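(* For any positive integer $k$ and any $\theta>0$ such that $\theta k<1$, $$\lim_{n\to\infty}\frac{\mathbb{E}(|c_n|^{2k})}{\mathbb{E}(|c_n|^2)^k}=\frac{\Gamma(1-k\theta)}{\Gamma(1-\theta)^k}\,k! .$$
   Context: Let $(\mathcal N_k)_{k\ge1}$ be i.i.d. standard complex normal random variables ($\mathbb{E}\mathcal N_k=0$, $\mathbb{E}\mathcal N_k^2=0$, $\mathbb{E}|\mathcal N_k|^2=1$). For $\theta>0$ and $n\ge0$, $c_n$ is the coefficient of $z^n$ in the power series expansion of $\exp\left(\sqrt\theta\sum_{k=1}^\infty\frac{z^k}{\sqrt k}\mathcal N_k\right)$ at $z=0$. $\Gamma$ is the Gamma function. *)

theory Defs
  imports "HOL-Probability.Probability" "HOL-Complex_Analysis.Complex_Analysis"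
begin

text \<open>
  A standard complex normal variable is \<open>(X + \<i> Y) / sqrt 2\<close> with \<open>X\<close>, \<open>Y\<close> independent real standard
  normals. The second parameter of \<^const>\<open>normal_density\<close> is the standard deviation, so both
  parts have variance \<open>1/2\<close>.
\<close>
definition std_complex_normal :: "'a measure \<Rightarrow> ('a \<Rightarrow> complex) \<Rightarrow> bool" where
  "std_complex_normal M Z \<longleftrightarrow>
     prob_space.indep_var M borel (\<lambda>\<omega>. Re (Z \<omega>)) borel (\<lambda>\<omega>. Im (Z \<omega>)) \<and>
     distributed M lborel (\<lambda>\<omega>. Re (Z \<omega>)) (normal_density 0 (1 / sqrt 2)) \<and>
     distributed M lborel (\<lambda>\<omega>. Im (Z \<omega>)) (normal_density 0 (1 / sqrt 2))"

definition log_series :: "real \<Rightarrow> (nat \<Rightarrow> complex) \<Rightarrow> complex fps" where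
  "log_series \<theta> a =
     Abs_fps (\<lambda>k. if k = 0 then 0 else of_real (sqrt \<theta>) * (a k / of_real (sqrt (real k))))"

text \<open>
  The power series is taken formally, so the coefficient is defined at every sample point, also on
  the null set where the Gaussian series has radius of convergence zero.
\<close>
definition chaos_coeff :: "real \<Rightarrow> (nat \<Rightarrow> 'a \<Rightarrow> complex) \<Rightarrow> nat \<Rightarrow> 'a \<Rightarrow> complex" where
  "chaos_coeff \<theta> N n \<omega> = fps_nth (fps_exp 1 oo log_series \<theta> (\<lambda>k. N k \<omega>)) n"

lemma log_series_nth_0 [simp]: "fps_nth (log_series \<theta> a) 0 = 0"
  by (simp add: log_series_def)

text \<open>
  Wherever the Gaussian series has positive radius of convergence, the formal coefficients are
  those of the Taylor expansion of the holomorphic function \<open>exp (\<dots>)\<close> at \<open>0\<close>.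
\<close>
lemma chaos_coeff_expansion:
  assumes "fps_conv_radius (log_series \<theta> (\<lambda>k. N k \<omega>)) > 0"
  shows "(\<lambda>z. exp (eval_fps (log_series \<theta> (\<lambda>k. N k \<omega>)) z)) has_fps_expansion
           Abs_fps (\<lambda>n. chaos_coeff \<theta> N n \<omega>)"
proof -
  have "eval_fps (log_series \<theta> (\<lambda>k. N k \<omega>)) has_fps_expansion log_series \<theta> (\<lambda>k. N k \<omega>)"
    using assms by (simp add: has_fps_expansion_def eventually_nhds_in_open)
  moreover have "exp has_fps_expansion fps_exp (1::complex)"
    using has_fps_expansion_exp[of "1::complex"] by simp
  ultimately have "(exp \<circ> eval_fps (log_series \<theta> (\<lambda>k. N k \<omega>))) has_fps_expansion
      (fps_exp 1 oo log_series \<theta> (\<lambda>k. N k \<omega>))"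
    by (intro has_fps_expansion_compose) auto
  moreover have "Abs_fps (\<lambda>n. chaos_coeff \<theta> N n \<omega>) = fps_exp 1 oo log_series \<theta> (\<lambda>k. N k \<omega>)"
    by (simp add: fps_eq_iff chaos_coeff_def)
  ultimately show ?thesis
    by (simp add: o_def)
qed

end

theory Submission imports Defs "HOL-Real_Asymp.Real_Asymp" begin

text \<open>
  Write \<open>d(a)\<close> for the coefficient of \<open>x\<^sup>a\<close> in \<open>(1 - x) powr (-\<theta>)\<close>. Since \<open>c\<^sub>n\<close> is a Fourier coefficient of
  the exponential of a Gaussian trigonometric polynomial, Fubini's theorem and
  \<open>E exp (x N + y cnj N) = exp (x y)\<close> express \<open>E |c\<^sub>n|\<^bsup>2k\<^esup>\<close> as a coefficient of \<open>\<Prod>i j. (1 - z\<^sub>i w\<^sub>j) powr (-\<theta>)\<close>,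
  that is, as the sum of \<open>\<Prod>i j. d (a\<^sub>i\<^sub>j)\<close> over the \<open>k \<times> k\<close> matrices of naturals whose rows and columns all
  sum to \<open>n\<close>. After division by \<open>d(n)\<^sup>k\<close> only matrices within bounded distance of \<open>n\<close> times a permutation
  matrix survive; by Hall's theorem each matrix has a diagonal with entries at least \<open>n / k\<^sup>2\<close>, which gives
  the dominating function. The limit is \<open>k!\<close> times a sum over balanced off-diagonal matrices, which is the
  constant term of \<open>\<Prod>i\<noteq>j. (1 - z\<^sub>i / z\<^sub>j) powr (-\<theta>)\<close>, i.e. the moment of order \<open>-\<theta>\<close> of
  \<open>X = \<Prod>i\<noteq>j. |1 - z\<^sub>i / z\<^sub>j|\<close> on the torus.

  Dyson's constant term identity gives the moments of natural order of the bounded variable \<open>X\<close>. They agree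
  with those of \<open>k\<^sup>k\<close> times a product of independent beta variables, and
  \<open>u powr (-\<theta>) = (\<Sum>n. d(n) (1 - u)\<^sup>n)\<close> has nonnegative coefficients, so the negative moments agree as well.
\<close>

section \<open>Integration over the torus\<close>

text \<open>The obstacle is the singularity at z_i = z_j. On the torus itself the series of (1 - z_i
  / z_j) powr (-\<theta>) does not converge absolutely, so each z_i / z_j is first damped by r < 1.
  As r tends to 1, the matrix side increases and the torus side is dominated by a multiple of the
  undamped integrand; the finiteness of the moment of order -\<theta> is therefore proved before the
  matrix sum is known to converge.

  Dyson's identity speaks of natural exponents only. The passage to -\<theta> is a comparison with a
  second variable whose real moments are all explicit, term by term in a series of nonnegative
  terms. For k > 1, the condition \<theta> k < 1 says that the most singular Beta factor, with first
  parameter 1 / k, has a moment of order -\<theta>.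

  Convergence of the Gaussian series is never an issue: c_n depends on N_1, ..., N_n only, so the
  torus integrals have a polynomial in the exponent. Dividing by d(n)^k is the right normalisation
  because E |c_n|^2 = d(n), the case k = 1. The factor k! counts the permutations near which the
  surviving matrices lie.\<close>

definition angle :: "real measure" where
  "angle = density lborel (\<lambda>t. ennreal (indicator {0..2 * pi} t / (2 * pi)))"

definition torus :: "'i set \<Rightarrow> ('i \<Rightarrow> real) measure" where
  "torus I = PiM I (\<lambda>_. angle)"

lemma borel_measurable_cis [measurable]:
  "f \<in> borel_measurable M \<Longrightarrow> (\<lambda>x. cis (f x)) \<in> borel_measurable M"
  unfolding cis_conv_exp by measurable

lemma sets_angle [simp, measurable_cong]: "sets angle = sets borel"
  by (simp add: angle_def)

lemma space_angle [simp]: "space angle = UNIV"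
  by (simp add: angle_def)

lemma prob_space_angle: "prob_space angle"
proof
  have "emeasure angle (space angle) = (\<integral>\<^sup>+t. ennreal (1 / (2 * pi)) * indicator {0..2 * pi} t \<partial>lborel)"
    unfolding angle_def
    by (subst emeasure_density) (auto intro!: nn_integral_cong split: split_indicator)
  also have "\<dots> = ennreal (1 / (2 * pi)) * ennreal (2 * pi)"
    by (subst nn_integral_cmult_indicator) auto
  also have "\<dots> = 1"
    by (subst ennreal_mult'[symmetric]) auto
  finally show "emeasure angle (space angle) = 1" .
qed

interpretation angle: prob_space angle
  by (rule prob_space_angle)

interpretation angles: product_sigma_finite "\<lambda>_. angle"
  by standard

lemma prob_space_torus: "prob_space (torus I)"
  unfolding torus_def by (rule prob_space_PiM) (rule prob_space_angle)

lemma measurable_torus_component [measurable (raw)]: "i \<in> I \<Longrightarrow> (\<lambda>t. t i) \<in> borel_measurable (torus I)"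
  unfolding torus_def by measurable

lemma integral_cis_angle:
  fixes m :: int
  shows "(\<integral>t. cis (of_int m * t) \<partial>angle) = of_bool (m = 0)"
proof -
  have "(\<integral>t. cis (of_int m * t) \<partial>angle) =
      (\<integral>t. (indicator {0..2 * pi} t / (2 * pi)) *\<^sub>R cis (of_int m * t) \<partial>lborel)"
    unfolding angle_def by (subst integral_density) (auto simp: cis_conv_exp)
  also have "\<dots> = (\<integral>t. (1 / (2 * pi)) *\<^sub>R (indicator {0..2 * pi} t *\<^sub>R cis (of_int m * t)) \<partial>lborel)"
    by simp
  also have "\<dots> = (1 / (2 * pi)) *\<^sub>R (\<integral>t. indicator {0..2 * pi} t *\<^sub>R cis (of_int m * t) \<partial>lborel)"
    by (rule integral_scaleR_right)
  also have "(\<integral>t. indicator {0..2 * pi} t *\<^sub>R cis (of_int m * t) \<partial>lborel) = of_bool (m = 0) * (2 * pi)"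
  proof (cases "m = 0")
    case True
    have "has_bochner_integral lborel (\<lambda>t. indicator {0..2 * pi} t *\<^sub>R (1::complex))
        (complex_of_real (2 * pi) - complex_of_real 0)"
      by (intro has_bochner_integral_FTC_Icc) (auto intro!: derivative_eq_intros)
    with True show ?thesis
      by (simp add: has_bochner_integral_integral_eq scaleR_conv_of_real)
  next
    case False
    define F where "F = (\<lambda>t. cis (of_int m * t) / (\<i> * of_int m))"
    have "has_bochner_integral lborel (\<lambda>t. indicator {0..2 * pi} t *\<^sub>R cis (of_int m * t))
        (F (2 * pi) - F 0)"
    proof (intro has_bochner_integral_FTC_Icc)
      fix t :: real
      have "((\<lambda>z. exp (\<i> * (of_int m * z)) / (\<i> * of_int m)) has_field_derivative
          exp (\<i> * (of_int m * complex_of_real t))) (at (complex_of_real t))"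
        using False by (auto intro!: derivative_eq_intros simp: field_simps)
      hence "((\<lambda>t. exp (\<i> * (of_int m * complex_of_real t)) / (\<i> * of_int m)) has_vector_derivative
          exp (\<i> * (of_int m * complex_of_real t))) (at t within {0..2 * pi})"
        by (rule has_vector_derivative_real_field)
      thus "(F has_vector_derivative cis (of_int m * t)) (at t within {0..2 * pi})"
        by (simp add: F_def cis_conv_exp)
    qed (auto intro!: continuous_intros)
    moreover have "F (2 * pi) = F 0"
      using cis_multiple_2pi[of "of_int m"] by (simp add: F_def mult_ac)
    ultimately show ?thesis
      using False by (simp add: has_bochner_integral_integral_eq)
  qed
  finally show ?thesis by (simp add: scaleR_conv_of_real)
qed

lemma cis_sum: "finite I \<Longrightarrow> cis (\<Sum>i\<in>I. f i) = (\<Prod>i\<in>I. cis (f i))"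
  by (induction I rule: finite_induct) (auto simp: cis_mult[symmetric])

lemma integral_cis_torus:
  fixes m :: "'i \<Rightarrow> int"
  assumes "finite I"
  shows "(\<integral>t. cis (\<Sum>i\<in>I. of_int (m i) * t i) \<partial>torus I) = of_bool (\<forall>i\<in>I. m i = 0)"
proof -
  have "(\<integral>t. cis (\<Sum>i\<in>I. of_int (m i) * t i) \<partial>torus I) =
      (\<integral>t. (\<Prod>i\<in>I. cis (of_int (m i) * t i)) \<partial>torus I)"
    using assms by (simp add: cis_sum)
  also have "\<dots> = (\<Prod>i\<in>I. \<integral>x. cis (of_int (m i) * x) \<partial>angle)"
    unfolding torus_def using assms
    by (intro angles.product_integral_prod angle.integrable_const_bound[of _ 1])
      simp_all
  also have "\<dots> = of_bool (\<forall>i\<in>I. m i = 0)"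
    using assms by (simp add: integral_cis_angle)
  finally show ?thesis .
qed

text \<open>Truncating every series at N leaves a finite sum of characters, and orthogonality keeps
  the exponent vectors that match \<open>m\<close>; dominated convergence, with the product of the
  absolute sums as bound, removes the truncation. A limit over boxes is stated because infinitely
  many vectors may match, and the exponents are integers because variables also occur
  inverted.\<close>

lemma torus_coefficient_extraction:
  fixes g :: "'p \<Rightarrow> nat \<Rightarrow> complex" and e :: "'p \<Rightarrow> 'i \<Rightarrow> int" and m :: "'i \<Rightarrow> int"
  assumes fin: "finite I" "finite P" and summ: "\<And>p. p \<in> P \<Longrightarrow> summable (\<lambda>n. norm (g p n))"
  shows "(\<lambda>N. \<Sum>a | a \<in> P \<rightarrow>\<^sub>E {..N} \<and> (\<forall>i\<in>I. (\<Sum>p\<in>P. int (a p) * e p i) = m i). \<Prod>p\<in>P. g p (a p))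
    \<longlonglongrightarrow> (\<integral>t. cis (- (\<Sum>i\<in>I. of_int (m i) * t i)) *
            (\<Prod>p\<in>P. \<Sum>n. g p n * cis (\<Sum>i\<in>I. of_int (e p i) * t i) ^ n) \<partial>torus I)"
proof -
  interpret prob_space "torus I" by (rule prob_space_torus)
  define M where "M p t = cis (\<Sum>i\<in>I. of_int (e p i) * t i)" for p t
  define M0 where "M0 t = cis (- (\<Sum>i\<in>I. of_int (m i) * t i))" for t
  have M_meas [measurable]: "M p \<in> borel_measurable (torus I)" "M0 \<in> borel_measurable (torus I)" for p
    unfolding M_def M0_def by measurable
  have norm_M [simp]: "norm (M p t) = 1" "norm (M0 t) = 1" for p t
    by (auto simp: M_def M0_def)
  define h where "h N t = M0 t * (\<Prod>p\<in>P. \<Sum>n\<le>N. g p n * M p t ^ n)" for N t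
  have h_eq: "(\<integral>t. h N t \<partial>torus I) =
      (\<Sum>a | a \<in> P \<rightarrow>\<^sub>E {..N} \<and> (\<forall>i\<in>I. (\<Sum>p\<in>P. int (a p) * e p i) = m i). \<Prod>p\<in>P. g p (a p))" for N
  proof -
    have mono: "M0 t * (\<Prod>p\<in>P. M p t ^ a p) =
        cis (\<Sum>i\<in>I. of_int ((\<Sum>p\<in>P. int (a p) * e p i) - m i) * t i)" for a t
    proof -
      have "(\<Prod>p\<in>P. M p t ^ a p) = cis (\<Sum>p\<in>P. of_nat (a p) * (\<Sum>i\<in>I. of_int (e p i) * t i))"
        by (simp add: M_def Complex.DeMoivre cis_sum[OF fin(2)])
      also have "(\<Sum>p\<in>P. of_nat (a p) * (\<Sum>i\<in>I. of_int (e p i) * t i)) =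
          (\<Sum>i\<in>I. of_int (\<Sum>p\<in>P. int (a p) * e p i) * t i)"
        by (simp add: sum_distrib_left sum_distrib_right mult_ac) (rule sum.swap)
      finally show ?thesis
        by (simp add: M0_def cis_mult left_diff_distrib sum_subtractf)
    qed
    have "h N t = (\<Sum>a\<in>P \<rightarrow>\<^sub>E {..N}. (\<Prod>p\<in>P. g p (a p)) *
        cis (\<Sum>i\<in>I. of_int ((\<Sum>p\<in>P. int (a p) * e p i) - m i) * t i))" for t
      unfolding mono[symmetric] using fin
      by (simp add: h_def prod_sum_PiE prod.distrib sum_distrib_left mult_ac)
    hence "(\<integral>t. h N t \<partial>torus I) = (\<integral>t. (\<Sum>a\<in>P \<rightarrow>\<^sub>E {..N}. (\<Prod>p\<in>P. g p (a p)) *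
        cis (\<Sum>i\<in>I. of_int ((\<Sum>p\<in>P. int (a p) * e p i) - m i) * t i)) \<partial>torus I)"
      by simp
    also have "\<dots> = (\<Sum>a\<in>P \<rightarrow>\<^sub>E {..N}. (\<integral>t. (\<Prod>p\<in>P. g p (a p)) *
        cis (\<Sum>i\<in>I. of_int ((\<Sum>p\<in>P. int (a p) * e p i) - m i) * t i) \<partial>torus I))"
    proof (rule Bochner_Integration.integral_sum)
      fix a
      show "integrable (torus I) (\<lambda>t. (\<Prod>p\<in>P. g p (a p)) *
        cis (\<Sum>i\<in>I. of_int ((\<Sum>p\<in>P. int (a p) * e p i) - m i) * t i))"
        by (intro integrable_const_bound[of _ "norm (\<Prod>p\<in>P. g p (a p))"])
           (auto simp: norm_mult)
    qed
    also have "\<dots> = (\<Sum>a\<in>P \<rightarrow>\<^sub>E {..N}. (\<Prod>p\<in>P. g p (a p)) *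
        of_bool (\<forall>i\<in>I. (\<Sum>p\<in>P. int (a p) * e p i) - m i = 0))"
      using fin by (simp only: integral_mult_right_zero integral_cis_torus)
    also have "\<dots> = (\<Sum>a | a \<in> P \<rightarrow>\<^sub>E {..N} \<and> (\<forall>i\<in>I. (\<Sum>p\<in>P. int (a p) * e p i) = m i). \<Prod>p\<in>P. g p (a p))"
      using fin by (intro sum.mono_neutral_cong_right) (auto intro!: finite_PiE)
    finally show ?thesis .
  qed
  define H where "H t = M0 t * (\<Prod>p\<in>P. \<Sum>n. g p n * M p t ^ n)" for t
  have summable: "summable (\<lambda>n. g p n * M p t ^ n)" if "p \<in> P" for p t
    using summ[OF that] by (rule summable_norm_cancel[OF summable_norm_comparison_test, rotated])
      (auto simp: norm_mult norm_power)
  have "(\<lambda>N. \<integral>t. h N t \<partial>torus I) \<longlonglongrightarrow> (\<integral>t. H t \<partial>torus I)"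
  proof (rule integral_dominated_convergence)
    show "integrable (torus I) (\<lambda>_. \<Prod>p\<in>P. \<Sum>n. norm (g p n))" by simp
    show "AE t in torus I. (\<lambda>N. h N t) \<longlonglongrightarrow> H t"
      unfolding h_def H_def using summable
      by (intro AE_I2 tendsto_intros summable_LIMSEQ') auto
    show "AE t in torus I. norm (h N t) \<le> (\<Prod>p\<in>P. \<Sum>n. norm (g p n))" for N
    proof (rule AE_I2)
      fix t
      have "norm (h N t) = (\<Prod>p\<in>P. norm (\<Sum>n\<le>N. g p n * M p t ^ n))"
        by (simp add: h_def norm_mult prod_norm)
      also have "\<dots> \<le> (\<Prod>p\<in>P. \<Sum>n. norm (g p n))"
      proof (intro prod_mono conjI norm_ge_zero)
        fix p assume p: "p \<in> P"
        have "norm (\<Sum>n\<le>N. g p n * M p t ^ n) \<le> (\<Sum>n\<le>N. norm (g p n * M p t ^ n))"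
          by (rule norm_sum)
        also have "\<dots> = (\<Sum>n\<le>N. norm (g p n))"
          by (simp add: norm_mult norm_power)
        also have "\<dots> \<le> (\<Sum>n. norm (g p n))"
          using summ[OF p] by (intro sum_le_suminf) auto
        finally show "norm (\<Sum>n\<le>N. g p n * M p t ^ n) \<le> (\<Sum>n. norm (g p n))" .
      qed
      finally show "norm (h N t) \<le> (\<Prod>p\<in>P. \<Sum>n. norm (g p n))" .
    qed
    show "H \<in> borel_measurable (torus I)"
      unfolding H_def by measurable
    show "h N \<in> borel_measurable (torus I)" for N
      unfolding h_def by measurable
  qed
  thus ?thesis
    by (simp add: h_eq) (simp add: H_def M_def M0_def)
qed

section \<open>Dyson's constant term identity\<close>

text \<open>Lagrange interpolation of the constant 1 at the nodes z_i, evaluated at 0. The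
  interpolant is \<open>Q\<close>, whose degree is below the number of nodes, so it equals
  1.\<close>

lemma sum_prod_divide_diff_eq_1:
  fixes z :: "'i \<Rightarrow> complex"
  assumes "finite I" "I \<noteq> {}" "inj_on z I"
  shows "(\<Sum>i\<in>I. \<Prod>j\<in>I - {i}. z j / (z j - z i)) = 1"
proof -
  define Q where "Q = (\<Sum>i\<in>I. smult (\<Prod>j\<in>I - {i}. 1 / (z i - z j)) (\<Prod>j\<in>I - {i}. [:- z j, 1:]))"
  have card: "card I > 0"
    using assms by (simp add: card_gt_0_iff)
  have "degree Q < card (z ` I)"
  proof -
    have "degree Q \<le> card I - 1"
      unfolding Q_def
    proof (intro degree_sum_le order.trans[OF degree_smult_le])
      fix i assume "i \<in> I"
      have "degree (\<Prod>j\<in>I - {i}. [:- z j, 1:]) \<le> (\<Sum>j\<in>I - {i}. degree [:- z j, 1:])"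
        using degree_prod_sum_le[of "I - {i}" "\<lambda>j. [:- z j, 1:]"] assms by (simp add: o_def)
      thus "degree (\<Prod>j\<in>I - {i}. [:- z j, 1:]) \<le> card I - 1"
        using assms \<open>i \<in> I\<close> by simp
    qed (use assms in auto)
    thus ?thesis using card assms by (simp add: card_image)
  qed
  moreover have "poly Q x = poly 1 x" if "x \<in> z ` I" for x
  proof -
    from that obtain l where l: "l \<in> I" "x = z l" by auto
    have "poly Q x = (\<Sum>i\<in>I. \<Prod>j\<in>I - {i}. (z l - z j) / (z i - z j))"
      by (simp add: Q_def l poly_sum poly_prod prod.distrib[symmetric])
    also have "\<dots> = (\<Sum>i\<in>I. if i = l then 1 else 0)"
    proof (intro sum.cong refl)
      fix i assume i: "i \<in> I"
      show "(\<Prod>j\<in>I - {i}. (z l - z j) / (z i - z j)) = (if i = l then 1 else 0)"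
      proof (cases "i = l")
        case True
        thus ?thesis
          using assms(3) l by (intro trans[OF prod.neutral]) (auto dest: inj_onD)
      next
        case False
        thus ?thesis
          using assms l by (auto simp: prod_zero_iff)
      qed
    qed
    finally show ?thesis using l assms by simp
  qed
  ultimately have "Q = 1"
    using card assms by (intro poly_eqI_degree[of "z ` I"]) (auto simp: card_image)
  hence "poly Q 0 = 1" by simp
  moreover have "poly Q 0 = (\<Sum>i\<in>I. \<Prod>j\<in>I - {i}. z j / (z j - z i))"
  proof -
    have "1 / (z i - z j) * - z j = z j / (z j - z i)" for i j
      using minus_divide_divide[of "z j" "z j - z i"] by simp
    thus ?thesis
      by (simp only: Q_def poly_sum poly_smult poly_prod prod.distrib[symmetric] poly_pCons poly_0) simp
  qed
  ultimately show ?thesis by simp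
qed

definition dyson_factor :: "'i set \<Rightarrow> 'i \<Rightarrow> ('i \<Rightarrow> real) \<Rightarrow> complex" where
  "dyson_factor I i t = (\<Prod>j\<in>I - {i}. 1 - cis (t i - t j))"

definition dyson :: "'i set \<Rightarrow> ('i \<Rightarrow> nat) \<Rightarrow> ('i \<Rightarrow> real) \<Rightarrow> complex" where
  "dyson I a t = (\<Prod>i\<in>I. dyson_factor I i t ^ a i)"

text \<open>Good's recursion: the interpolation identity says that the reciprocals of the Dyson
  factors sum to 1, and this is multiplied by the whole product. Positive exponents make
  \<open>a i - 1\<close> a genuine predecessor.\<close>

lemma dyson_recursion:
  assumes I: "finite I" "I \<noteq> {}" and pos: "\<And>i. i \<in> I \<Longrightarrow> a i > 0"
  shows "dyson I a t = (\<Sum>i\<in>I. dyson I (a(i := a i - 1)) t)"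
proof -
  let ?D = "\<lambda>i. dyson_factor I i t"
  have upd: "dyson I (a(i := a i - 1)) t = ?D i ^ (a i - 1) * (\<Prod>l\<in>I - {i}. ?D l ^ a l)" if "i \<in> I" for i
    unfolding dyson_def using I that by (subst prod.remove[of I i]) auto
  have all: "dyson I a t = ?D i * dyson I (a(i := a i - 1)) t" if "i \<in> I" for i
    unfolding upd[OF that] unfolding dyson_def using I that pos[OF that]
    by (subst prod.remove[of I i]) (auto simp: power_eq_if)
  show ?thesis
  proof (cases "inj_on (\<lambda>i. cis (t i)) I")
    case True
    have D: "1 / ?D i = (\<Prod>j\<in>I - {i}. cis (t j) / (cis (t j) - cis (t i)))" for i
    proof -
      have "1 / (1 - cis (x - y)) = cis y / (cis y - cis x)" for x y
      proof -
        have "1 - cis (x - y) = (cis y - cis x) / cis y"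
          unfolding cis_divide[symmetric] by (simp add: diff_divide_distrib)
        thus ?thesis by simp
      qed
      hence "(\<Prod>j\<in>I - {i}. 1 / (1 - cis (t i - t j))) = (\<Prod>j\<in>I - {i}. cis (t j) / (cis (t j) - cis (t i)))"
        by simp
      thus ?thesis
        by (simp only: dyson_factor_def prod_dividef prod.neutral_const)
    qed
    have nz: "?D i \<noteq> 0" if "i \<in> I" for i
    proof
      assume "?D i = 0"
      then obtain j where "j \<in> I" "j \<noteq> i" "1 - cis (t i - t j) = 0"
        unfolding dyson_factor_def using I by (auto simp: prod_zero_iff)
      hence "cis (t i) = cis (t j)"
        by (simp add: cis_divide[symmetric] field_simps)
      thus False using True \<open>j \<in> I\<close> \<open>j \<noteq> i\<close> that by (auto dest: inj_onD)
    qed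
    have "(\<Sum>i\<in>I. dyson I (a(i := a i - 1)) t) = (\<Sum>i\<in>I. dyson I a t * (1 / ?D i))"
      using nz by (intro sum.cong refl) (simp add: all)
    also have "\<dots> = dyson I a t * (\<Sum>i\<in>I. 1 / ?D i)"
      by (simp add: sum_distrib_left)
    also have "(\<Sum>i\<in>I. 1 / ?D i) = 1"
      unfolding D by (rule sum_prod_divide_diff_eq_1) (use I True in auto)
    finally show ?thesis by (simp only: mult_1_right)
  next
    case False
    then obtain p q where pq: "p \<in> I" "q \<in> I" "p \<noteq> q" "cis (t p) = cis (t q)"
      by (auto simp: inj_on_def)
    have zero: "?D p = 0" "?D q = 0"
      unfolding dyson_factor_def using I pq
      by (intro prod_zero bexI[of _ q] bexI[of _ p]; simp add: cis_divide[symmetric])+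
    have "dyson I (a(i := a i - 1)) t = 0" if "i \<in> I" for i
    proof (cases "i = p")
      case True
      thus ?thesis
        unfolding upd[OF that] using I pq zero pos[of q] by (auto intro!: prod_zero bexI[of _ q])
    next
      case False
      thus ?thesis
        unfolding upd[OF that] using I pq zero pos[of p] by (auto intro!: prod_zero bexI[of _ p])
    qed
    thus ?thesis using all[OF pq(1)] zero by simp
  qed
qed

lemma measurable_dyson [measurable]: "dyson I a \<in> borel_measurable (torus I)"
proof -
  have "(\<lambda>t. dyson I a t) \<in> borel_measurable (torus I)"
    unfolding dyson_def dyson_factor_def by measurable
  thus ?thesis by simp
qed

lemma norm_one_minus_cis_le: "norm (1 - cis x) \<le> 2"
  using norm_triangle_ineq4[of 1 "cis x"] by simp

lemma integrable_dyson:
  assumes "finite I"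
  shows "integrable (torus I) (dyson I a)"
proof -
  interpret prob_space "torus I" by (rule prob_space_torus)
  show ?thesis
  proof (rule integrable_const_bound[of _ "\<Prod>i\<in>I. (\<Prod>j\<in>I - {i}. 2) ^ a i"])
    show "AE t in torus I. norm (dyson I a t) \<le> (\<Prod>i\<in>I. (\<Prod>j\<in>I - {i}. 2) ^ a i)"
      unfolding dyson_def dyson_factor_def prod_norm[symmetric] norm_power
      by (intro AE_I2 prod_mono conjI power_mono prod_nonneg zero_le_power norm_one_minus_cis_le) auto
  qed auto
qed

lemma integral_poly_cis:
  shows "(\<integral>y. poly p (cis (- y)) \<partial>angle) = poly p 0"
proof -
  have "(\<integral>y. poly p (cis (- y)) \<partial>angle) = (\<integral>y. (\<Sum>n\<le>degree p. coeff p n * cis (of_int (- int n) * y)) \<partial>angle)"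
    by (simp add: poly_altdef Complex.DeMoivre)
  also have "\<dots> = (\<Sum>n\<le>degree p. \<integral>y. coeff p n * cis (of_int (- int n) * y) \<partial>angle)"
    by (rule Bochner_Integration.integral_sum)
       (rule angle.integrable_const_bound[of _ "norm (coeff p n)" for n], auto simp: norm_mult)
  also have "\<dots> = (\<Sum>n\<le>degree p. if n = 0 then coeff p n else 0)"
    by (intro sum.cong refl) (simp only: integral_mult_right_zero integral_cis_angle, simp)
  also have "\<dots> = poly p 0"
    by (simp add: poly_0_coeff_0)
  finally show ?thesis .
qed

text \<open>As its own factor has exponent 0, the variable z_i enters only through the factors 1 -
  z_j / z_i. The integrand is thus \<open>dyson J a\<close> times a polynomial in cis (-y) with
  constant term 1, and the integral over y picks out that term.\<close>

lemma integral_dyson_insert: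
  assumes J: "finite J" "i \<notin> J" and a: "a i = 0"
  shows "(\<integral>t. dyson (insert i J) a t \<partial>torus (insert i J)) = (\<integral>t. dyson J a t \<partial>torus J)"
proof -
  have inner: "(\<integral>y. dyson (insert i J) a (x(i := y)) \<partial>angle) = dyson J a x" for x
  proof -
    define p where "p = (\<Prod>j\<in>J. [:1, - cis (x j):] ^ a j)"
    have "dyson_factor (insert i J) j (x(i := y)) = (1 - cis (x j) * cis (- y)) * dyson_factor J j x"
      if "j \<in> J" for j y
    proof -
      have "(\<Prod>l\<in>J - {j}. 1 - cis ((x(i := y)) j - (x(i := y)) l)) = (\<Prod>l\<in>J - {j}. 1 - cis (x j - x l))"
        using J that by (intro prod.cong refl) auto
      moreover have "insert i J - {j} = insert i (J - {j})" "j \<noteq> i" using J that by auto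
      ultimately show ?thesis
        unfolding dyson_factor_def using J that by (simp add: cis_mult)
    qed
    hence "dyson (insert i J) a (x(i := y)) = dyson J a x * poly p (cis (- y))" for y
      using J a by (simp add: dyson_def p_def poly_prod power_mult_distrib prod.distrib mult_ac)
    hence "(\<integral>y. dyson (insert i J) a (x(i := y)) \<partial>angle) = dyson J a x * poly p 0"
      by (simp add: integral_poly_cis)
    thus ?thesis by (simp add: p_def poly_prod)
  qed
  have "(\<integral>t. dyson (insert i J) a t \<partial>torus (insert i J)) =
      (\<integral>x. (\<integral>y. dyson (insert i J) a (x(i := y)) \<partial>angle) \<partial>torus J)"
    using integrable_dyson[of "insert i J" a] J unfolding torus_def
    by (intro angles.product_integral_insert) auto
  thus ?thesis by (simp only: inner)
qed

text \<open>Both sides obey \<open>dyson_recursion\<close>, the right one by the Pascal rule for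
  multinomial coefficients, and both allow an index of exponent 0 to be dropped. Dropping an index
  does not lower the sum of the exponents, hence the summand \<open>card I\<close> in the induction
  measure.\<close>

theorem dyson_constant_term:
  assumes "finite I"
  shows "(\<integral>t. dyson I a t \<partial>torus I) = fact (sum a I) / (\<Prod>i\<in>I. fact (a i))"
  using assms
proof (induction "sum a I + card I" arbitrary: I a rule: less_induct)
  case less
  interpret prob_space "torus I" by (rule prob_space_torus)
  consider "I = {}" | i where "i \<in> I" "a i = 0" | "I \<noteq> {}" "\<And>i. i \<in> I \<Longrightarrow> a i > 0"
    by blast
  thus ?case
  proof cases
    case 1
    thus ?thesis using prob_space by (simp add: dyson_def[abs_def])
  next
    case 2
    define J where "J = I - {i}"
    have J: "finite J" "i \<notin> J" "I = insert i J"
      using less.prems 2 by (auto simp: J_def)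
    have "(\<integral>t. dyson I a t \<partial>torus I) = (\<integral>t. dyson J a t \<partial>torus J)"
      unfolding J(3) using J 2 by (intro integral_dyson_insert)
    also have "\<dots> = fact (sum a J) / (\<Prod>i\<in>J. fact (a i))"
      using J by (intro less.hyps) auto
    finally show ?thesis using J 2 by simp
  next
    case 3
    have pos: "sum a I > 0"
      using less.prems 3 by (metis sum_pos)
    have sum_upd: "sum (a(i := a i - 1)) I = sum a I - 1" if "i \<in> I" for i
      using less.prems that 3(2)[OF that]
      by (simp add: sum.remove[of I i])
    have "(\<integral>t. dyson I a t \<partial>torus I) = (\<Sum>i\<in>I. \<integral>t. dyson I (a(i := a i - 1)) t \<partial>torus I)"
      unfolding Bochner_Integration.integral_sum[OF integrable_dyson[OF less.prems], symmetric]
      by (intro Bochner_Integration.integral_cong refl dyson_recursion less.prems 3)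
    also have "\<dots> = (\<Sum>i\<in>I. fact (sum a I - 1) * of_nat (a i) / (\<Prod>i\<in>I. fact (a i)))"
    proof (intro sum.cong refl)
      fix i assume i: "i \<in> I"
      have "(\<integral>t. dyson I (a(i := a i - 1)) t \<partial>torus I) =
          fact (sum a I - 1) / (\<Prod>l\<in>I. fact ((a(i := a i - 1)) l))"
        using less.hyps[of "a(i := a i - 1)" I] less.prems pos sum_upd[OF i] by simp
      moreover have "(\<Prod>l\<in>I. fact (a l)) = of_nat (a i) * (\<Prod>l\<in>I. fact ((a(i := a i - 1)) l) :: complex)"
        using less.prems i 3(2)[OF i] fact_reduce[of "a i", where 'a = complex]
        by (simp add: prod.remove[of I i])
      ultimately show "(\<integral>t. dyson I (a(i := a i - 1)) t \<partial>torus I) =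
          fact (sum a I - 1) * of_nat (a i) / (\<Prod>i\<in>I. fact (a i))"
        using 3(2)[OF i] by simp
    qed
    also have "\<dots> = of_nat (sum a I) * fact (sum a I - 1) / (\<Prod>i\<in>I. fact (a i))"
      by (simp add: sum_divide_distrib[symmetric] sum_distrib_left[symmetric] sum_distrib_right mult_ac)
    also have "of_nat (sum a I) * fact (sum a I - 1) = (fact (sum a I) :: complex)"
      using fact_reduce[OF pos, where 'a = complex] by simp
    finally show ?thesis .
  qed
qed

section \<open>Moments of negative order\<close>

definition neg_binom :: "real \<Rightarrow> nat \<Rightarrow> real" where
  "neg_binom \<theta> n = pochhammer \<theta> n / fact n"

lemma neg_binom_0 [simp]: "neg_binom \<theta> 0 = 1"
  by (simp add: neg_binom_def)

lemma neg_binom_Suc: "neg_binom \<theta> (Suc n) = neg_binom \<theta> n * ((\<theta> + n) / (n + 1))"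
  by (simp add: neg_binom_def pochhammer_Suc)

lemma neg_binom_pos: "\<theta> > 0 \<Longrightarrow> neg_binom \<theta> n > 0"
  by (auto simp: neg_binom_def intro!: divide_pos_pos pochhammer_pos)

lemma neg_binom_eq_gbinomial: "neg_binom \<theta> n = (-1) ^ n * ((-\<theta>) gchoose n)"
  by (simp add: neg_binom_def gbinomial_pochhammer power_mult_distrib[symmetric])

lemma neg_binom_sums:
  assumes "0 < u" "u \<le> 1"
  shows "(\<lambda>n. neg_binom \<theta> n * (1 - u) ^ n) sums (u powr (-\<theta>))"
proof -
  have "(\<lambda>n. ((-\<theta>) gchoose n) * (u - 1) ^ n) sums (1 + (u - 1)) powr (-\<theta>)"
    by (rule gen_binomial_real) (use assms in auto)
  moreover have "neg_binom \<theta> n * (1 - u) ^ n = ((-\<theta>) gchoose n) * (u - 1) ^ n" for n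
  proof -
    have "(u - 1) ^ n = (-1) ^ n * (1 - u) ^ n"
      by (simp flip: power_mult_distrib)
    thus ?thesis by (simp add: neg_binom_eq_gbinomial)
  qed
  ultimately show ?thesis by simp
qed

text \<open>At u = 0 the series diverges although \<open>0 powr (-\<theta>)\<close> is 0 in HOL, so
  this point is separated. The value infinity there later turns a finite integral into positivity
  almost everywhere.\<close>

lemma suminf_neg_binom_ennreal:
  assumes \<theta>: "\<theta> > 0" and u: "0 \<le> u" "u \<le> 1"
  shows "(\<Sum>n. ennreal (neg_binom \<theta> n * (1 - u) ^ n)) = (if u = 0 then \<infinity> else ennreal (u powr (-\<theta>)))"
proof -
  have nonneg: "0 \<le> neg_binom \<theta> n * (1 - v) ^ n" if "v \<le> 1" for n v
    using neg_binom_pos[OF \<theta>, of n] that by (intro mult_nonneg_nonneg) auto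
  have pos: "(\<Sum>n. ennreal (neg_binom \<theta> n * (1 - v) ^ n)) = ennreal (v powr (-\<theta>))" if "0 < v" "v \<le> 1" for v
    using neg_binom_sums[of v \<theta>] that nonneg by (intro suminf_ennreal_eq) auto
  show ?thesis
  proof (cases "u = 0")
    case True
    have "of_nat n \<le> (\<Sum>n. ennreal (neg_binom \<theta> n * (1 - u) ^ n))" for n
    proof -
      \<comment> \<open>Chosen so that \<open>v powr (-\<theta>)\<close> is 1 + n. Termwise, the
        series at 0 dominates the series at v.\<close>
      define v where "v = (1 + real n) powr (- (1 / \<theta>))"
      have v: "0 < v" "v \<le> 1"
        using \<theta> by (auto simp: v_def powr_minus field_simps intro!: ge_one_powr_ge_zero)
      have "of_nat n = ennreal (real n)"
        by (simp add: ennreal_of_nat_eq_real_of_nat)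
      also have "\<dots> \<le> ennreal (v powr (-\<theta>))"
        using \<theta> by (intro ennreal_leI) (simp add: v_def powr_powr)
      also have "\<dots> = (\<Sum>n. ennreal (neg_binom \<theta> n * (1 - v) ^ n))"
        using v by (simp add: pos)
      also have "\<dots> \<le> (\<Sum>n. ennreal (neg_binom \<theta> n * (1 - u) ^ n))"
        using v True neg_binom_pos[OF \<theta>]
        by (intro suminf_le ennreal_leI mult_left_mono power_mono) (auto intro: less_imp_le)
      finally show ?thesis .
    qed
    hence "(\<Sum>n. ennreal (neg_binom \<theta> n * (1 - u) ^ n)) = \<infinity>"
      by (metis ennreal_SUP_of_nat_eq_top top.extremum_unique SUP_least infinity_ennreal_def)
    thus ?thesis using True by simp
  next
    case False
    thus ?thesis using pos[of u] u by simp
  qed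
qed

lemma (in prob_space) expectation_one_minus_power:
  assumes [measurable]: "X \<in> borel_measurable M" and X: "AE x in M. 0 \<le> X x \<and> X x \<le> (1::real)"
  shows "expectation (\<lambda>x. (1 - X x) ^ n) = (\<Sum>j\<le>n. of_nat (n choose j) * (-1) ^ j * expectation (\<lambda>x. X x ^ j))"
proof -
  have int: "integrable M (\<lambda>x. X x ^ j)" for j
  proof (rule integrable_const_bound[of _ 1])
    show "AE x in M. norm (X x ^ j) \<le> 1"
      using X by eventually_elim (auto intro!: power_le_one)
  qed simp
  have "(1 - X x) ^ n = (\<Sum>j\<le>n. of_nat (n choose j) * (-1) ^ j * X x ^ j)" for x
    using binomial_ring[of "- X x" 1 n] by (simp add: power_minus[of "X x"] mult_ac)
  thus ?thesis using int by simp
qed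

text \<open>Exchanging sum and integral turns both sides into series in the moments of 1 - X and 1 -
  Y, which the natural moments determine. Positivity of \<open>X\<close> is a conclusion: a finite
  total excludes the value 0, where the series is infinite.\<close>

lemma neg_powr_expectation_eq:
  fixes X :: "'a \<Rightarrow> real" and Y :: "'b \<Rightarrow> real"
  assumes "prob_space M" "prob_space N"
    and [measurable]: "X \<in> borel_measurable M" "Y \<in> borel_measurable N"
    and X: "AE x in M. 0 \<le> X x \<and> X x \<le> 1" and Y: "AE y in N. 0 < Y y \<and> Y y \<le> 1"
    and moments: "\<And>m. (\<integral>x. X x ^ m \<partial>M) = (\<integral>y. Y y ^ m \<partial>N)"
    and \<theta>: "\<theta> > 0" and fin: "(\<integral>\<^sup>+y. ennreal (Y y powr (-\<theta>)) \<partial>N) < \<infinity>"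
  shows "AE x in M. 0 < X x"
    and "(\<integral>\<^sup>+x. ennreal (X x powr (-\<theta>)) \<partial>M) = (\<integral>\<^sup>+y. ennreal (Y y powr (-\<theta>)) \<partial>N)"
proof -
  interpret M: prob_space M by fact
  interpret N: prob_space N by fact
  have Y': "AE y in N. 0 \<le> Y y \<and> Y y \<le> 1"
    using Y by eventually_elim auto
  let ?h = "\<lambda>u. \<Sum>n. ennreal (neg_binom \<theta> n * (1 - u) ^ n)"
  have expand: "(\<integral>\<^sup>+x. ?h (Z x) \<partial>P) = (\<Sum>n. ennreal (neg_binom \<theta> n * (\<integral>x. (1 - Z x) ^ n \<partial>P)))"
    if "prob_space P" and [measurable]: "Z \<in> borel_measurable P" and Z: "AE x in P. 0 \<le> Z x \<and> Z x \<le> 1"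
    for P :: "'c measure" and Z
  proof -
    interpret P: prob_space P by fact
    have "(\<integral>\<^sup>+x. ennreal (neg_binom \<theta> n * (1 - Z x) ^ n) \<partial>P) =
        ennreal (neg_binom \<theta> n * (\<integral>x. (1 - Z x) ^ n \<partial>P))" for n
    proof -
      have "integrable P (\<lambda>x. (1 - Z x) ^ n)"
      proof (rule P.integrable_const_bound[of _ 1])
        show "AE x in P. norm ((1 - Z x) ^ n) \<le> 1"
          using Z by eventually_elim (auto intro!: power_le_one simp: power_abs)
      qed simp
      hence "integrable P (\<lambda>x. neg_binom \<theta> n * (1 - Z x) ^ n)" by simp
      moreover have "AE x in P. 0 \<le> neg_binom \<theta> n * (1 - Z x) ^ n"
        using Z by eventually_elim (intro mult_nonneg_nonneg less_imp_le[OF neg_binom_pos] \<theta>, auto)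
      ultimately have "(\<integral>\<^sup>+x. ennreal (neg_binom \<theta> n * (1 - Z x) ^ n) \<partial>P) =
          ennreal (\<integral>x. neg_binom \<theta> n * (1 - Z x) ^ n \<partial>P)"
        by (rule nn_integral_eq_integral)
      thus ?thesis by simp
    qed
    thus ?thesis by (simp add: nn_integral_suminf)
  qed
  have "(\<integral>x. (1 - X x) ^ n \<partial>M) = (\<integral>y. (1 - Y y) ^ n \<partial>N)" for n
    using X Y' by (simp add: M.expectation_one_minus_power N.expectation_one_minus_power moments)
  hence "(\<integral>\<^sup>+x. ?h (X x) \<partial>M) = (\<integral>\<^sup>+y. ?h (Y y) \<partial>N)"
    using expand[of M X] expand[of N Y] X Y' M.prob_space_axioms N.prob_space_axioms by simp
  also have "\<dots> = (\<integral>\<^sup>+y. ennreal (Y y powr (-\<theta>)) \<partial>N)"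
    using Y by (intro nn_integral_cong_AE, eventually_elim) (simp add: suminf_neg_binom_ennreal \<theta>)
  finally have hX: "(\<integral>\<^sup>+x. ?h (X x) \<partial>M) = (\<integral>\<^sup>+y. ennreal (Y y powr (-\<theta>)) \<partial>N)" .
  have "AE x in M. ?h (X x) \<noteq> \<infinity>"
    by (rule nn_integral_PInf_AE) (use hX fin in auto)
  with X show pos: "AE x in M. 0 < X x"
  proof eventually_elim
    case (elim x)
    thus ?case using suminf_neg_binom_ennreal[OF \<theta>, of "X x"] by (cases "X x = 0") auto
  qed
  have "(\<integral>\<^sup>+x. ?h (X x) \<partial>M) = (\<integral>\<^sup>+x. ennreal (X x powr (-\<theta>)) \<partial>M)"
    using X pos by (intro nn_integral_cong_AE, eventually_elim) (auto simp: suminf_neg_binom_ennreal \<theta>)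
  with hX show "(\<integral>\<^sup>+x. ennreal (X x powr (-\<theta>)) \<partial>M) = (\<integral>\<^sup>+y. ennreal (Y y powr (-\<theta>)) \<partial>N)"
    by simp
qed

text \<open>Gauss's formula by the Bohr-Mollerup characterisation: the right side is log-convex,
  satisfies the functional equation and equals 1 at 1. The power of k supplies the factor k that the
  functional equation asks for, and the denominator normalises the value at 1.\<close>

lemma Gamma_multiplication:
  fixes x :: real and k :: nat
  assumes k: "k > 0" and x: "x > 0"
  shows "Gamma x = real k powr (x - 1) * (\<Prod>j<k. Gamma ((x + real j) / k)) / (\<Prod>j<k. Gamma ((1 + real j) / k))"
proof -
  define C where "C = (\<Prod>j<k. Gamma ((1 + real j) / k))"
  define G where "G = (\<lambda>x. real k powr (x - 1) * (\<Prod>j<k. Gamma ((x + real j) / k)) / C)"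
  have Gpos: "Gamma ((y + real j) / k) > 0" if "y > 0" for y j
    using that k by (intro Gamma_real_pos divide_pos_pos) auto
  have C: "C > 0"
    unfolding C_def using Gpos[of 1] by (intro prod_pos) auto
  have "G x = Gamma x"
  proof (rule Gamma_pos_real_unique[OF _ _ _ _ x])
    show "G 1 = 1" using C k by (simp add: G_def flip: C_def)
    show "G y > 0" if "y > 0" for y
      using that C k Gpos[OF that] unfolding G_def by (auto intro!: mult_pos_pos divide_pos_pos prod_pos)
    show "G (y + 1) = y * G y" if y: "y > 0" for y
    proof -
      define P where "P = (\<Prod>j<k. Gamma ((y + real j) / k))"
      define Q where "Q = (\<Prod>j<k. Gamma ((y + 1 + real j) / k))"
      \<comment> \<open>Shifting y by 1 moves the window of k indices by one; the product over
        \<open>Suc k\<close> indices is split once at its lower and once at its upper end.\<close>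
      have "Gamma (y / k) * Q = (\<Prod>j<Suc k. Gamma ((y + real j) / k))"
        by (subst prod.lessThan_Suc_shift) (simp add: Q_def add_ac)
      also have "\<dots> = P * Gamma (y / k + 1)"
        using k by (simp add: P_def add_divide_distrib)
      also have "Gamma (y / k + 1) = y / k * Gamma (y / k)"
        using y k divide_pos_pos[of y "real k"] by (intro Gamma_plus1) (metis nonpos_Ints_nonpos not_le of_nat_0_less_iff)
      finally have "Gamma (y / k) * Q = Gamma (y / k) * (P * (y / k))"
        by (simp only: mult_ac)
      hence "Q = P * (y / k)"
        using Gpos[OF y, of 0] unfolding mult_cancel_left by simp
      moreover have "real k powr y = real k powr (y - 1) * k"
        using k by (simp add: powr_diff)
      ultimately show ?thesis
        unfolding G_def P_def[symmetric] Q_def[symmetric] using k by simp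
    qed
    \<comment> \<open>Up to an affine function of y, this is a sum of ln Gamma at increasing affine
      arguments, so convexity is inherited.\<close>
    have lnG: "(ln \<circ> G) y = (\<Sum>j<k. (ln \<circ> Gamma) ((y + real j) / k)) + ((y - 1) * ln k - ln C)" if "y > 0" for y
    proof -
      define P where "P = (\<Prod>j<k. Gamma ((y + real j) / k))"
      have P: "P > 0"
        unfolding P_def using Gpos[OF that] by (intro prod_pos) auto
      have lnP: "ln P = (\<Sum>j<k. ln (Gamma ((y + real j) / k)))"
        unfolding P_def by (rule ln_prod) (use Gpos[OF that] in \<open>simp_all add: dual_order.strict_implies_not_eq\<close>)
      have "ln (real k powr (y - 1) * P / C) = ln (real k powr (y - 1) * P) - ln C"
        by (rule ln_divide_pos) (use P C k in simp_all)
      also have "ln (real k powr (y - 1) * P) = (y - 1) * ln k + ln P"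
        using P k ln_powr[of "real k" "y - 1"] ln_mult[of "real k powr (y - 1)" P] by simp
      finally show ?thesis
        unfolding comp_def G_def P_def[symmetric] lnP by linarith
    qed
    show "convex_on {0<..} (ln \<circ> G)"
    proof (intro convex_onI)
      fix t y z :: real
      assume t: "0 < t" "t < 1" and yz: "y \<in> {0<..}" "z \<in> {0<..}"
      have "(ln \<circ> Gamma) (((1 - t) * y + t * z + real j) / k) \<le>
          (1 - t) * (ln \<circ> Gamma) ((y + real j) / k) + t * (ln \<circ> Gamma) ((z + real j) / k)" for j
      proof -
        have "((1 - t) * y + t * z + real j) / k = (1 - t) * ((y + real j) / k) + t * ((z + real j) / k)"
          using k by (simp add: field_simps)
        thus ?thesis
          using convex_onD[OF log_convex_Gamma_real, of t "(y + real j) / k" "(z + real j) / k"] t yz k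
          by (simp add: add_pos_nonneg)
      qed
      hence "(\<Sum>j<k. (ln \<circ> Gamma) (((1 - t) * y + t * z + real j) / k)) \<le>
          (\<Sum>j<k. (1 - t) * (ln \<circ> Gamma) ((y + real j) / k) + t * (ln \<circ> Gamma) ((z + real j) / k))"
        by (rule sum_mono)
      also have "\<dots> = (1 - t) * (\<Sum>j<k. (ln \<circ> Gamma) ((y + real j) / k)) + t * (\<Sum>j<k. (ln \<circ> Gamma) ((z + real j) / k))"
        by (simp only: sum.distrib sum_distrib_left)
      finally have *: "(\<Sum>j<k. (ln \<circ> Gamma) (((1 - t) * y + t * z + real j) / k)) \<le> \<dots>" .
      have "(1 - t) * y + t * z > 0"
        using t yz by (intro add_pos_pos mult_pos_pos) auto
      with * yz have "(ln \<circ> G) ((1 - t) * y + t * z) \<le> (1 - t) * (ln \<circ> G) y + t * (ln \<circ> G) z"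
        by (simp only: lnG greaterThan_iff) (simp add: algebra_simps)
      thus "(ln \<circ> G) ((1 - t) *\<^sub>R y + t *\<^sub>R z) \<le> (1 - t) * (ln \<circ> G) y + t * (ln \<circ> G) z"
        by simp
    qed auto
  qed
  thus ?thesis by (simp add: G_def C_def)
qed

text \<open>The multiplication formula at 1 + k a, with the term j = k split off: it is Gamma (1 +
  a) above and Gamma 1 below. The remaining k - 1 powers of Gamma (1 + a) are spread over the other
  factors, each of which thereby becomes the a-th moment of a Beta variable with parameters j / k
  and 1 - j / k.\<close>

lemma Gamma_multiplication_ratio:
  fixes a :: real and k :: nat
  assumes k: "k > 0" and a: "a * k > -1"
  shows "Gamma (1 + k * a) / Gamma (1 + a) ^ k =
    real k powr (k * a) * (\<Prod>j\<in>{1..<k}. Gamma (real j / k + a) / (Gamma (real j / k) * Gamma (1 + a)))"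
proof -
  have shift: "(\<Prod>j<k. f (1 + real j)) = (\<Prod>j\<in>{1..<k}. f (real j)) * f (real k)" for f :: "real \<Rightarrow> real"
  proof -
    have "(\<Prod>j<k. f (1 + real j)) = (\<Prod>j\<in>{1..<Suc k}. f (real j))"
      by (rule prod.reindex_bij_witness[of _ "\<lambda>j. j - 1" Suc]) auto
    thus ?thesis using k by simp
  qed
  have "a > -1"
  proof (rule ccontr)
    assume "\<not> a > -1"
    hence "a * k \<le> - 1 * real k" by (intro mult_right_mono) auto
    thus False using k a by simp
  qed
  hence G1: "Gamma (1 + a) > 0" by (intro Gamma_real_pos) auto
  have "Gamma (1 + k * a) = real k powr (k * a) * (\<Prod>j<k. Gamma ((1 + real j) / k + a)) / (\<Prod>j<k. Gamma ((1 + real j) / k))"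
    using k a by (subst Gamma_multiplication[OF k]) (simp_all add: mult_ac add_divide_distrib add_ac)
  also have "(\<Prod>j<k. Gamma ((1 + real j) / k + a)) = (\<Prod>j\<in>{1..<k}. Gamma (real j / k + a)) * Gamma (1 + a)"
    using shift[of "\<lambda>j. Gamma (j / k + a)"] k by simp
  also have "(\<Prod>j<k. Gamma ((1 + real j) / k)) = (\<Prod>j\<in>{1..<k}. Gamma (real j / k))"
    using shift[of "\<lambda>j. Gamma (j / k)"] k by simp
  finally have num: "Gamma (1 + k * a) = real k powr (k * a) *
      ((\<Prod>j\<in>{1..<k}. Gamma (real j / k + a)) * Gamma (1 + a)) / (\<Prod>j\<in>{1..<k}. Gamma (real j / k))" .
  have den: "Gamma (1 + a) ^ k = Gamma (1 + a) * (\<Prod>j\<in>{1..<k}. Gamma (1 + a))"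
    using k by (cases k) auto
  show ?thesis
    unfolding num den prod_dividef prod.distrib using G1 by (simp add: mult_ac)
qed

section \<open>Beta distributions and the comparison variable\<close>

definition beta_measure :: "real \<Rightarrow> real \<Rightarrow> real measure" where
  "beta_measure \<alpha> \<beta> = density lborel (\<lambda>x. ennreal
     (indicator {0..1} x * (x powr (\<alpha> - 1) * (1 - x) powr (\<beta> - 1)) / Beta \<alpha> \<beta>))"

lemma sets_beta_measure [simp, measurable_cong]: "sets (beta_measure \<alpha> \<beta>) = sets borel"
  by (simp add: beta_measure_def)

lemma Beta_real_pos: "\<alpha> > 0 \<Longrightarrow> \<beta> > 0 \<Longrightarrow> Beta \<alpha> \<beta> > (0::real)"
  by (simp add: Beta_def Gamma_real_pos)

lemma nn_integral_Beta:
  assumes "\<alpha> > 0" "\<beta> > 0"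
  shows "(\<integral>\<^sup>+x. ennreal (indicator {0..1} x * (x powr (\<alpha> - 1) * (1 - x) powr (\<beta> - 1))) \<partial>lborel) =
    ennreal (Beta \<alpha> \<beta>)"
  using assms by (intro nn_integral_has_integral_lebesgue has_integral_Beta_real) auto

lemma prob_space_beta_measure:
  assumes "\<alpha> > 0" "\<beta> > 0"
  shows "prob_space (beta_measure \<alpha> \<beta>)"
proof
  have "emeasure (beta_measure \<alpha> \<beta>) (space (beta_measure \<alpha> \<beta>)) =
      (\<integral>\<^sup>+x. ennreal (1 / Beta \<alpha> \<beta>) *
        ennreal (indicator {0..1} x * (x powr (\<alpha> - 1) * (1 - x) powr (\<beta> - 1))) \<partial>lborel)"
    unfolding beta_measure_def using Beta_real_pos[OF assms]
    by (subst emeasure_density) (auto intro!: nn_integral_cong simp: ennreal_mult'[symmetric])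
  also have "\<dots> = ennreal (1 / Beta \<alpha> \<beta>) * ennreal (Beta \<alpha> \<beta>)"
    by (subst nn_integral_cmult) (auto simp: nn_integral_Beta assms)
  also have "\<dots> = 1"
    using Beta_real_pos[OF assms] by (simp add: ennreal_mult'[symmetric])
  finally show "emeasure (beta_measure \<alpha> \<beta>) (space (beta_measure \<alpha> \<beta>)) = 1" .
qed

lemma AE_beta_measure: "AE x in beta_measure \<alpha> \<beta>. 0 < x \<and> x < 1"
  unfolding beta_measure_def
  by (subst AE_density) (auto intro!: AE_I2 simp: indicator_def split: if_splits simp: less_le)

lemma nn_integral_powr_beta_measure:
  assumes "\<alpha> > 0" "\<beta> > 0" "\<alpha> + a > 0"
  shows "(\<integral>\<^sup>+x. ennreal (x powr a) \<partial>beta_measure \<alpha> \<beta>) = ennreal (Beta (\<alpha> + a) \<beta> / Beta \<alpha> \<beta>)"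
proof -
  have "(\<integral>\<^sup>+x. ennreal (x powr a) \<partial>beta_measure \<alpha> \<beta>) =
      (\<integral>\<^sup>+x. ennreal (1 / Beta \<alpha> \<beta>) *
        ennreal (indicator {0..1} x * (x powr (\<alpha> + a - 1) * (1 - x) powr (\<beta> - 1))) \<partial>lborel)"
    unfolding beta_measure_def
  proof (subst nn_integral_density)
    show "(\<integral>\<^sup>+ x. ennreal (indicator {0..1} x * (x powr (\<alpha> - 1) * (1 - x) powr (\<beta> - 1)) / Beta \<alpha> \<beta>) *
          ennreal (x powr a) \<partial>lborel) =
      (\<integral>\<^sup>+x. ennreal (1 / Beta \<alpha> \<beta>) *
        ennreal (indicator {0..1} x * (x powr (\<alpha> + a - 1) * (1 - x) powr (\<beta> - 1))) \<partial>lborel)"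
    proof (rule nn_integral_cong)
      fix x :: real
      have "indicator {0..1} x * (x powr (\<alpha> - 1) * (1 - x) powr (\<beta> - 1)) / Beta \<alpha> \<beta> * x powr a =
          1 / Beta \<alpha> \<beta> * (indicator {0..1} x * (x powr (\<alpha> + a - 1) * (1 - x) powr (\<beta> - 1)))"
        by (simp add: powr_add[symmetric] algebra_simps)
      thus "ennreal (indicator {0..1} x * (x powr (\<alpha> - 1) * (1 - x) powr (\<beta> - 1)) / Beta \<alpha> \<beta>) * ennreal (x powr a) =
          ennreal (1 / Beta \<alpha> \<beta>) * ennreal (indicator {0..1} x * (x powr (\<alpha> + a - 1) * (1 - x) powr (\<beta> - 1)))"
        using Beta_real_pos[OF assms(1,2)] by (subst (1 2) ennreal_mult'[symmetric]) (auto simp: indicator_def)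
    qed
  qed auto
  also have "\<dots> = ennreal (1 / Beta \<alpha> \<beta>) * ennreal (Beta (\<alpha> + a) \<beta>)"
    by (subst nn_integral_cmult) (auto simp: nn_integral_Beta assms)
  also have "\<dots> = ennreal (Beta (\<alpha> + a) \<beta> / Beta \<alpha> \<beta>)"
    using Beta_real_pos[OF assms(1,2)] by (simp add: ennreal_mult'[symmetric])
  finally show ?thesis .
qed

text \<open>
  By Gauss's multiplication formula, \<open>\<Gamma>(1 + k a) / \<Gamma>(1 + a)\<^sup>k\<close> is the \<open>a\<close>-th moment of \<open>k\<^sup>k\<close> times a
  product of independent \<open>Beta (j / k) (1 - j / k)\<close> variables.
\<close>
lemma ex_variable_with_Gamma_moments:
  fixes k :: nat
  assumes k: "k > 0"
  obtains N :: "(nat \<Rightarrow> real) measure" and Y where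
    "prob_space N" "Y \<in> borel_measurable N" "AE y in N. 0 < Y y \<and> Y y \<le> real k ^ k"
    "\<And>a::real. a * real k > -1 \<Longrightarrow> (\<integral>\<^sup>+y. ennreal (Y y powr a) \<partial>N) = ennreal (Gamma (1 + k * a) / Gamma (1 + a) ^ k)"
proof -
  define J where "J = {1..<k}"
  \<comment> \<open>The point mass outside \<open>J\<close> is a default value that makes
    \<open>B j\<close> a probability measure for every index, as the product locale demands.\<close>
  define B where "B j = (if j \<in> J then beta_measure (real j / k) (1 - real j / k) else return borel 0)" for j
  have par: "real j / k > 0" "1 - real j / k > 0" if "j \<in> J" for j
    using that k by (auto simp: J_def)
  have B: "prob_space (B j)" for j
    using par[of j] by (auto simp: B_def intro!: prob_space_beta_measure prob_space_return)
  have sets_B [measurable_cong, simp]: "sets (B j) = sets borel" for j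
    by (simp add: B_def)
  interpret B: product_prob_space B J
    unfolding product_prob_space_def product_prob_space_axioms_def product_sigma_finite_def
    using B by (auto intro: prob_space_imp_sigma_finite)
  define N where "N = PiM J B"
  have comp [measurable]: "(\<lambda>y. y j) \<in> borel_measurable N" if "j \<in> J" for j
    using measurable_component_singleton[OF that, of B] unfolding N_def
    by (simp cong: measurable_cong_sets)
  define Y where "Y y = real k ^ k * (\<Prod>j\<in>J. y j)" for y :: "nat \<Rightarrow> real"
  have finJ: "finite J" by (simp add: J_def)
  have Y_meas: "Y \<in> borel_measurable N"
  proof -
    have "(\<lambda>y. real k ^ k * (\<Prod>j\<in>J. y j)) \<in> borel_measurable N"
      by (intro borel_measurable_times borel_measurable_prod comp) auto
    thus ?thesis by (simp add: Y_def[abs_def])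
  qed
  have AE: "AE y in N. \<forall>j\<in>J. 0 < y j \<and> y j < 1"
    unfolding N_def
  proof (intro eventually_ball_finite ballI finJ)
    fix j assume "j \<in> J"
    hence "B j = beta_measure (real j / k) (1 - real j / k)" by (simp add: B_def)
    hence "AE x in B j. 0 < x \<and> x < 1" using AE_beta_measure by (simp only:)
    thus "AE y in PiM J B. 0 < y j \<and> y j < 1"
      by (rule AE_PiM_component[where P = "\<lambda>x. 0 < x \<and> x < 1", OF B \<open>j \<in> J\<close>])
  qed
  have "AE y in N. 0 < Y y \<and> Y y \<le> real k ^ k"
    using AE
  proof eventually_elim
    case (elim y)
    have "0 < (\<Prod>j\<in>J. y j)" using elim by (intro prod_pos) auto
    moreover have "(\<Prod>j\<in>J. y j) \<le> 1" using elim by (intro prod_le_1) (auto simp: less_imp_le)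
    ultimately show ?case using k by (simp add: Y_def mult_left_le)
  qed
  moreover have "(\<integral>\<^sup>+y. ennreal (Y y powr a) \<partial>N) = ennreal (Gamma (1 + k * a) / Gamma (1 + a) ^ k)"
    if a: "a * real k > -1" for a :: real
  proof -
    \<comment> \<open>The smallest index j = 1 decides: 1 / k + a > 0 is the assumption on a, and
      for a = -\<theta> it reads \<theta> k < 1.\<close>
    have ja: "real j / k + a > 0" if "j \<in> J" for j
    proof -
      have "real j + a * k > 0" using a that by (auto simp: J_def)
      hence "(real j + a * k) / k > 0" using k by simp
      thus ?thesis using k by (simp add: add_divide_distrib)
    qed
    have G1: "Gamma (1 + a) > 0"
    proof (rule Gamma_real_pos)
      show "1 + a > 0"
      proof (rule ccontr)
        assume "\<not> 1 + a > 0"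
        hence "a * k \<le> - 1 * real k" by (intro mult_right_mono) auto
        thus False using k a by simp
      qed
    qed
    have "(\<integral>\<^sup>+y. ennreal (Y y powr a) \<partial>N) =
        (\<integral>\<^sup>+y. ennreal (real k powr (k * a)) * (\<Prod>j\<in>J. ennreal (y j powr a)) \<partial>N)"
      using AE
    proof (intro nn_integral_cong_AE, eventually_elim)
      case (elim y)
      have "Y y powr a = (real k ^ k) powr a * (\<Prod>j\<in>J. y j powr a)"
        using elim k unfolding Y_def
        by (subst powr_mult) (auto intro!: prod_nonneg prod_powr_distrib simp: less_imp_le)
      also have "(real k ^ k) powr a = real k powr (k * a)"
        using k by (simp add: powr_powr powr_realpow[symmetric])
      finally show ?case
        by (simp add: ennreal_mult prod_ennreal prod_nonneg)
    qed
    also have "\<dots> = ennreal (real k powr (k * a)) * (\<integral>\<^sup>+y. (\<Prod>j\<in>J. ennreal (y j powr a)) \<partial>N)"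
      by (rule nn_integral_cmult) (auto intro!: borel_measurable_prod_ennreal)
    also have "(\<integral>\<^sup>+y. (\<Prod>j\<in>J. ennreal (y j powr a)) \<partial>N) = (\<Prod>j\<in>J. \<integral>\<^sup>+x. ennreal (x powr a) \<partial>B j)"
      unfolding N_def using finJ
      by (intro B.product_nn_integral_prod) (auto simp: measurable_cong_sets[OF sets_B refl])
    also have "\<dots> = (\<Prod>j\<in>J. ennreal (Gamma (real j / k + a) / (Gamma (real j / k) * Gamma (1 + a))))"
    proof (intro prod.cong refl)
      fix j assume j: "j \<in> J"
      have "(\<integral>\<^sup>+x. ennreal (x powr a) \<partial>B j) =
          ennreal (Beta (real j / k + a) (1 - real j / k) / Beta (real j / k) (1 - real j / k))"
        using j par[OF j] ja[OF j] by (simp add: B_def nn_integral_powr_beta_measure)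
      also have "Beta (real j / k + a) (1 - real j / k) / Beta (real j / k) (1 - real j / k) =
          Gamma (real j / k + a) / (Gamma (real j / k) * Gamma (1 + a))"
        using Gamma_real_pos[OF par(2)[OF j]] by (simp add: Beta_def add_ac)
      finally show "(\<integral>\<^sup>+x. ennreal (x powr a) \<partial>B j) =
          ennreal (Gamma (real j / k + a) / (Gamma (real j / k) * Gamma (1 + a)))" .
    qed
    also have "\<dots> = ennreal (\<Prod>j\<in>J. Gamma (real j / k + a) / (Gamma (real j / k) * Gamma (1 + a)))"
      using par ja G1 by (intro prod_ennreal) (auto intro!: divide_nonneg_nonneg mult_nonneg_nonneg less_imp_le Gamma_real_pos)
    also have "ennreal (real k powr (k * a)) * \<dots> = ennreal (Gamma (1 + k * a) / Gamma (1 + a) ^ k)"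
      unfolding Gamma_multiplication_ratio[OF k a] by (subst ennreal_mult') (auto simp: J_def)
    finally show ?thesis .
  qed
  moreover have "prob_space N" unfolding N_def by (rule B.prob_space_axioms)
  ultimately show ?thesis using that Y_meas by blast
qed

text \<open>At a natural order m the Gamma quotient is (k m)! / (m!)^k, so the Beta product has
  exactly the moments assumed of \<open>X\<close>. Both variables are divided by a common bound
  \<open>L\<close> to land in [0, 1], and the factor \<open>L powr (-\<theta>)\<close> is restored
  on both sides at the end.\<close>

lemma negative_moment_from_Dyson_moments:
  fixes X :: "'a \<Rightarrow> real" and k :: nat and \<theta> :: real
  assumes M: "prob_space M" and X [measurable]: "X \<in> borel_measurable M"
    and bound: "AE x in M. 0 \<le> X x \<and> X x \<le> K"
    and moments: "\<And>m. (\<integral>x. X x ^ m \<partial>M) = fact (k * m) / fact m ^ k"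
    and k: "k > 0" and \<theta>: "\<theta> > 0" "\<theta> * k < 1"
  shows "AE x in M. 0 < X x"
    and "(\<integral>\<^sup>+x. ennreal (X x powr (-\<theta>)) \<partial>M) = ennreal (Gamma (1 - k * \<theta>) / Gamma (1 - \<theta>) ^ k)"
proof -
  obtain N :: "(nat \<Rightarrow> real) measure" and Y where N: "prob_space N" and Y [measurable]: "Y \<in> borel_measurable N"
    and Yb: "AE y in N. 0 < Y y \<and> Y y \<le> real k ^ k"
    and Ym: "\<And>a::real. a * real k > -1 \<Longrightarrow> (\<integral>\<^sup>+y. ennreal (Y y powr a) \<partial>N) = ennreal (Gamma (1 + k * a) / Gamma (1 + a) ^ k)"
    using ex_variable_with_Gamma_moments[OF k] by blast
  define L where "L = max K (real k ^ k)"
  have L: "L > 0" "K \<le> L" "real k ^ k \<le> L" using k by (auto simp: L_def less_max_iff_disj)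
  have int_moment: "(\<integral>y. Y y ^ m \<partial>N) = fact (k * m) / fact m ^ k" for m
  proof -
    have nonneg: "AE y in N. 0 \<le> Y y ^ m" using Yb by eventually_elim auto
    have "(\<integral>\<^sup>+y. ennreal (Y y ^ m) \<partial>N) = (\<integral>\<^sup>+y. ennreal (Y y powr real m) \<partial>N)"
      using Yb by (intro nn_integral_cong_AE, eventually_elim) (simp add: powr_realpow)
    also have "\<dots> = ennreal (Gamma (1 + k * real m) / Gamma (1 + real m) ^ k)"
          proof (rule Ym)
      have "0 \<le> real m * real k" by simp
      thus "- 1 < real m * real k" by linarith
    qed
    also have "Gamma (1 + k * real m) / Gamma (1 + real m) ^ k = fact (k * m) / fact m ^ k"
      using Gamma_fact[of "k * m", where 'a = real] Gamma_fact[of m, where 'a = real] by simp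
    finally have "(\<integral>\<^sup>+y. ennreal (Y y ^ m) \<partial>N) = ennreal (fact (k * m) / fact m ^ k)" .
    with nonneg show ?thesis
      by (subst integral_eq_nn_integral) auto
  qed
  have scale: "u powr (-\<theta>) = L powr (-\<theta>) * (u / L) powr (-\<theta>)" if "u \<ge> 0" for u
    using L that by (simp add: powr_divide)
  have finY: "(\<integral>\<^sup>+y. ennreal (Y y powr (-\<theta>)) \<partial>N) = ennreal (Gamma (1 - k * \<theta>) / Gamma (1 - \<theta>) ^ k)"
    using Ym[of "-\<theta>"] \<theta> by simp
  have eqY: "(\<integral>\<^sup>+y. ennreal (Y y powr (-\<theta>)) \<partial>N) =
      ennreal (L powr (-\<theta>)) * (\<integral>\<^sup>+y. ennreal ((Y y / L) powr (-\<theta>)) \<partial>N)"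
  proof -
    have "AE y in N. ennreal (Y y powr (-\<theta>)) = ennreal (L powr (-\<theta>)) * ennreal ((Y y / L) powr (-\<theta>))"
      using Yb by eventually_elim (simp add: scale ennreal_mult')
    thus ?thesis by (subst nn_integral_cmult[symmetric]) (auto intro!: nn_integral_cong_AE)
  qed
  have eqX: "(\<integral>\<^sup>+x. ennreal (X x powr (-\<theta>)) \<partial>M) =
      ennreal (L powr (-\<theta>)) * (\<integral>\<^sup>+x. ennreal ((X x / L) powr (-\<theta>)) \<partial>M)"
  proof -
    have "AE x in M. ennreal (X x powr (-\<theta>)) = ennreal (L powr (-\<theta>)) * ennreal ((X x / L) powr (-\<theta>))"
      using bound by eventually_elim (simp add: scale ennreal_mult')
    thus ?thesis by (subst nn_integral_cmult[symmetric]) (auto intro!: nn_integral_cong_AE)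
  qed
  have XL: "AE x in M. 0 \<le> X x / L \<and> X x / L \<le> 1"
    using bound by eventually_elim (use L in \<open>auto simp: divide_simps\<close>)
  have YL: "AE y in N. 0 < Y y / L \<and> Y y / L \<le> 1"
    using Yb by eventually_elim (use L in \<open>auto simp: divide_simps\<close>)
  have fin: "(\<integral>\<^sup>+y. ennreal ((Y y / L) powr (-\<theta>)) \<partial>N) < \<infinity>"
  proof (rule ccontr)
    assume "\<not> ?thesis"
    hence "(\<integral>\<^sup>+y. ennreal ((Y y / L) powr (-\<theta>)) \<partial>N) = \<infinity>"
      by (simp add: less_top[symmetric])
    with eqY L have "(\<integral>\<^sup>+y. ennreal (Y y powr (-\<theta>)) \<partial>N) = \<infinity>"
      by (simp add: ennreal_mult_top)
    thus False using finY by simp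
  qed
  have moments': "(\<integral>x. (X x / L) ^ m \<partial>M) = (\<integral>y. (Y y / L) ^ m \<partial>N)" for m
    by (simp add: power_divide int_moment moments)
  have meas: "(\<lambda>x. X x / L) \<in> borel_measurable M" "(\<lambda>y. Y y / L) \<in> borel_measurable N"
    by measurable
  note * = neg_powr_expectation_eq[OF M N meas XL YL moments' \<theta>(1) fin]
  show "AE x in M. 0 < X x" using *(1) L by (simp add: zero_less_divide_iff)
  show "(\<integral>\<^sup>+x. ennreal (X x powr (-\<theta>)) \<partial>M) = ennreal (Gamma (1 - k * \<theta>) / Gamma (1 - \<theta>) ^ k)"
    using eqX *(2) eqY finY by simp
qed

section \<open>Matrices with constant line sums\<close>

text \<open>The Halmos-Vaughan induction. If all nonempty proper subsets have slack, any index can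
  be given any of its partners, which is then removed; otherwise a tight \<open>J\<close> is matched
  first, and the rest is matched outside the neighbours of \<open>J\<close>.\<close>

lemma hall_marriage:
  assumes "finite I" "\<And>i. i \<in> I \<Longrightarrow> finite (A i)"
    and "\<And>J. J \<subseteq> I \<Longrightarrow> card J \<le> card (\<Union>i\<in>J. A i)"
  shows "\<exists>f. inj_on f I \<and> (\<forall>i\<in>I. f i \<in> A i)"
  using assms
proof (induction "card I" arbitrary: I A rule: less_induct)
  case less
  note fin = less.prems(1,2) and hall = less.prems(3)
  consider "I = {}"
    | "I \<noteq> {}" "\<And>J. J \<subset> I \<Longrightarrow> J \<noteq> {} \<Longrightarrow> card J < card (\<Union>i\<in>J. A i)"
    | J where "J \<subset> I" "J \<noteq> {}" "card (\<Union>i\<in>J. A i) \<le> card J"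
    by (meson not_le)
  thus ?case
  proof cases
    case 1
    thus ?thesis by auto
  next
    case 2
    then obtain i where i: "i \<in> I" by auto
    have "card (A i) \<ge> 1" using hall[of "{i}"] i by simp
    then obtain x where x: "x \<in> A i" by fastforce
    have "card J \<le> card (\<Union>j\<in>J. A j - {x})" if J: "J \<subseteq> I - {i}" for J
    proof (cases "J = {}")
      case False
      have "card J < card (\<Union>j\<in>J. A j)" using 2 J False i by blast
      moreover have "(\<Union>j\<in>J. A j - {x}) = (\<Union>j\<in>J. A j) - {x}" by auto
      moreover have "card ((\<Union>j\<in>J. A j) - {x}) \<ge> card (\<Union>j\<in>J. A j) - 1"
          by (simp add: card_Diff_singleton_if)
      ultimately show ?thesis by simp
    qed simp
    moreover have "card (I - {i}) < card I" using i fin(1) by (intro psubset_card_mono) auto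
    ultimately obtain f where f: "inj_on f (I - {i})" "\<forall>j\<in>I - {i}. f j \<in> A j - {x}"
      using less.hyps[of "I - {i}" "\<lambda>j. A j - {x}"] fin by auto
    have "inj_on (f(i := x)) I"
      using f by (auto simp: inj_on_def)
    moreover have "\<forall>j\<in>I. (f(i := x)) j \<in> A j"
      using f x by auto
    ultimately show ?thesis by blast
  next
    case 3
    have finJ: "finite J" using 3 fin by (auto intro: finite_subset)
    have "card J < card I" using 3 fin by (simp add: psubset_card_mono)
    then obtain f where f: "inj_on f J" "\<forall>j\<in>J. f j \<in> A j"
      using less.hyps[of J A] finJ fin hall 3 by (metis (no_types, lifting) order.trans psubset_imp_subset subsetD)
    let ?U = "\<Union>j\<in>J. A j"
    have "card L \<le> card (\<Union>j\<in>L. A j - ?U)" if L: "L \<subseteq> I - J" for L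
    proof -
      have finL: "finite L" using L fin by (auto intro: finite_subset)
      have finA: "finite (\<Union>j\<in>L. A j)" "finite ?U"
        using finL finJ fin L 3 by (auto intro!: fin(2))
      \<comment> \<open>Hall's condition for the union of L and J, minus the tight bound for J, is
        Hall's condition for L outside the neighbours of J.\<close>
      have "card L + card J = card (L \<union> J)"
        using finL finJ L by (intro card_Un_disjoint[symmetric]) auto
      also have "\<dots> \<le> card (\<Union>j\<in>L \<union> J. A j)"
        using L 3 by (intro hall) auto
      also have "(\<Union>j\<in>L \<union> J. A j) = (\<Union>j\<in>L. A j - ?U) \<union> ?U" by auto
      also have "card \<dots> \<le> card (\<Union>j\<in>L. A j - ?U) + card ?U" by (rule card_Un_le)
      finally show ?thesis using 3 by simp
    qed
    moreover have "card (I - J) < card I"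
      using 3 fin by (intro psubset_card_mono) auto
    ultimately obtain g where g: "inj_on g (I - J)" "\<forall>j\<in>I - J. g j \<in> A j - ?U"
      using less.hyps[of "I - J" "\<lambda>j. A j - ?U"] fin by auto
    have disj: "f u \<noteq> g v" if "u \<in> J" "v \<in> I - J" for u v
    proof -
      have "f u \<in> ?U" using f(2) that(1) by blast
      moreover have "g v \<notin> ?U" using g(2) that(2) by blast
      ultimately show ?thesis by metis
    qed
    have "inj_on (\<lambda>j. if j \<in> J then f j else g j) I"
    proof (rule inj_onI)
      fix x y assume "x \<in> I" "y \<in> I" "(if x \<in> J then f x else g x) = (if y \<in> J then f y else g y)"
      thus "x = y"
        using inj_onD[OF f(1), of x y] inj_onD[OF g(1), of x y] disj[of x y] disj[of y x]
        by (simp split: if_splits)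
    qed
    moreover have "\<forall>j\<in>I. (if j \<in> J then f j else g j) \<in> A j"
      using f g by auto
    ultimately show ?thesis by (intro exI[of _ "\<lambda>j. if j \<in> J then f j else g j"]) blast
  qed
qed

section \<open>Matrices with constant line sums and their large diagonals\<close>

definition line_matrices :: "nat \<Rightarrow> nat \<Rightarrow> (nat \<times> nat \<Rightarrow> nat) set" where
  "line_matrices k n = {a \<in> {..<k} \<times> {..<k} \<rightarrow>\<^sub>E {..n}.
     (\<forall>i<k. (\<Sum>j<k. a (i, j)) = n) \<and> (\<forall>j<k. (\<Sum>i<k. a (i, j)) = n)}"

definition off_diag :: "nat \<Rightarrow> (nat \<times> nat) set" where
  "off_diag k = (SIGMA i:{..<k}. {..<k} - {i})"

text \<open>Circulations on the complete digraph: this is what is left of a matrix with constant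
  line sums once its diagonal is dropped.\<close>

definition balanced :: "nat \<Rightarrow> (nat \<times> nat \<Rightarrow> nat) set" where
  "balanced k = {b \<in> off_diag k \<rightarrow>\<^sub>E UNIV.
     \<forall>i<k. (\<Sum>j\<in>{..<k} - {i}. b (i, j)) = (\<Sum>j\<in>{..<k} - {i}. b (j, i))}"

lemma finite_line_matrices: "finite (line_matrices k n)"
  unfolding line_matrices_def by (rule finite_subset[of _ "{..<k} \<times> {..<k} \<rightarrow>\<^sub>E {..n}"]) (auto intro!: finite_PiE)

lemma finite_off_diag: "finite (off_diag k)"
  by (auto simp: off_diag_def)

text \<open>
  Small entries carry less than a full line of mass, so the entries of size at least \<open>n / k\<^sup>2\<close> satisfy
  Hall's condition.
\<close>
lemma line_matrices_large_diagonal: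
  assumes a: "a \<in> line_matrices k n"
  shows "\<exists>\<sigma>. \<sigma> permutes {..<k} \<and> (\<forall>i<k. n \<le> k ^ 2 * a (i, \<sigma> i))"
proof -
  define A where "A i = {j\<in>{..<k}. n \<le> k ^ 2 * a (i, j)}" for i
  have row: "(\<Sum>j<k. a (i, j)) = n" if "i < k" for i using a that by (auto simp: line_matrices_def)
  have col: "(\<Sum>i<k. a (i, j)) = n" if "j < k" for j using a that by (auto simp: line_matrices_def)
  have "card J \<le> card (\<Union>i\<in>J. A i)" if J: "J \<subseteq> {..<k}" for J
  proof (rule ccontr)
    define N where "N = (\<Union>i\<in>J. A i)"
    assume "\<not> card J \<le> card (\<Union>i\<in>J. A i)"
    hence less: "Suc (card N) \<le> card J" by (simp add: N_def)
    have N: "N \<subseteq> {..<k}" by (auto simp: N_def A_def)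
    have fin: "finite J" "finite N" using J N by (auto intro: finite_subset)
    have cards: "card J \<le> k" "card ({..<k} - N) \<le> k"
      using J card_mono[of "{..<k}"] by (auto intro: order.trans[OF card_mono[of "{..<k}"]])
    from less obtain i0 where i0: "i0 \<in> J" by fastforce
    hence k: "k > 0" using J by auto
    have n: "n > 0"
    proof (rule ccontr)
      assume "\<not> n > 0"
      hence "N = {..<k}" using i0 by (auto simp: N_def A_def)
      thus False using less cards by simp
    qed
    \<comment> \<open>The mass of the rows in \<open>J\<close> outside the columns in
      \<open>N\<close>. It is at least n, since those columns absorb at most n (|J| - 1); yet it
      consists of at most k^2 entries, each satisfying k^2 a <= n - 1. The strict bound, kept as n -
      1, gives the contradiction.\<close>
    define R where "R = (\<Sum>i\<in>J. \<Sum>j\<in>{..<k} - N. a (i, j))"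
    have "n * card J = (\<Sum>i\<in>J. \<Sum>j<k. a (i, j))"
      using J by (simp add: row subset_eq)
    also have "\<dots> = (\<Sum>i\<in>J. (\<Sum>j\<in>N. a (i, j)) + (\<Sum>j\<in>{..<k} - N. a (i, j)))"
      using N by (intro sum.cong refl) (subst sum.subset_diff[of N], auto)
    also have "\<dots> = (\<Sum>i\<in>J. \<Sum>j\<in>N. a (i, j)) + R"
      by (simp add: sum.distrib R_def)
    also have "(\<Sum>i\<in>J. \<Sum>j\<in>N. a (i, j)) = (\<Sum>j\<in>N. \<Sum>i\<in>J. a (i, j))"
      by (rule sum.swap)
    also have "\<dots> \<le> (\<Sum>j\<in>N. \<Sum>i<k. a (i, j))"
      using J by (intro sum_mono sum_mono2) auto
    also have "\<dots> = n * card N"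
      using N by (simp add: col subset_eq)
    finally have "n * card J \<le> n * card N + R" by simp
    moreover have "n * Suc (card N) \<le> n * card J" using less by (intro mult_left_mono) auto
    ultimately have "n \<le> R" by simp
    moreover have "k ^ 2 * R \<le> k ^ 2 * (n - 1)"
    proof -
      have "k ^ 2 * R = (\<Sum>i\<in>J. \<Sum>j\<in>{..<k} - N. k ^ 2 * a (i, j))"
        by (simp add: R_def sum_distrib_left)
      also have "\<dots> \<le> (\<Sum>i\<in>J. \<Sum>j\<in>{..<k} - N. n - 1)"
      proof (intro sum_mono)
        fix i j assume "i \<in> J" "j \<in> {..<k} - N"
        hence "\<not> n \<le> k ^ 2 * a (i, j)" by (auto simp: N_def A_def)
        thus "k ^ 2 * a (i, j) \<le> n - 1" by simp
      qed
      also have "\<dots> = card J * card ({..<k} - N) * (n - 1)" by simp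
      also have "\<dots> \<le> k * k * (n - 1)" using cards by (intro mult_mono) auto
      finally show ?thesis by (simp add: power2_eq_square)
    qed
    hence "R \<le> n - 1" using k by simp
    ultimately show False using n by simp
  qed
  moreover have "finite (A i)" for i by (simp add: A_def)
  ultimately obtain f where f: "inj_on f {..<k}" "\<forall>i\<in>{..<k}. f i \<in> A i"
    using hall_marriage[of "{..<k}" A] by auto
  define \<sigma> where "\<sigma> i = (if i < k then f i else i)" for i
  have "inj_on \<sigma> {..<k}" "\<sigma> ` {..<k} \<subseteq> {..<k}"
    using f by (auto simp: \<sigma>_def A_def inj_on_def)
  hence "bij_betw \<sigma> {..<k} {..<k}"
    by (simp add: bij_betw_def endo_inj_surj)
  hence "\<sigma> permutes {..<k}"
    by (rule bij_imp_permutes) (auto simp: \<sigma>_def)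
  moreover have "\<forall>i<k. n \<le> k ^ 2 * a (i, \<sigma> i)"
    using f by (auto simp: \<sigma>_def A_def)
  ultimately show ?thesis by blast
qed

text \<open>The coefficients themselves decrease when \<theta> < 1, but (n + 1) d(n + 1) = (\<theta>
  + n) d(n), so weighting by the index makes them increase.\<close>

lemma neg_binom_times_mono:
  assumes "\<theta> > 0" "m \<le> n"
  shows "real m * neg_binom \<theta> m \<le> real n * neg_binom \<theta> n"
  using assms(2)
proof (induction rule: dec_induct)
  case (step n)
  have "real n * neg_binom \<theta> n \<le> (\<theta> + n) * neg_binom \<theta> n"
    using neg_binom_pos[OF assms(1), of n] assms by (intro mult_right_mono) auto
  also have "\<dots> = real (Suc n) * neg_binom \<theta> (Suc n)"
    by (simp add: neg_binom_Suc)
  finally show ?case using step by simp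
qed simp

text \<open>Converts the lower bound n / c on a diagonal entry into a factor of the dominating
  function; it is applied with c = k^2.\<close>

lemma neg_binom_le:
  assumes \<theta>: "\<theta> > 0" and mn: "m \<le> n" "n \<le> c * m" and c: "c > 0"
  shows "neg_binom \<theta> m \<le> real c * neg_binom \<theta> n"
proof (cases "m = 0")
  case True
  thus ?thesis using mn c by simp
next
  case False
  have "real m * neg_binom \<theta> m \<le> real n * neg_binom \<theta> n"
    using \<theta> mn by (intro neg_binom_times_mono)
  also have "\<dots> \<le> real (c * m) * neg_binom \<theta> n"
    using mn neg_binom_pos[OF \<theta>, of n] by (intro mult_right_mono) (auto simp del: of_nat_mult)
  finally have "real m * neg_binom \<theta> m \<le> real m * (real c * neg_binom \<theta> n)"
    by (simp add: mult_ac)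
  thus ?thesis using False by simp
qed

text \<open>Consecutive ratios tend to 1 and r of them are multiplied. Truncation in
  \<open>n - r\<close> affects only finitely many n, which the offset by r removes.\<close>

lemma neg_binom_ratio_tendsto:
  assumes \<theta>: "\<theta> > 0"
  shows "(\<lambda>n. neg_binom \<theta> (n - r) / neg_binom \<theta> n) \<longlonglongrightarrow> 1"
proof -
  have nz: "neg_binom \<theta> n \<noteq> 0" for n using neg_binom_pos[OF \<theta>, of n] by simp
  have "(\<lambda>n. neg_binom \<theta> n / neg_binom \<theta> (n + r)) \<longlonglongrightarrow> 1"
  proof (induction r)
    case (Suc r)
    have "(\<lambda>n. (real n + real r + 1) / (\<theta> + (real n + real r))) \<longlonglongrightarrow> 1"
      by real_asymp
    from tendsto_mult[OF Suc this]
    have "(\<lambda>n. neg_binom \<theta> n / neg_binom \<theta> (n + r) *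
        ((real n + real r + 1) / (\<theta> + (real n + real r)))) \<longlonglongrightarrow> 1" by simp
    moreover have "neg_binom \<theta> n / neg_binom \<theta> (n + r) * ((real n + real r + 1) / (\<theta> + (real n + real r))) =
        neg_binom \<theta> n / neg_binom \<theta> (n + Suc r)" for n
      using \<theta> nz by (simp add: neg_binom_Suc add_ac)
    ultimately show ?case by simp
  qed (simp add: nz)
  thus ?thesis
    using LIMSEQ_offset[of "\<lambda>n. neg_binom \<theta> (n - r) / neg_binom \<theta> n" r 1] by simp
qed

section \<open>Splitting a matrix into a permuted diagonal and a balanced rest\<close>

definition row_sum :: "nat \<Rightarrow> (nat \<times> nat \<Rightarrow> nat) \<Rightarrow> nat \<Rightarrow> nat" where
  "row_sum k b i = (\<Sum>j\<in>{..<k} - {i}. b (i, j))"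

text \<open>The columns are relabelled so that the entries at (i, \<sigma> i) become the diagonal,
  which is then forgotten.\<close>

definition off_part :: "nat \<Rightarrow> (nat \<Rightarrow> nat) \<Rightarrow> (nat \<times> nat \<Rightarrow> nat) \<Rightarrow> nat \<times> nat \<Rightarrow> nat" where
  "off_part k \<sigma> a = restrict (\<lambda>p. a (fst p, \<sigma> (snd p))) (off_diag k)"

definition off_weight :: "real \<Rightarrow> nat \<Rightarrow> (nat \<times> nat \<Rightarrow> nat) \<Rightarrow> real" where
  "off_weight \<theta> k b = (\<Prod>p\<in>off_diag k. neg_binom \<theta> (b p))"

context
  fixes k n :: nat and \<sigma> :: "nat \<Rightarrow> nat" and a :: "nat \<times> nat \<Rightarrow> nat"
  assumes a: "a \<in> line_matrices k n" and \<sigma>: "\<sigma> permutes {..<k}"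
begin

lemma off_part_row: "i < k \<Longrightarrow> row_sum k (off_part k \<sigma> a) i + a (i, \<sigma> i) = n"
proof -
  assume i: "i < k"
  have "row_sum k (off_part k \<sigma> a) i = (\<Sum>j\<in>{..<k} - {i}. a (i, \<sigma> j))"
    using i by (auto simp: row_sum_def off_part_def off_diag_def intro!: sum.cong)
  also have "\<dots> + a (i, \<sigma> i) = (\<Sum>j<k. a (i, \<sigma> j))"
    using i by (subst sum.remove[of "{..<k}" i]) auto
  also have "\<dots> = (\<Sum>j<k. a (i, j))"
    using sum.permute[OF \<sigma>, of "\<lambda>j. a (i, j)"] by (simp add: o_def)
  finally show ?thesis using a i by (simp add: line_matrices_def)
qed

text \<open>After relabelling, row i and column i share the entry a (i, \<sigma> i) and both sum to
  n, so their remainders agree.\<close>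

lemma off_part_balanced: "off_part k \<sigma> a \<in> balanced k"
proof -
  have col: "(\<Sum>j\<in>{..<k} - {i}. off_part k \<sigma> a (j, i)) + a (i, \<sigma> i) = n" if i: "i < k" for i
  proof -
    have "(\<Sum>j\<in>{..<k} - {i}. off_part k \<sigma> a (j, i)) = (\<Sum>j\<in>{..<k} - {i}. a (j, \<sigma> i))"
      using i by (auto simp: off_part_def off_diag_def intro!: sum.cong)
    also have "\<dots> + a (i, \<sigma> i) = (\<Sum>j<k. a (j, \<sigma> i))"
      using i by (subst sum.remove[of "{..<k}" i]) auto
    also have "\<dots> = n"
      using a i permutes_in_image[OF \<sigma>, of i] by (simp add: line_matrices_def)
    finally show ?thesis .
  qed
  have "row_sum k (off_part k \<sigma> a) i = (\<Sum>j\<in>{..<k} - {i}. off_part k \<sigma> a (j, i))" if "i < k" for i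
    using col[OF that] off_part_row[OF that] by linarith
  moreover have "off_part k \<sigma> a \<in> off_diag k \<rightarrow>\<^sub>E UNIV"
    by (simp add: off_part_def)
  ultimately show ?thesis
    by (simp add: balanced_def row_sum_def)
qed

lemma prod_neg_binom_off_part:
  "(\<Prod>p\<in>{..<k} \<times> {..<k}. neg_binom \<theta> (a p)) =
     (\<Prod>i<k. neg_binom \<theta> (n - row_sum k (off_part k \<sigma> a) i)) * off_weight \<theta> k (off_part k \<sigma> a)"
proof -
  have "(\<Prod>p\<in>{..<k} \<times> {..<k}. neg_binom \<theta> (a p)) = (\<Prod>i<k. \<Prod>j<k. neg_binom \<theta> (a (i, j)))"
    by (simp add: prod.cartesian_product)
  also have "\<dots> = (\<Prod>i<k. \<Prod>j<k. neg_binom \<theta> (a (i, \<sigma> j)))"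
    using prod.permute[OF \<sigma>, of "\<lambda>j. neg_binom \<theta> (a (i, j))" for i] by (simp add: o_def)
  also have "\<dots> = (\<Prod>i<k. neg_binom \<theta> (n - row_sum k (off_part k \<sigma> a) i) *
      (\<Prod>j\<in>{..<k} - {i}. neg_binom \<theta> (off_part k \<sigma> a (i, j))))"
  proof (intro prod.cong refl)
    fix i assume i: "i \<in> {..<k}"
    have "n - row_sum k (off_part k \<sigma> a) i = a (i, \<sigma> i)"
      using off_part_row[of i] i by simp
    moreover have "(\<Prod>j\<in>{..<k} - {i}. neg_binom \<theta> (off_part k \<sigma> a (i, j))) =
        (\<Prod>j\<in>{..<k} - {i}. neg_binom \<theta> (a (i, \<sigma> j)))"
      using i by (intro prod.cong) (auto simp: off_part_def off_diag_def)
    ultimately show "(\<Prod>j<k. neg_binom \<theta> (a (i, \<sigma> j))) = neg_binom \<theta> (n - row_sum k (off_part k \<sigma> a) i) *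
      (\<Prod>j\<in>{..<k} - {i}. neg_binom \<theta> (off_part k \<sigma> a (i, j)))"
      using i by (simp add: prod.remove[of "{..<k}" i])
  qed
  also have "\<dots> = (\<Prod>i<k. neg_binom \<theta> (n - row_sum k (off_part k \<sigma> a) i)) * off_weight \<theta> k (off_part k \<sigma> a)"
    unfolding off_weight_def off_diag_def by (simp add: prod.distrib prod.Sigma split_def)
  finally show ?thesis .
qed

end

text \<open>The forgotten diagonal is recovered from the row sums, all equal to n.\<close>

lemma inj_on_off_part:
  assumes \<sigma>: "\<sigma> permutes {..<k}"
  shows "inj_on (off_part k \<sigma>) (line_matrices k n)"
proof (rule inj_onI)
  fix a a' assume *: "a \<in> line_matrices k n" "a' \<in> line_matrices k n" "off_part k \<sigma> a = off_part k \<sigma> a'"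
  have eq: "a (i, \<sigma> j) = a' (i, \<sigma> j)" if "i < k" "j < k" for i j
  proof (cases "i = j")
    case True
    thus ?thesis using off_part_row[OF *(1) \<sigma>, of i] off_part_row[OF *(2) \<sigma>, of i] *(3) that by simp
  next
    case False
    hence "(i, j) \<in> off_diag k" using that by (auto simp: off_diag_def)
    thus ?thesis using fun_cong[OF *(3), of "(i, j)"] by (simp add: off_part_def)
  qed
  show "a = a'"
  proof (rule PiE_ext[of _ "{..<k} \<times> {..<k}" "\<lambda>_. {..n}"])
    fix p assume "p \<in> {..<k} \<times> {..<k}"
    then obtain i j where ij: "p = (i, j)" "i < k" "j < k" by auto
    moreover obtain j' where "j' < k" "j = \<sigma> j'"
      using permutes_image[OF \<sigma>] ij by (metis imageE lessThan_iff)
    ultimately show "a p = a' p" using eq by simp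
  qed (use * in \<open>auto simp: line_matrices_def\<close>)
qed

text \<open>The inverse of \<open>off_part\<close>: the entry at \<sigma> receives whatever its row
  lacks to reach n. The subtraction is exact when no row sum of b exceeds n, as the following
  context assumes.\<close>

definition rebuild :: "nat \<Rightarrow> (nat \<Rightarrow> nat) \<Rightarrow> nat \<Rightarrow> (nat \<times> nat \<Rightarrow> nat) \<Rightarrow> nat \<times> nat \<Rightarrow> nat" where
  "rebuild k \<sigma> n b = restrict (\<lambda>p. if snd p = \<sigma> (fst p) then n - row_sum k b (fst p)
     else b (fst p, inv \<sigma> (snd p))) ({..<k} \<times> {..<k})"

context
  fixes k n :: nat and \<sigma> :: "nat \<Rightarrow> nat" and b :: "nat \<times> nat \<Rightarrow> nat"
  assumes b: "b \<in> balanced k" and \<sigma>: "\<sigma> permutes {..<k}" and n: "\<And>i. i < k \<Longrightarrow> row_sum k b i \<le> n"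
begin

lemma rebuild_perm:
  assumes "i < k" "j < k"
  shows "rebuild k \<sigma> n b (i, \<sigma> j) = (if i = j then n - row_sum k b i else b (i, j))"
  using assms permutes_in_image[OF \<sigma>, of j] permutes_inverses[OF \<sigma>]
  by (auto simp: rebuild_def dest: permutes_inj[OF \<sigma>, THEN injD])

lemma rebuild_line_matrices: "rebuild k \<sigma> n b \<in> line_matrices k n"
proof -
  have row: "(\<Sum>j<k. rebuild k \<sigma> n b (i, j)) = n" if i: "i < k" for i
  proof -
    have "(\<Sum>j<k. rebuild k \<sigma> n b (i, j)) = (\<Sum>j<k. rebuild k \<sigma> n b (i, \<sigma> j))"
      using sum.permute[OF \<sigma>, of "\<lambda>j. rebuild k \<sigma> n b (i, j)"] by (simp add: o_def)
    also have "\<dots> = (n - row_sum k b i) + (\<Sum>j\<in>{..<k} - {i}. b (i, j))"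
      using i by (subst sum.remove[of "{..<k}" i]) (auto simp: rebuild_perm intro!: sum.cong)
    finally show ?thesis using n[OF i] by (simp add: row_sum_def)
  qed
  have col: "(\<Sum>i<k. rebuild k \<sigma> n b (i, j)) = n" if j: "j < k" for j
  proof -
    obtain l where l: "l < k" "j = \<sigma> l"
      using permutes_image[OF \<sigma>] j by (metis imageE lessThan_iff)
    have "(\<Sum>i<k. rebuild k \<sigma> n b (i, j)) = (n - row_sum k b l) + (\<Sum>i\<in>{..<k} - {l}. b (i, l))"
      using l by (subst sum.remove[of "{..<k}" l]) (auto simp: rebuild_perm intro!: sum.cong)
    also have "(\<Sum>i\<in>{..<k} - {l}. b (i, l)) = row_sum k b l"
      using b l by (simp add: balanced_def row_sum_def)
    finally show ?thesis using n[OF l(1)] by simp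
  qed
  have le: "rebuild k \<sigma> n b (i, j) \<le> n" if "i < k" "j < k" for i j
    using member_le_sum[of j "{..<k}" "\<lambda>j. rebuild k \<sigma> n b (i, j)"] row[of i] that by simp
  have "rebuild k \<sigma> n b \<in> {..<k} \<times> {..<k} \<rightarrow>\<^sub>E {..n}"
  proof (rule PiE_I)
    fix p assume "p \<in> {..<k} \<times> {..<k}"
    thus "rebuild k \<sigma> n b p \<in> {..n}" using le by (cases p) simp
  next
    fix p assume "p \<notin> {..<k} \<times> {..<k}"
    thus "rebuild k \<sigma> n b p = undefined" unfolding rebuild_def restrict_def by (rule if_not_P)
  qed
  thus ?thesis
    unfolding line_matrices_def using row col by blast
qed

lemma off_part_rebuild: "off_part k \<sigma> (rebuild k \<sigma> n b) = b"
proof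
  fix p
  show "off_part k \<sigma> (rebuild k \<sigma> n b) p = b p"
  proof (cases "p \<in> off_diag k")
    case True
    then obtain i j where "p = (i, j)" "i < k" "j < k" "i \<noteq> j"
      by (auto simp: off_diag_def)
    thus ?thesis using True by (simp add: off_part_def rebuild_perm)
  next
    case False
    from b have "b \<in> extensional (off_diag k)" by (simp add: balanced_def PiE_def)
    from extensional_arb[OF this False] False show ?thesis by (simp add: off_part_def)
  qed
qed

end

text \<open>Every matrix is assigned to one large diagonal \<sigma>. For fixed \<sigma> the matrices
  embed into \<open>balanced k\<close>, and the limit does not depend on \<sigma>, whence the factor
  \<open>fact k\<close>.\<close>

theorem line_matrix_sum_asymptotics:
  assumes \<theta>: "\<theta> > 0" and int: "integrable (count_space (balanced k)) (off_weight \<theta> k)"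
  shows "(\<lambda>n. (\<Sum>a\<in>line_matrices k n. \<Prod>p\<in>{..<k} \<times> {..<k}. neg_binom \<theta> (a p)) / neg_binom \<theta> n ^ k)
    \<longlonglongrightarrow> fact k * (\<integral>b. off_weight \<theta> k b \<partial>count_space (balanced k))"
proof -
  define S where "S = {\<sigma>. \<sigma> permutes {..<k}}"
  define good where "good n a \<sigma> \<longleftrightarrow> \<sigma> permutes {..<k} \<and> (\<forall>i<k. n \<le> k ^ 2 * a (i, \<sigma> i))"
    for n :: nat and a :: "nat \<times> nat \<Rightarrow> nat" and \<sigma>
  \<comment> \<open>A matrix may have several large diagonals; choosing one makes the classes
    disjoint, so that each matrix is counted once.\<close>
  define sel where "sel n a = (SOME \<sigma>. good n a \<sigma>)" for n a
  have sel: "good n a (sel n a)" if "a \<in> line_matrices k n" for a n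
  proof -
    have "\<exists>\<sigma>. good n a \<sigma>"
      using line_matrices_large_diagonal[OF that] by (simp add: good_def)
    thus ?thesis unfolding sel_def by (rule someI_ex)
  qed
  have S: "finite S" "card S = fact k"
    by (auto simp: S_def finite_permutations card_permutations[of "{..<k}" k])
  define G where "G n \<sigma> = off_part k \<sigma> ` {a \<in> line_matrices k n. sel n a = \<sigma>}" for n \<sigma>
  \<comment> \<open>The indicator turns the n-th class into an integral over the fixed space
    \<open>balanced k\<close>, the form that dominated convergence requires.\<close>
  define f where "f n \<sigma> b = indicator (G n \<sigma>) b *
    ((\<Prod>i<k. neg_binom \<theta> (n - row_sum k b i) / neg_binom \<theta> n) * off_weight \<theta> k b)" for n \<sigma> b
  have pos: "neg_binom \<theta> n > 0" for n by (rule neg_binom_pos[OF \<theta>])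
  have W_nonneg: "off_weight \<theta> k b \<ge> 0" for b
    unfolding off_weight_def by (intro prod_nonneg less_imp_le pos ballI)
  have sum_eq: "(\<Sum>a\<in>line_matrices k n. \<Prod>p\<in>{..<k} \<times> {..<k}. neg_binom \<theta> (a p)) / neg_binom \<theta> n ^ k =
      (\<Sum>\<sigma>\<in>S. \<integral>b. f n \<sigma> b \<partial>count_space (balanced k))" for n
  proof -
    define t where "t a = (\<Prod>p\<in>{..<k} \<times> {..<k}. neg_binom \<theta> (a p)) / neg_binom \<theta> n ^ k" for a
    have "sel n ` line_matrices k n \<subseteq> S"
      using sel by (auto simp: S_def good_def)
    hence "(\<Sum>a\<in>line_matrices k n. t a) = (\<Sum>\<sigma>\<in>S. \<Sum>a | a \<in> line_matrices k n \<and> sel n a = \<sigma>. t a)"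
      using S finite_line_matrices by (intro sum.group[symmetric])
    also have "\<dots> = (\<Sum>\<sigma>\<in>S. \<integral>b. f n \<sigma> b \<partial>count_space (balanced k))"
    proof (intro sum.cong refl)
      fix \<sigma> assume "\<sigma> \<in> S"
      hence \<sigma>: "\<sigma> permutes {..<k}" by (simp add: S_def)
      have finG: "finite (G n \<sigma>)"
        unfolding G_def using finite_line_matrices by auto
      have sub: "G n \<sigma> \<subseteq> balanced k"
        unfolding G_def using off_part_balanced[OF _ \<sigma>] by auto
      have "(\<Sum>a | a \<in> line_matrices k n \<and> sel n a = \<sigma>. t a) =
          (\<Sum>a | a \<in> line_matrices k n \<and> sel n a = \<sigma>. f n \<sigma> (off_part k \<sigma> a))"
      proof (intro sum.cong refl)
        fix a assume a: "a \<in> {a. a \<in> line_matrices k n \<and> sel n a = \<sigma>}"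
        hence "off_part k \<sigma> a \<in> G n \<sigma>" by (auto simp: G_def)
        thus "t a = f n \<sigma> (off_part k \<sigma> a)"
          using a \<sigma> by (simp add: t_def f_def prod_neg_binom_off_part prod_dividef)
      qed
      also have "\<dots> = (\<Sum>b\<in>G n \<sigma>. f n \<sigma> b)"
        unfolding G_def
        by (subst sum.reindex) (auto intro: inj_on_subset[OF inj_on_off_part[OF \<sigma>]])
      also have "\<dots> = (\<Sum>b | b \<in> balanced k \<and> f n \<sigma> b \<noteq> 0. f n \<sigma> b)"
        using finG sub by (intro sum.mono_neutral_right) (auto simp: f_def indicator_def)
      also have "\<dots> = (\<integral>b. f n \<sigma> b \<partial>count_space (balanced k))"
      proof (rule lebesgue_integral_count_space_finite_support[symmetric])
        show "finite {b \<in> balanced k. f n \<sigma> b \<noteq> 0}"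
          by (rule finite_subset[OF _ finG]) (auto simp: f_def indicator_def split: if_splits)
      qed
      finally show "(\<Sum>a | a \<in> line_matrices k n \<and> sel n a = \<sigma>. t a) =
        (\<integral>b. f n \<sigma> b \<partial>count_space (balanced k))" .
    qed
    finally show ?thesis by (simp add: t_def sum_divide_distrib)
  qed
  have "(\<lambda>n. \<integral>b. f n \<sigma> b \<partial>count_space (balanced k)) \<longlonglongrightarrow>
      (\<integral>b. off_weight \<theta> k b \<partial>count_space (balanced k))" if "\<sigma> \<in> S" for \<sigma>
  proof (rule integral_dominated_convergence)
    have \<sigma>: "\<sigma> permutes {..<k}" using that by (simp add: S_def)
    \<comment> \<open>One factor k^2 from \<open>neg_binom_le\<close> for each of the k entries on
      the large diagonal.\<close>
    show "integrable (count_space (balanced k)) (\<lambda>b. (real k ^ 2) ^ k * off_weight \<theta> k b)"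
      using int by simp
    show "AE b in count_space (balanced k). norm (f n \<sigma> b) \<le> (real k ^ 2) ^ k * off_weight \<theta> k b" for n
    proof (rule AE_I2)
      fix b assume "b \<in> space (count_space (balanced k))"
      show "norm (f n \<sigma> b) \<le> (real k ^ 2) ^ k * off_weight \<theta> k b"
      proof (cases "b \<in> G n \<sigma>")
        case True
        then obtain a where a: "a \<in> line_matrices k n" "sel n a = \<sigma>" "b = off_part k \<sigma> a"
          by (auto simp: G_def)
        have "(\<Prod>i<k. neg_binom \<theta> (n - row_sum k b i) / neg_binom \<theta> n) \<le> (\<Prod>i<k. real k ^ 2)"
        proof (intro prod_mono conjI)
          fix i assume i: "i \<in> {..<k}"
          have "n - row_sum k b i = a (i, \<sigma> i)"
            using off_part_row[OF a(1) \<sigma>, of i] i a(3) by simp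
          moreover have "n \<le> k ^ 2 * a (i, \<sigma> i)"
            using sel[OF a(1)] a(2) i by (simp add: good_def)
          ultimately have "neg_binom \<theta> (n - row_sum k b i) \<le> real (k ^ 2) * neg_binom \<theta> n"
            using i by (intro neg_binom_le \<theta>) auto
          thus "neg_binom \<theta> (n - row_sum k b i) / neg_binom \<theta> n \<le> real k ^ 2"
            using pos[of n] by (simp add: field_simps)
        qed (use pos in \<open>auto simp: less_imp_le\<close>)
        hence "(\<Prod>i<k. neg_binom \<theta> (n - row_sum k b i) / neg_binom \<theta> n) * off_weight \<theta> k b
            \<le> (real k ^ 2) ^ k * off_weight \<theta> k b"
          using W_nonneg by (intro mult_right_mono) auto
        moreover have "(\<Prod>i<k. neg_binom \<theta> (n - row_sum k b i) / neg_binom \<theta> n) \<ge> 0"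
          using pos by (intro prod_nonneg) (auto simp: less_imp_le)
        ultimately show ?thesis
          using True W_nonneg[of b] by (simp add: f_def abs_mult)
      next
        case False
        thus ?thesis using W_nonneg by (simp add: f_def)
      qed
    qed
    show "AE b in count_space (balanced k). (\<lambda>n. f n \<sigma> b) \<longlonglongrightarrow> off_weight \<theta> k b"
    proof (rule AE_I2)
      fix b assume "b \<in> space (count_space (balanced k))"
      hence b: "b \<in> balanced k" by simp
      define s where "s = (\<Sum>i<k. row_sum k b i)"
      have row_le: "row_sum k b i \<le> s" if "i < k" for i
        unfolding s_def using that by (intro member_le_sum) auto
      have entry_le: "b (i, j) \<le> s" if "i < k" "j < k" "i \<noteq> j" for i j
      proof -
        have "b (i, j) \<le> row_sum k b i"
          unfolding row_sum_def using that by (intro member_le_sum[of j _ "\<lambda>j. b (i, j)"]) auto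
        thus ?thesis using row_le[of i] that by simp
      qed
      \<comment> \<open>The summand s lets every row sum fit into n. The summand k^2 s makes the
        entries off \<sigma> too small to be large ones, so \<sigma> is the only large diagonal of
        the rebuilt matrix and must be the selected one.\<close>
      have "b \<in> G n \<sigma>" if n: "n > s + k ^ 2 * s" for n
      proof -
        define a where "a = rebuild k \<sigma> n b"
        have rown: "row_sum k b i \<le> n" if "i < k" for i
          using row_le[OF that] n by simp
        have a: "a \<in> line_matrices k n" "off_part k \<sigma> a = b"
          unfolding a_def using rebuild_line_matrices[OF b \<sigma> rown] off_part_rebuild[OF b \<sigma> rown] by auto
        define \<tau> where "\<tau> = sel n a"
        have \<tau>: "\<tau> permutes {..<k}" "\<And>i. i < k \<Longrightarrow> n \<le> k ^ 2 * a (i, \<tau> i)"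
          using sel[OF a(1)] by (auto simp: \<tau>_def good_def)
        have "\<tau> i = \<sigma> i" for i
        proof (cases "i < k")
          case True
          have "\<tau> i < k" using permutes_in_image[OF \<tau>(1), of i] True by simp
          then obtain j where j: "j < k" "\<tau> i = \<sigma> j"
            using permutes_image[OF \<sigma>] by (metis imageE lessThan_iff)
          have "i = j"
          proof (rule ccontr)
            assume "i \<noteq> j"
            hence "a (i, \<tau> i) = b (i, j)"
              using j True by (simp add: a_def rebuild_perm[OF b \<sigma> rown])
            hence "n \<le> k ^ 2 * s"
              using \<tau>(2)[OF True] entry_le[of i j] j True \<open>i \<noteq> j\<close>
              by (metis le_trans mult_le_mono2)
            thus False using n by simp
          qed
          thus ?thesis using j by simp
        next
          case False
          thus ?thesis using permutes_not_in[OF \<tau>(1)] permutes_not_in[OF \<sigma>] by simp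
        qed
        hence "sel n a = \<sigma>" by (auto simp: \<tau>_def)
        thus ?thesis using a by (auto simp: G_def)
      qed
      hence ev: "eventually (\<lambda>n. (\<Prod>i<k. neg_binom \<theta> (n - row_sum k b i) / neg_binom \<theta> n) * off_weight \<theta> k b
          = f n \<sigma> b) sequentially"
        by (intro eventually_mono[OF eventually_gt_at_top[of "s + k ^ 2 * s"]]) (simp add: f_def)
      have "(\<lambda>n. (\<Prod>i<k. neg_binom \<theta> (n - row_sum k b i) / neg_binom \<theta> n) * off_weight \<theta> k b)
          \<longlonglongrightarrow> (\<Prod>i<k. 1) * off_weight \<theta> k b"
        by (intro tendsto_mult tendsto_prod tendsto_const neg_binom_ratio_tendsto \<theta>)
      thus "(\<lambda>n. f n \<sigma> b) \<longlonglongrightarrow> off_weight \<theta> k b"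
        using ev by (auto elim: Lim_transform_eventually)
    qed
  qed auto
  hence "(\<lambda>n. \<Sum>\<sigma>\<in>S. \<integral>b. f n \<sigma> b \<partial>count_space (balanced k)) \<longlonglongrightarrow>
      (\<Sum>\<sigma>\<in>S. \<integral>b. off_weight \<theta> k b \<partial>count_space (balanced k))"
    by (intro tendsto_sum)
  thus ?thesis by (simp add: sum_eq S)
qed

section \<open>The sum over balanced off-diagonal matrices\<close>

text \<open>The factors at (i, j) and (j, i) are conjugate, so they multiply to a squared modulus,
  which is the product of their norms. This turns the complex products into real integrands.\<close>

lemma prod_off_diag_hermitian:
  assumes "\<And>i j. F (j, i) = cnj (F (i, j))"
  shows "(\<Prod>p\<in>off_diag k. F p) = complex_of_real (\<Prod>p\<in>off_diag k. norm (F p))"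
proof -
  define L where "L = {(i, j). i < j \<and> j < k}"
  have "finite L" unfolding L_def by (rule finite_subset[of _ "{..<k} \<times> {..<k}"]) auto
  have off: "off_diag k = L \<union> prod.swap ` L" "L \<inter> prod.swap ` L = {}"
    by (auto simp: off_diag_def L_def image_iff)
  have split: "(\<Prod>p\<in>off_diag k. G p) = (\<Prod>p\<in>L. G p * G (prod.swap p))" for G :: "nat \<times> nat \<Rightarrow> 'b::comm_monoid_mult"
    unfolding off(1) using \<open>finite L\<close> off(2)
    by (subst prod.union_disjoint) (auto simp: prod.reindex prod.distrib)
  have "F p * F (prod.swap p) = complex_of_real (norm (F p) * norm (F (prod.swap p)))" for p
  proof -
    have "F (prod.swap p) = cnj (F p)" using assms[where i = "fst p" and j = "snd p"] by (cases p) simp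
    thus ?thesis by (simp add: complex_norm_square[symmetric] power2_eq_square)
  qed
  thus ?thesis by (simp add: split)
qed

text \<open>The product runs over ordered pairs, so each distance |z_i - z_j| occurs twice: this is
  the squared modulus of the Vandermonde determinant of the points cis (t i), and the variable X of
  the overview.\<close>

definition vandermonde_sq :: "nat \<Rightarrow> (nat \<Rightarrow> real) \<Rightarrow> real" where
  "vandermonde_sq k t = (\<Prod>p\<in>off_diag k. norm (1 - cis (t (fst p) - t (snd p))))"

lemma measurable_off_diag_cis [measurable]:
  assumes "p \<in> off_diag k"
  shows "(\<lambda>t. cis (t (fst p) - t (snd p))) \<in> borel_measurable (torus {..<k})"
proof -
  have "fst p \<in> {..<k}" "snd p \<in> {..<k}" using assms by (auto simp: off_diag_def)
  thus ?thesis by measurable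
qed

lemma measurable_vandermonde_sq [measurable]: "vandermonde_sq k \<in> borel_measurable (torus {..<k})"
proof -
  have "(\<lambda>t. vandermonde_sq k t) \<in> borel_measurable (torus {..<k})"
    unfolding vandermonde_sq_def
    by (intro borel_measurable_prod borel_measurable_norm borel_measurable_diff measurable_off_diag_cis) auto
  thus ?thesis by simp
qed

lemma vandermonde_sq_bounds: "0 \<le> vandermonde_sq k t" "vandermonde_sq k t \<le> 2 ^ card (off_diag k)"
proof -
  show "0 \<le> vandermonde_sq k t" by (auto simp: vandermonde_sq_def intro!: prod_nonneg)
  have "vandermonde_sq k t \<le> (\<Prod>p\<in>off_diag k. 2)"
    unfolding vandermonde_sq_def by (intro prod_mono conjI norm_one_minus_cis_le) auto
  thus "vandermonde_sq k t \<le> 2 ^ card (off_diag k)" by simp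
qed

text \<open>Dyson's identity with all exponents equal to m, where the integrand is real by
  conjugation symmetry.\<close>

lemma vandermonde_sq_moment:
  "(\<integral>t. vandermonde_sq k t ^ m \<partial>torus {..<k}) = fact (k * m) / fact m ^ k"
proof -
  have D: "dyson {..<k} (\<lambda>_. m) t = complex_of_real (vandermonde_sq k t ^ m)" for t
  proof -
    have "dyson {..<k} (\<lambda>_. m) t = (\<Prod>p\<in>off_diag k. 1 - cis (t (fst p) - t (snd p))) ^ m"
      by (simp add: dyson_def dyson_factor_def off_diag_def prod.Sigma split_def prod_power_distrib)
    also have "(\<Prod>p\<in>off_diag k. 1 - cis (t (fst p) - t (snd p))) = complex_of_real (vandermonde_sq k t)"
      unfolding vandermonde_sq_def by (rule prod_off_diag_hermitian) (simp add: cis_cnj)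
    finally show ?thesis by simp
  qed
  have "complex_of_real (\<integral>t. vandermonde_sq k t ^ m \<partial>torus {..<k}) = (\<integral>t. dyson {..<k} (\<lambda>_. m) t \<partial>torus {..<k})"
    by (simp only: D integral_complex_of_real)
  also have "\<dots> = complex_of_real (fact (k * m) / fact m ^ k)"
    by (subst dyson_constant_term) auto
  finally show ?thesis by (simp only: of_real_eq_iff)
qed

lemma vandermonde_sq_negative_moment:
  assumes "k > 0" "\<theta> > 0" "\<theta> * real k < 1"
  shows "AE t in torus {..<k}. 0 < vandermonde_sq k t"
    and "(\<integral>\<^sup>+t. ennreal (vandermonde_sq k t powr (-\<theta>)) \<partial>torus {..<k}) = ennreal (Gamma (1 - k * \<theta>) / Gamma (1 - \<theta>) ^ k)"
  using negative_moment_from_Dyson_moments[OF prob_space_torus measurable_vandermonde_sq _ vandermonde_sq_moment assms,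
      of "2 ^ card (off_diag k)"] vandermonde_sq_bounds[of k] by auto

text \<open>Abel damping of \<open>vandermonde_sq\<close> to the power -\<theta>: for r < 1 the
  binomial series of each factor converges absolutely on the whole torus.\<close>

definition smoothed :: "real \<Rightarrow> nat \<Rightarrow> real \<Rightarrow> (nat \<Rightarrow> real) \<Rightarrow> real" where
  "smoothed \<theta> k r t = (\<Prod>p\<in>off_diag k. norm (1 - of_real r * cis (t (fst p) - t (snd p))) powr (-\<theta>))"

lemma measurable_smoothed [measurable]: "smoothed \<theta> k r \<in> borel_measurable (torus {..<k})"
proof -
  have "(\<lambda>t. smoothed \<theta> k r t) \<in> borel_measurable (torus {..<k})"
    unfolding smoothed_def
    by (intro borel_measurable_prod powr_real_measurable borel_measurable_norm borel_measurable_diff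
          borel_measurable_times measurable_off_diag_cis borel_measurable_const) auto
  thus ?thesis by simp
qed

lemma neg_binom_suminf_complex:
  fixes z :: complex
  assumes "norm z < 1"
  shows "(\<Sum>n. of_real (neg_binom \<theta> n) * z ^ n) = (1 - z) powr (- of_real \<theta>)"
proof -
  have "of_real (neg_binom \<theta> n) * z ^ n = ((- of_real \<theta>) gchoose n) * (- z) ^ n" for n
  proof -
    have "complex_of_real (neg_binom \<theta> n) = (-1) ^ n * ((- of_real \<theta>) gchoose n)"
      by (simp add: neg_binom_def gbinomial_pochhammer pochhammer_of_real power_mult_distrib[symmetric])
    thus ?thesis by (simp add: power_minus[of z])
  qed
  thus ?thesis
    using gen_binomial_complex[of "- z" "- of_real \<theta>"] assms by (simp add: sums_iff)
qed

lemma summable_neg_binom: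
  assumes "0 \<le> r" "r < 1"
  shows "summable (\<lambda>n. neg_binom \<theta> n * r ^ n)"
  using neg_binom_sums[of "1 - r" \<theta>] assms by (simp add: sums_iff)

text \<open>The factor at (i, j) carries the monomial z_i / z_j, so the right side says that every
  z_l has total exponent 0. This is why balanced matrices index a constant term.\<close>

lemma balanced_iff:
  assumes "b \<in> off_diag k \<rightarrow>\<^sub>E UNIV"
  shows "b \<in> balanced k \<longleftrightarrow>
    (\<forall>l\<in>{..<k}. (\<Sum>p\<in>off_diag k. int (b p) * (of_bool (l = fst p) - of_bool (l = snd p))) = 0)"
proof -
  have "(\<Sum>p\<in>off_diag k. int (b p) * (of_bool (l = fst p) - of_bool (l = snd p))) =
      int (\<Sum>j\<in>{..<k} - {l}. b (l, j)) - int (\<Sum>j\<in>{..<k} - {l}. b (j, l))" if l: "l < k" for l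
  proof -
    have "(\<Sum>p\<in>off_diag k. int (b p) * of_bool (l = fst p)) = (\<Sum>p\<in>Pair l ` ({..<k} - {l}). int (b p))"
      using l finite_off_diag by (intro sum.mono_neutral_cong_right) (auto simp: off_diag_def)
    also have "\<dots> = int (\<Sum>j\<in>{..<k} - {l}. b (l, j))"
      by (subst sum.reindex) (auto simp: inj_on_def)
    finally have 1: "(\<Sum>p\<in>off_diag k. int (b p) * of_bool (l = fst p)) = int (\<Sum>j\<in>{..<k} - {l}. b (l, j))" .
    have "(\<Sum>p\<in>off_diag k. int (b p) * of_bool (l = snd p)) = (\<Sum>p\<in>(\<lambda>j. (j, l)) ` ({..<k} - {l}). int (b p))"
      using l finite_off_diag by (intro sum.mono_neutral_cong_right) (auto simp: off_diag_def)
    also have "\<dots> = int (\<Sum>j\<in>{..<k} - {l}. b (j, l))"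
      by (subst sum.reindex) (auto simp: inj_on_def)
    finally have 2: "(\<Sum>p\<in>off_diag k. int (b p) * of_bool (l = snd p)) = int (\<Sum>j\<in>{..<k} - {l}. b (j, l))" .
    show ?thesis by (simp only: right_diff_distrib sum_subtractf 1 2)
  qed
  thus ?thesis using assms unfolding balanced_def by (simp add: Ball_def del: of_nat_sum)
qed

text \<open>The sums over finite boxes converge to the torus integral by coefficient extraction and
  to the full sum by monotone convergence. In \<open>ennreal\<close> the comparison yields
  summability along with the value.\<close>

lemma nn_integral_damped_off_weight:
  assumes \<theta>: "\<theta> > 0" and r: "0 < r" "r < 1"
  shows "(\<integral>\<^sup>+b. ennreal (\<Prod>p\<in>off_diag k. neg_binom \<theta> (b p) * r ^ b p) \<partial>count_space (balanced k)) =
    ennreal (\<integral>t. smoothed \<theta> k r t \<partial>torus {..<k})"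
proof -
  define W where "W b = (\<Prod>p\<in>off_diag k. neg_binom \<theta> (b p) * r ^ b p)" for b :: "nat \<times> nat \<Rightarrow> nat"
  have W_nonneg: "W b \<ge> 0" for b
    unfolding W_def using r neg_binom_pos[OF \<theta>] by (intro prod_nonneg) (auto simp: less_imp_le)
  define e :: "nat \<times> nat \<Rightarrow> nat \<Rightarrow> int" where "e p l = of_bool (l = fst p) - of_bool (l = snd p)" for p l
  define Bal where "Bal N = {b \<in> off_diag k \<rightarrow>\<^sub>E {..N}. \<forall>l\<in>{..<k}. (\<Sum>p\<in>off_diag k. int (b p) * e p l) = 0}" for N :: nat
  have Bal: "Bal N = {b \<in> balanced k. \<forall>p\<in>off_diag k. b p \<le> N}" for N
  proof -
    have "off_diag k \<rightarrow>\<^sub>E {..N} = {b \<in> off_diag k \<rightarrow>\<^sub>E UNIV. \<forall>p\<in>off_diag k. b p \<le> N}"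
      by (auto simp: PiE_def Pi_def)
    hence "Bal N = {b \<in> off_diag k \<rightarrow>\<^sub>E UNIV. (\<forall>p\<in>off_diag k. b p \<le> N) \<and>
        (\<forall>l\<in>{..<k}. (\<Sum>p\<in>off_diag k. int (b p) * e p l) = 0)}"
      unfolding Bal_def by blast
    also have "\<dots> = {b \<in> off_diag k \<rightarrow>\<^sub>E UNIV. (\<forall>p\<in>off_diag k. b p \<le> N) \<and> b \<in> balanced k}"
      using balanced_iff unfolding e_def by blast
    also have "\<dots> = {b \<in> balanced k. \<forall>p\<in>off_diag k. b p \<le> N}"
      by (auto simp: balanced_def)
    finally show ?thesis .
  qed
  have finBal: "finite (Bal N)" for N
    unfolding Bal_def using finite_off_diag by (rule_tac finite_subset[of _ "off_diag k \<rightarrow>\<^sub>E {..N}"]) (auto intro!: finite_PiE)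
  have "(\<lambda>N. \<Sum>b\<in>Bal N. \<Prod>p\<in>off_diag k. complex_of_real (neg_binom \<theta> (b p) * r ^ b p)) \<longlonglongrightarrow>
      (\<integral>t. cis (- (\<Sum>i<k. of_int 0 * t i)) * (\<Prod>p\<in>off_diag k. \<Sum>n. complex_of_real (neg_binom \<theta> n * r ^ n) *
          cis (\<Sum>i<k. of_int (e p i) * t i) ^ n) \<partial>torus {..<k})"
    unfolding Bal_def
  proof (rule torus_coefficient_extraction)
    show "summable (\<lambda>n. norm (complex_of_real (neg_binom \<theta> n * r ^ n)))"
    proof -
      have "norm (complex_of_real (neg_binom \<theta> n * r ^ n)) = neg_binom \<theta> n * r ^ n" for n
        using r neg_binom_pos[OF \<theta>, of n] unfolding norm_of_real by (intro abs_of_nonneg) auto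
      thus ?thesis using summable_neg_binom[of r \<theta>] r by simp
    qed
  qed (auto simp: finite_off_diag)
  also have "(\<lambda>t. cis (- (\<Sum>i<k. of_int 0 * t i)) * (\<Prod>p\<in>off_diag k. \<Sum>n. complex_of_real (neg_binom \<theta> n * r ^ n) *
          cis (\<Sum>i<k. of_int (e p i) * t i) ^ n)) = (\<lambda>t. complex_of_real (smoothed \<theta> k r t))"
  proof
    fix t :: "nat \<Rightarrow> real"
    define F where "F p = (1 - of_real r * cis (t (fst p) - t (snd p))) powr (- complex_of_real \<theta>)" for p
    have "(\<Sum>n. complex_of_real (neg_binom \<theta> n * r ^ n) * cis (\<Sum>i<k. of_int (e p i) * t i) ^ n) = F p"
      if p: "p \<in> off_diag k" for p
    proof -
      have "(\<Sum>i<k. of_int (e p i) * t i) = (\<Sum>i<k. of_bool (i = fst p) * t i) - (\<Sum>i<k. of_bool (i = snd p) * t i)"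
        by (simp add: e_def left_diff_distrib sum_subtractf)
      also have "\<dots> = t (fst p) - t (snd p)"
        using p by (auto simp: off_diag_def of_bool_def if_distrib[of "\<lambda>x. x * _"] cong: if_cong)
      finally have "(\<Sum>i<k. of_int (e p i) * t i) = t (fst p) - t (snd p)" .
      moreover have "(\<Sum>n. complex_of_real (neg_binom \<theta> n) * (of_real r * cis (t (fst p) - t (snd p))) ^ n) = F p"
        unfolding F_def using r by (intro neg_binom_suminf_complex) (simp add: norm_mult)
      ultimately show ?thesis by (simp add: power_mult_distrib mult_ac)
    qed
    moreover have "(\<Prod>p\<in>off_diag k. F p) = complex_of_real (\<Prod>p\<in>off_diag k. norm (F p))"
    proof (rule prod_off_diag_hermitian)
      fix i j
      define z where "z = 1 - of_real r * cis (t i - t j)"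
      \<comment> \<open>Keeps z off the branch cut, so that \<open>powr\<close> commutes with
        conjugation.\<close>
      have "Re z > 0"
      proof -
        have "r * cos (t i - t j) \<le> r * 1" using r by (intro mult_left_mono) auto
        moreover have "Re z = 1 - r * cos (t i - t j)" by (simp add: z_def)
        ultimately show ?thesis using r by linarith
      qed
      hence "cnj (z powr (- complex_of_real \<theta>)) = cnj z powr (- complex_of_real \<theta>)"
        by (subst cnj_powr) (auto simp: complex_nonpos_Reals_iff)
      moreover have "cnj z = 1 - of_real r * cis (t j - t i)"
        by (simp add: z_def cis_cnj)
      ultimately show "F (j, i) = cnj (F (i, j))"
        by (simp only: F_def z_def fst_conv snd_conv)
    qed
    moreover have "norm (F p) = norm (1 - of_real r * cis (t (fst p) - t (snd p))) powr (-\<theta>)" for p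
      unfolding F_def by (subst norm_powr_real_powr') auto
    ultimately show "cis (- (\<Sum>i<k. of_int 0 * t i)) * (\<Prod>p\<in>off_diag k. \<Sum>n. complex_of_real (neg_binom \<theta> n * r ^ n) *
          cis (\<Sum>i<k. of_int (e p i) * t i) ^ n) = complex_of_real (smoothed \<theta> k r t)"
      by (simp add: smoothed_def)
  qed
  finally have "(\<lambda>N. complex_of_real (\<Sum>b\<in>Bal N. W b)) \<longlonglongrightarrow> complex_of_real (\<integral>t. smoothed \<theta> k r t \<partial>torus {..<k})"
    by (simp add: W_def)
  hence "(\<lambda>N. \<Sum>b\<in>Bal N. W b) \<longlonglongrightarrow> (\<integral>t. smoothed \<theta> k r t \<partial>torus {..<k})"
    by (simp only: tendsto_of_real_iff)
  hence lim1: "(\<lambda>N. ennreal (\<Sum>b\<in>Bal N. W b)) \<longlonglongrightarrow> ennreal (\<integral>t. smoothed \<theta> k r t \<partial>torus {..<k})"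
    by (rule tendsto_ennrealI)
  have "(\<lambda>N. \<integral>\<^sup>+b. ennreal (W b) * indicator (Bal N) b \<partial>count_space (balanced k)) \<longlonglongrightarrow>
      (\<integral>\<^sup>+b. ennreal (W b) \<partial>count_space (balanced k))"
  proof -
    have "(\<lambda>N. \<integral>\<^sup>+b. ennreal (W b) * indicator (Bal N) b \<partial>count_space (balanced k)) \<longlonglongrightarrow>
      (\<integral>\<^sup>+b. ennreal (W b) * indicator (\<Union>N. Bal N) b \<partial>count_space (balanced k))"
    proof (rule nn_integral_LIMSEQ)
      show "mono (\<lambda>N b. ennreal (W b) * indicator (Bal N) b)"
        by (intro monoI le_funI mult_left_mono) (auto simp: indicator_def Bal intro: order.trans)
      fix b
      show "(\<lambda>N. ennreal (W b) * indicator (Bal N) b) \<longlonglongrightarrow> ennreal (W b) * indicator (\<Union>N. Bal N) b"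
      proof (cases "b \<in> (\<Union>N. Bal N)")
        case True
        then obtain N where "b \<in> Bal N" by auto
        hence "\<forall>n\<ge>N. b \<in> Bal n" by (auto simp: Bal intro: order.trans)
        hence "eventually (\<lambda>n. ennreal (W b) * indicator (Bal n) b = ennreal (W b) * indicator (\<Union>N. Bal N) b) sequentially"
          using True unfolding eventually_sequentially by (intro exI[of _ N]) (auto simp: indicator_def)
        thus ?thesis by (rule tendsto_eventually)
      qed simp
    qed auto
    also have "(\<integral>\<^sup>+b. ennreal (W b) * indicator (\<Union>N. Bal N) b \<partial>count_space (balanced k)) =
        (\<integral>\<^sup>+b. ennreal (W b) \<partial>count_space (balanced k))"
    proof (rule nn_integral_cong)
      fix b assume "b \<in> space (count_space (balanced k))"
      \<comment> \<open>The sum of all entries is a box size that bounds each of them.\<close>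
      hence "b \<in> Bal (\<Sum>p\<in>off_diag k. b p)"
        using finite_off_diag by (auto simp: Bal intro!: member_le_sum)
      hence "b \<in> (\<Union>N. Bal N)" by blast
      thus "ennreal (W b) * indicator (\<Union>N. Bal N) b = ennreal (W b)" by (simp add: indicator_def)
    qed
    finally show ?thesis .
  qed
  moreover have "(\<integral>\<^sup>+b. ennreal (W b) * indicator (Bal N) b \<partial>count_space (balanced k)) = ennreal (\<Sum>b\<in>Bal N. W b)" for N
  proof -
    have "(\<integral>\<^sup>+b. ennreal (W b) * indicator (Bal N) b \<partial>count_space (balanced k)) = (\<integral>\<^sup>+b. ennreal (W b) \<partial>count_space (Bal N))"
      by (subst (1 2) nn_integral_count_space_indicator)
         (auto intro!: nn_integral_cong simp: Bal indicator_def)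
    also have "\<dots> = (\<Sum>b\<in>Bal N. ennreal (W b))"
      using finBal by (rule nn_integral_count_space_finite)
    also have "\<dots> = ennreal (\<Sum>b\<in>Bal N. W b)"
      using W_nonneg by simp
    finally show ?thesis .
  qed
  ultimately have "(\<lambda>N. ennreal (\<Sum>b\<in>Bal N. W b)) \<longlonglongrightarrow> (\<integral>\<^sup>+b. ennreal (W b) \<partial>count_space (balanced k))"
    by simp
  from LIMSEQ_unique[OF this lim1] show ?thesis by (simp add: W_def)
qed

theorem nn_integral_off_weight:
  assumes k: "k > 0" and \<theta>: "\<theta> > 0" "\<theta> * real k < 1"
  shows "(\<integral>\<^sup>+b. ennreal (off_weight \<theta> k b) \<partial>count_space (balanced k)) =
    ennreal (Gamma (1 - k * \<theta>) / Gamma (1 - \<theta>) ^ k)"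
proof -
  \<comment> \<open>Increasing to 1, as monotone convergence requires, and because of the 2 inside
    (0, 1) from m = 0 on.\<close>
  define r where "r m = 1 - 1 / (real m + 2)" for m
  have r: "0 < r m" "r m < 1" for m by (auto simp: r_def field_simps)
  have r_lim: "r \<longlonglongrightarrow> 1" unfolding r_def by real_asymp
  have r_mono: "r m \<le> r n" if "m \<le> n" for m n
    using that by (auto simp: r_def intro!: divide_left_mono)
  define V where "V t = vandermonde_sq k t powr (-\<theta>)" for t
  note neg = vandermonde_sq_negative_moment[OF k \<theta>]
  have V_meas [measurable]: "V \<in> borel_measurable (torus {..<k})"
  proof -
    have "(\<lambda>t. V t) \<in> borel_measurable (torus {..<k})" unfolding V_def by measurable
    thus ?thesis by simp
  qed
  have V_int: "integrable (torus {..<k}) V"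
    using neg(2) by (intro integrableI_nonneg) (auto simp: V_def)
  have "(\<integral>\<^sup>+t. ennreal (V t) \<partial>torus {..<k}) = ennreal (\<integral>t. V t \<partial>torus {..<k})"
    using V_int by (rule nn_integral_eq_integral) (simp add: V_def)
  hence V_val: "ennreal (\<integral>t. V t \<partial>torus {..<k}) = ennreal (Gamma (1 - k * \<theta>) / Gamma (1 - \<theta>) ^ k)"
    using neg(2) by (simp add: V_def)
  have "(\<lambda>m. \<integral>t. smoothed \<theta> k (r m) t \<partial>torus {..<k}) \<longlonglongrightarrow> (\<integral>t. V t \<partial>torus {..<k})"
  proof (rule integral_dominated_convergence)
    \<comment> \<open>One factor \<open>2 powr \<theta>\<close> per pair: for |w| = 1 one has |1 -
      w| <= |1 - r w| + (1 - r) <= 2 |1 - r w|, and the exponent -\<theta> reverses the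
      inequality.\<close>
    show "integrable (torus {..<k}) (\<lambda>t. (2 powr \<theta>) ^ card (off_diag k) * V t)"
      using V_int by simp
    have factor_pos: "norm (1 - cis (t (fst p) - t (snd p))) > 0" if "vandermonde_sq k t > 0" "p \<in> off_diag k" for t p
    proof -
      have "norm (1 - cis (t (fst p) - t (snd p))) \<noteq> 0"
        using that finite_off_diag[of k] unfolding vandermonde_sq_def by (metis less_irrefl prod_zero)
      thus ?thesis by simp
    qed
    have V_prod: "V t = (\<Prod>p\<in>off_diag k. norm (1 - cis (t (fst p) - t (snd p))) powr (-\<theta>))" for t
      unfolding V_def vandermonde_sq_def by (rule prod_powr_distrib)
    show "AE t in torus {..<k}. (\<lambda>m. smoothed \<theta> k (r m) t) \<longlonglongrightarrow> V t"
      using neg(1)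
    proof eventually_elim
      case (elim t)
      have "(\<lambda>m. smoothed \<theta> k (r m) t) \<longlonglongrightarrow>
          (\<Prod>p\<in>off_diag k. norm (1 - of_real 1 * cis (t (fst p) - t (snd p))) powr (-\<theta>))"
        unfolding smoothed_def using factor_pos[OF elim] r_lim
        by (intro tendsto_prod tendsto_powr tendsto_norm tendsto_intros) auto
      thus ?case by (simp add: V_prod)
    qed
    show "AE t in torus {..<k}. norm (smoothed \<theta> k (r m) t) \<le> (2 powr \<theta>) ^ card (off_diag k) * V t" for m
      using neg(1)
    proof eventually_elim
      case (elim t)
      have "smoothed \<theta> k (r m) t \<le> (\<Prod>p\<in>off_diag k. 2 powr \<theta> * norm (1 - cis (t (fst p) - t (snd p))) powr (-\<theta>))"
        unfolding smoothed_def
      proof (intro prod_mono conjI)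
        fix p assume p: "p \<in> off_diag k"
        define w where "w = cis (t (fst p) - t (snd p))"
        have "1 - w = (1 - of_real (r m) * w) - of_real (1 - r m) * w" by (simp add: algebra_simps)
        hence "norm (1 - w) \<le> norm (1 - of_real (r m) * w) + norm (of_real (1 - r m) * w)"
          by (metis norm_triangle_ineq4)
        also have "norm (of_real (1 - r m) * w) = 1 - r m"
          using r[of m] by (simp add: norm_mult w_def del: of_real_diff)
        also have "1 - r m \<le> norm (1 - of_real (r m) * w)"
          using norm_triangle_ineq2[of 1 "of_real (r m) * w"] r[of m] by (simp add: norm_mult w_def)
        finally have le: "norm (1 - w) / 2 \<le> norm (1 - of_real (r m) * w)" by simp
        have "norm (1 - of_real (r m) * w) powr (-\<theta>) \<le> (norm (1 - w) / 2) powr (-\<theta>)"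
          using le factor_pos[OF elim p] \<theta> by (intro powr_mono2') (auto simp: w_def)
        also have "\<dots> = 2 powr \<theta> * norm (1 - w) powr (-\<theta>)"
          by (simp add: powr_divide powr_minus field_simps)
        finally show "norm (1 - of_real (r m) * cis (t (fst p) - t (snd p))) powr (-\<theta>) \<le>
            2 powr \<theta> * norm (1 - cis (t (fst p) - t (snd p))) powr (-\<theta>)" by (simp add: w_def)
      qed auto
      also have "\<dots> = (2 powr \<theta>) ^ card (off_diag k) * V t"
        by (simp add: prod.distrib V_prod)
      finally show ?case by (simp add: smoothed_def abs_of_nonneg prod_nonneg)
    qed
  qed auto
  hence lim1: "(\<lambda>m. ennreal (\<integral>t. smoothed \<theta> k (r m) t \<partial>torus {..<k})) \<longlonglongrightarrow> ennreal (\<integral>t. V t \<partial>torus {..<k})"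
    by (rule tendsto_ennrealI)
  have "(\<lambda>m. \<integral>\<^sup>+b. ennreal (\<Prod>p\<in>off_diag k. neg_binom \<theta> (b p) * r m ^ b p) \<partial>count_space (balanced k)) \<longlonglongrightarrow>
      (\<integral>\<^sup>+b. ennreal (off_weight \<theta> k b) \<partial>count_space (balanced k))"
  proof (rule nn_integral_LIMSEQ)
    show "mono (\<lambda>m b. ennreal (\<Prod>p\<in>off_diag k. neg_binom \<theta> (b p) * r m ^ b p))"
    proof (intro monoI le_funI ennreal_leI prod_mono conjI mult_left_mono power_mono r_mono)
    qed (use r neg_binom_pos[OF \<theta>(1)] in \<open>auto simp: less_imp_le intro!: mult_nonneg_nonneg\<close>)
    fix b :: "nat \<times> nat \<Rightarrow> nat"
    have "(\<lambda>m. \<Prod>p\<in>off_diag k. neg_binom \<theta> (b p) * r m ^ b p) \<longlonglongrightarrow> (\<Prod>p\<in>off_diag k. neg_binom \<theta> (b p) * 1 ^ b p)"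
      by (intro tendsto_prod tendsto_mult tendsto_const tendsto_power r_lim)
    thus "(\<lambda>m. ennreal (\<Prod>p\<in>off_diag k. neg_binom \<theta> (b p) * r m ^ b p)) \<longlonglongrightarrow> ennreal (off_weight \<theta> k b)"
      by (simp add: off_weight_def tendsto_ennrealI)
  qed auto
  hence "(\<lambda>m. ennreal (\<integral>t. smoothed \<theta> k (r m) t \<partial>torus {..<k})) \<longlonglongrightarrow>
      (\<integral>\<^sup>+b. ennreal (off_weight \<theta> k b) \<partial>count_space (balanced k))"
    by (simp add: nn_integral_damped_off_weight[OF \<theta>(1) r])
  from LIMSEQ_unique[OF this lim1] V_val show ?thesis by simp
qed

section \<open>Gaussian moments as matrix sums\<close>

lemma fps_exp_compose_Suc:
  fixes L :: "'a::field_char_0 fps"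
  assumes "fps_nth L 0 = 0"
  shows "of_nat (Suc n) * fps_nth (fps_exp 1 oo L) (Suc n) =
    (\<Sum>i=0..n. fps_nth (fps_exp 1 oo L) i * (of_nat (Suc (n - i)) * fps_nth L (Suc (n - i))))"
proof -
  \<comment> \<open>The differential equation F' = F L' for F = exp L. Comparing coefficients gives
    the recursion over which the next lemmas do induction.\<close>
  have "fps_deriv (fps_exp 1 oo L) = (fps_exp 1 oo L) * fps_deriv L"
    using assms by (simp add: fps_compose_deriv)
  hence "fps_nth (fps_deriv (fps_exp 1 oo L)) n = fps_nth ((fps_exp 1 oo L) * fps_deriv L) n"
    by simp
  thus ?thesis by (simp add: fps_mult_nth del: of_nat_Suc)
qed

text \<open>The recursion for the n-th coefficient reads the exponent only up to degree n, so the
  Gaussian series may be cut to a polynomial.\<close>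

lemma fps_exp_compose_cong:
  fixes L L' :: "'a::field_char_0 fps"
  assumes "fps_nth L 0 = 0" "fps_nth L' 0 = 0" "\<And>j. j \<le> n \<Longrightarrow> fps_nth L j = fps_nth L' j"
  shows "fps_nth (fps_exp 1 oo L) n = fps_nth (fps_exp 1 oo L') n"
  using assms(3)
proof (induction n rule: less_induct)
  case (less n)
  show ?case
  proof (cases n)
    case (Suc m)
    have "of_nat (Suc m) * fps_nth (fps_exp 1 oo L) (Suc m) = of_nat (Suc m) * fps_nth (fps_exp 1 oo L') (Suc m)"
      unfolding fps_exp_compose_Suc[OF assms(1)] fps_exp_compose_Suc[OF assms(2)]
    proof (intro sum.cong refl arg_cong2[of _ _ _ _ "(*)"])
      fix i assume i: "i \<in> {0..m}"
      thus "fps_nth (fps_exp 1 oo L) i = fps_nth (fps_exp 1 oo L') i"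
        using Suc less.prems by (intro less.IH) auto
      show "fps_nth L (Suc (m - i)) = fps_nth L' (Suc (m - i))"
        using i Suc by (intro less.prems) auto
    qed
    thus ?thesis using Suc by (simp del: of_nat_Suc)
  qed simp
qed

lemma fps_exp_compose_cnj:
  fixes L L' :: "complex fps"
  assumes "fps_nth L 0 = 0" "fps_nth L' 0 = 0" "\<And>j. fps_nth L' j = cnj (fps_nth L j)"
  shows "fps_nth (fps_exp 1 oo L') n = cnj (fps_nth (fps_exp 1 oo L) n)"
proof (induction n rule: less_induct)
  case (less n)
  show ?case
  proof (cases n)
    case (Suc m)
    have "of_nat (Suc m) * fps_nth (fps_exp 1 oo L') (Suc m) =
        cnj (of_nat (Suc m) * fps_nth (fps_exp 1 oo L) (Suc m))"
      unfolding fps_exp_compose_Suc[OF assms(1)] fps_exp_compose_Suc[OF assms(2)]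
      using less Suc by (simp add: assms(3) del: of_nat_Suc)
    thus ?thesis using Suc by (simp del: of_nat_Suc)
  qed simp
qed

lemma sum_neg_binom: "\<theta> * (\<Sum>i=0..n. neg_binom \<theta> i) = real (Suc n) * neg_binom \<theta> (Suc n)"
proof (induction n)
  case (Suc n)
  have "\<theta> * (\<Sum>i=0..Suc n. neg_binom \<theta> i) = (\<theta> + real (Suc n)) * neg_binom \<theta> (Suc n)"
    using Suc by (simp add: distrib_left distrib_right)
  thus ?case by (simp add: neg_binom_Suc[of \<theta> "Suc n"])
qed (simp add: neg_binom_Suc)

text \<open>Formally, the exponential of \<theta> times the series of -ln (1 - x) is (1 - x) powr
  (-\<theta>). The exponent is prescribed only up to degree n, so that truncated series
  qualify.\<close>

lemma fps_exp_log_coeff: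
  fixes L :: "complex fps"
  assumes "fps_nth L 0 = 0" "\<And>j. 1 \<le> j \<Longrightarrow> j \<le> n \<Longrightarrow> fps_nth L j = of_real (\<theta> / real j)" "a \<le> n"
  shows "fps_nth (fps_exp 1 oo L) a = of_real (neg_binom \<theta> a)"
  using assms(3)
proof (induction a rule: less_induct)
  case (less a)
  show ?case
  proof (cases a)
    case (Suc m)
    have "of_nat (Suc m) * fps_nth (fps_exp 1 oo L) (Suc m) =
        (\<Sum>i=0..m. complex_of_real (neg_binom \<theta> i) * of_real \<theta>)"
      unfolding fps_exp_compose_Suc[OF assms(1)]
    proof (intro sum.cong refl)
      fix i assume i: "i \<in> {0..m}"
      have "fps_nth L (Suc (m - i)) = of_real (\<theta> / real (Suc (m - i)))"
        using i less.prems Suc by (intro assms(2)) auto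
      hence "of_nat (Suc (m - i)) * fps_nth L (Suc (m - i)) = complex_of_real \<theta>"
        by (simp del: of_nat_Suc)
      moreover have "fps_nth (fps_exp 1 oo L) i = of_real (neg_binom \<theta> i)"
        using i less.prems Suc by (intro less.IH) auto
      ultimately show "fps_nth (fps_exp 1 oo L) i * (of_nat (Suc (m - i)) * fps_nth L (Suc (m - i))) =
          complex_of_real (neg_binom \<theta> i) * of_real \<theta>" by simp
    qed
    also have "\<dots> = complex_of_real (\<theta> * (\<Sum>i=0..m. neg_binom \<theta> i))"
      by (simp add: sum_distrib_left mult_ac)
    also have "\<dots> = of_nat (Suc m) * complex_of_real (neg_binom \<theta> (Suc m))"
      unfolding sum_neg_binom by simp
    finally show ?thesis using Suc by (simp del: of_nat_Suc)
  qed simp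
qed

definition trunc_fps :: "nat \<Rightarrow> (nat \<Rightarrow> complex) \<Rightarrow> complex fps" where
  "trunc_fps n q = Abs_fps (\<lambda>j. if 1 \<le> j \<and> j \<le> n then q j else 0)"

lemma trunc_fps_nth [simp]: "fps_nth (trunc_fps n q) j = (if 1 \<le> j \<and> j \<le> n then q j else 0)"
  by (simp add: trunc_fps_def)

text \<open>With a polynomial exponent the function is entire and its expansion has infinite radius
  of convergence. In particular the coefficients are absolutely summable, which is what the unit
  circle requires.\<close>

lemma
  fixes q :: "nat \<Rightarrow> complex"
  shows exp_trunc_sums: "(\<lambda>a. fps_nth (fps_exp 1 oo trunc_fps n q) a * z ^ a) sums exp (\<Sum>j=1..n. q j * z ^ j)"
    and summable_exp_trunc: "summable (\<lambda>a. norm (fps_nth (fps_exp 1 oo trunc_fps n q) a))"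
proof -
  define f where "f = (\<lambda>z. exp (\<Sum>j=1..n. q j * z ^ j))"
  define E where "E = fps_exp 1 oo trunc_fps n q"
  have poly: "trunc_fps n q = (\<Sum>j=1..n. fps_const (q j) * fps_X ^ j)"
    by (rule fps_ext) (simp add: fps_sum_nth fps_X_power_iff if_distrib[of "\<lambda>x. _ * x"] cong: if_cong)
  have "(\<lambda>z. \<Sum>j=1..n. q j * z ^ j) has_fps_expansion trunc_fps n q"
    unfolding poly by (intro fps_expansion_intros)
  moreover have "exp has_fps_expansion fps_exp (1::complex)"
    using has_fps_expansion_exp[of "1::complex"] by simp
  ultimately have "(exp \<circ> (\<lambda>z. \<Sum>j=1..n. q j * z ^ j)) has_fps_expansion E"
    unfolding E_def by (intro has_fps_expansion_compose) auto
  hence "f has_fps_expansion E" by (simp add: f_def o_def)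
  moreover have holo: "f holomorphic_on UNIV"
    unfolding f_def by (intro holomorphic_intros)
  hence "f has_fps_expansion fps_expansion f 0"
    by (intro has_fps_expansion_fps_expansion[of UNIV]) auto
  ultimately have E: "fps_expansion f 0 = E"
    by (metis fps_expansion_unique_complex)
  have "fps_conv_radius E \<ge> \<infinity>"
    using conv_radius_fps_expansion[of f 0 \<infinity>] holo unfolding E by (simp add: holomorphic_on_subset)
  hence rad: "fps_conv_radius E = \<infinity>" by simp
  have "eval_fps E z = f z"
    using eval_fps_expansion'[of f 0 \<infinity> z] holo unfolding E by (simp add: holomorphic_on_subset)
  moreover have "(\<lambda>a. fps_nth E a * z ^ a) sums eval_fps E z"
    by (rule sums_eval_fps) (simp add: rad)
  ultimately show "(\<lambda>a. fps_nth E a * z ^ a) sums exp (\<Sum>j=1..n. q j * z ^ j)"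
    by (simp add: f_def)
  show "summable (\<lambda>a. norm (fps_nth E a))"
    using abs_summable_in_conv_radius[of 1 "fps_nth E"] rad by (simp add: fps_conv_radius_def)
qed

text \<open>Each factor has a circle variable of its own, so once the box contains n, exactly one
  exponent vector matches. The application has k factors c_n and k factors cnj c_n.\<close>

lemma prod_coeff_eq_integral:
  fixes q :: "'i \<Rightarrow> nat \<Rightarrow> complex"
  assumes I: "finite I"
  shows "(\<Prod>i\<in>I. fps_nth (fps_exp 1 oo trunc_fps n (q i)) n) =
    (\<integral>t. cis (- (\<Sum>i\<in>I. real n * t i)) * (\<Prod>i\<in>I. exp (\<Sum>j=1..n. q i j * cis (t i) ^ j)) \<partial>torus I)"
proof -
  define g where "g i = fps_nth (fps_exp 1 oo trunc_fps n (q i))" for i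
  define e :: "'i \<Rightarrow> 'i \<Rightarrow> int" where "e p i = of_bool (p = i)" for p i
  have ev: "(\<Sum>p\<in>I. int (a p) * e p i) = int (a i)" if "i \<in> I" for a i
    using that I by (simp add: e_def of_bool_def if_distrib[of "\<lambda>x. _ * x"] cong: if_cong)
  have cis_e: "cis (\<Sum>i\<in>I. of_int (e p i) * t i) = cis (t p)" if "p \<in> I" for p and t :: "'i \<Rightarrow> real"
    using that I by (simp add: e_def of_bool_def if_distrib[of of_int] if_distrib[of "\<lambda>x. x * _"] cong: if_cong)
  have "(\<lambda>N. \<Sum>a | a \<in> I \<rightarrow>\<^sub>E {..N} \<and> (\<forall>i\<in>I. (\<Sum>p\<in>I. int (a p) * e p i) = int n). \<Prod>p\<in>I. g p (a p))
    \<longlonglongrightarrow> (\<integral>t. cis (- (\<Sum>i\<in>I. of_int (int n) * t i)) *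
            (\<Prod>p\<in>I. \<Sum>a. g p a * cis (\<Sum>i\<in>I. of_int (e p i) * t i) ^ a) \<partial>torus I)"
    by (rule torus_coefficient_extraction[OF I I]) (simp add: g_def summable_exp_trunc)
  also have "(\<lambda>t. cis (- (\<Sum>i\<in>I. of_int (int n) * t i)) *
            (\<Prod>p\<in>I. \<Sum>a. g p a * cis (\<Sum>i\<in>I. of_int (e p i) * t i) ^ a)) =
      (\<lambda>t. cis (- (\<Sum>i\<in>I. real n * t i)) * (\<Prod>i\<in>I. exp (\<Sum>j=1..n. q i j * cis (t i) ^ j)))"
  proof
    fix t :: "'i \<Rightarrow> real"
    have "(\<Sum>a. g p a * cis (\<Sum>i\<in>I. of_int (e p i) * t i) ^ a) = exp (\<Sum>j=1..n. q p j * cis (t p) ^ j)"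
      if "p \<in> I" for p
      unfolding cis_e[OF that] g_def by (rule sums_unique[symmetric]) (rule exp_trunc_sums)
    thus "cis (- (\<Sum>i\<in>I. of_int (int n) * t i)) *
            (\<Prod>p\<in>I. \<Sum>a. g p a * cis (\<Sum>i\<in>I. of_int (e p i) * t i) ^ a) =
       cis (- (\<Sum>i\<in>I. real n * t i)) * (\<Prod>i\<in>I. exp (\<Sum>j=1..n. q i j * cis (t i) ^ j))"
      by simp
  qed
  finally have lim: "(\<lambda>N. \<Sum>a | a \<in> I \<rightarrow>\<^sub>E {..N} \<and> (\<forall>i\<in>I. (\<Sum>p\<in>I. int (a p) * e p i) = int n). \<Prod>p\<in>I. g p (a p))
    \<longlonglongrightarrow> (\<integral>t. cis (- (\<Sum>i\<in>I. real n * t i)) * (\<Prod>i\<in>I. exp (\<Sum>j=1..n. q i j * cis (t i) ^ j)) \<partial>torus I)" .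
  have "(\<Sum>a | a \<in> I \<rightarrow>\<^sub>E {..N} \<and> (\<forall>i\<in>I. (\<Sum>p\<in>I. int (a p) * e p i) = int n). \<Prod>p\<in>I. g p (a p)) = (\<Prod>i\<in>I. g i n)"
    if "N \<ge> n" for N
  proof -
    have "{a. a \<in> I \<rightarrow>\<^sub>E {..N} \<and> (\<forall>i\<in>I. (\<Sum>p\<in>I. int (a p) * e p i) = int n)} = {restrict (\<lambda>_. n) I}"
    proof (intro equalityI subsetI)
      fix a assume "a \<in> {a. a \<in> I \<rightarrow>\<^sub>E {..N} \<and> (\<forall>i\<in>I. (\<Sum>p\<in>I. int (a p) * e p i) = int n)}"
      hence a: "a \<in> I \<rightarrow>\<^sub>E {..N}" "\<And>i. i \<in> I \<Longrightarrow> a i = n" by (auto simp: ev)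
      have "a = restrict (\<lambda>_. n) I"
      proof
        fix i show "a i = restrict (\<lambda>_. n) I i"
          using a PiE_arb[OF a(1), of i] by (cases "i \<in> I") auto
      qed
      thus "a \<in> {restrict (\<lambda>_. n) I}" by simp
    qed (use that in \<open>auto simp: ev\<close>)
    thus ?thesis by simp
  qed
  hence "eventually (\<lambda>N. (\<Sum>a | a \<in> I \<rightarrow>\<^sub>E {..N} \<and> (\<forall>i\<in>I. (\<Sum>p\<in>I. int (a p) * e p i) = int n). \<Prod>p\<in>I. g p (a p)) =
      (\<Prod>i\<in>I. g i n)) sequentially"
    by (intro eventually_mono[OF eventually_ge_at_top[of n]])
  from tendsto_eventually[OF this] lim show ?thesis
    unfolding g_def by (rule LIMSEQ_unique)
qed

text \<open>The \<open>Inl\<close> variables z_i belong to rows and the \<open>Inr\<close> variables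
  w_j to columns. The entry (i, j) is the exponent of z_i w_j, so extracting the n-th power of every
  variable imposes all line sums. Cutting the exponents at degree n preserves coefficients up to n,
  and the line sums keep all entries in that range.\<close>

lemma line_matrix_sum_eq_integral:
  fixes k n :: nat
  defines "I \<equiv> {..<k} <+> {..<k}"
  shows "(\<integral>t. cis (- (\<Sum>i\<in>I. real n * t i)) *
      (\<Prod>p\<in>{..<k} \<times> {..<k}. exp (\<Sum>j=1..n. of_real (\<theta> / real j) * cis (t (Inl (fst p)) + t (Inr (snd p))) ^ j)) \<partial>torus I) =
    of_real (\<Sum>a\<in>line_matrices k n. \<Prod>p\<in>{..<k} \<times> {..<k}. neg_binom \<theta> (a p))"
proof -
  define P where "P = {..<k} \<times> {..<k}"
  define g where "g = fps_nth (fps_exp 1 oo trunc_fps n (\<lambda>j. complex_of_real (\<theta> / real j)))"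
  define e :: "nat \<times> nat \<Rightarrow> nat + nat \<Rightarrow> int" where "e p i = (case i of Inl l \<Rightarrow> of_bool (fst p = l) | Inr l \<Rightarrow> of_bool (snd p = l))" for p i
  have fin: "finite I" "finite P" by (auto simp: I_def P_def)
  have g_eq: "g a = of_real (neg_binom \<theta> a)" if "a \<le> n" for a
    unfolding g_def using that by (intro fps_exp_log_coeff[of _ n]) auto
  have ev_l: "(\<Sum>p\<in>P. int (a p) * e p (Inl l)) = int (\<Sum>j<k. a (l, j))" if "l < k" for a l
  proof -
    have "(\<Sum>p\<in>P. int (a p) * e p (Inl l)) = (\<Sum>i<k. \<Sum>j<k. int (a (i, j)) * of_bool (i = l))"
      unfolding P_def by (subst sum.cartesian_product) (intro sum.cong refl, simp add: e_def split_def)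
    also have "\<dots> = (\<Sum>i<k. if i = l then (\<Sum>j<k. int (a (i, j))) else 0)"
      by (intro sum.cong refl) auto
    finally show ?thesis using that by simp
  qed
  have ev_r: "(\<Sum>p\<in>P. int (a p) * e p (Inr l)) = int (\<Sum>i<k. a (i, l))" if "l < k" for a l
  proof -
    have "(\<Sum>p\<in>P. int (a p) * e p (Inr l)) = (\<Sum>i<k. \<Sum>j<k. int (a (i, j)) * of_bool (j = l))"
      unfolding P_def by (subst sum.cartesian_product) (intro sum.cong refl, simp add: e_def split_def)
    also have "\<dots> = (\<Sum>i<k. \<Sum>j<k. if j = l then int (a (i, j)) else 0)"
      by (intro sum.cong refl) auto
    finally show ?thesis using that by simp
  qed
  have cond: "(\<forall>i\<in>I. (\<Sum>p\<in>P. int (a p) * e p i) = int n) \<longleftrightarrow>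
      (\<forall>i<k. (\<Sum>j<k. a (i, j)) = n) \<and> (\<forall>j<k. (\<Sum>i<k. a (i, j)) = n)" for a
  proof -
    have "(\<forall>i\<in>I. (\<Sum>p\<in>P. int (a p) * e p i) = int n) \<longleftrightarrow>
        (\<forall>l<k. (\<Sum>p\<in>P. int (a p) * e p (Inl l)) = int n) \<and> (\<forall>l<k. (\<Sum>p\<in>P. int (a p) * e p (Inr l)) = int n)"
      by (auto simp: I_def Plus_def)
    thus ?thesis by (simp only: ev_l ev_r of_nat_eq_iff cong: conj_cong imp_cong)
  qed
  have cis_e: "cis (\<Sum>i\<in>I. of_int (e p i) * t i) = cis (t (Inl (fst p)) + t (Inr (snd p)))" if "p \<in> P" for p t
  proof -
    have "(\<Sum>i\<in>I. of_int (e p i) * t i) =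
        (\<Sum>l<k. if l = fst p then t (Inl l) else 0) + (\<Sum>l<k. if l = snd p then t (Inr l) else 0)"
      unfolding I_def by (subst sum.Plus) (auto simp: e_def intro!: arg_cong2[of _ _ _ _ "(+)"] sum.cong)
    also have "\<dots> = t (Inl (fst p)) + t (Inr (snd p))"
      using that by (auto simp: P_def)
    finally show ?thesis by simp
  qed
  have "(\<lambda>N. \<Sum>a | a \<in> P \<rightarrow>\<^sub>E {..N} \<and> (\<forall>i\<in>I. (\<Sum>p\<in>P. int (a p) * e p i) = int n). \<Prod>p\<in>P. g (a p))
    \<longlonglongrightarrow> (\<integral>t. cis (- (\<Sum>i\<in>I. of_int (int n) * t i)) *
            (\<Prod>p\<in>P. \<Sum>a. g a * cis (\<Sum>i\<in>I. of_int (e p i) * t i) ^ a) \<partial>torus I)"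
    by (rule torus_coefficient_extraction[OF fin]) (simp add: g_def summable_exp_trunc)
  also have "(\<lambda>t. cis (- (\<Sum>i\<in>I. of_int (int n) * t i)) *
            (\<Prod>p\<in>P. \<Sum>a. g a * cis (\<Sum>i\<in>I. of_int (e p i) * t i) ^ a)) =
      (\<lambda>t. cis (- (\<Sum>i\<in>I. real n * t i)) *
      (\<Prod>p\<in>P. exp (\<Sum>j=1..n. of_real (\<theta> / real j) * cis (t (Inl (fst p)) + t (Inr (snd p))) ^ j)))"
  proof
    fix t :: "nat + nat \<Rightarrow> real"
    have "(\<Sum>a. g a * cis (\<Sum>i\<in>I. of_int (e p i) * t i) ^ a) =
        exp (\<Sum>j=1..n. of_real (\<theta> / real j) * cis (t (Inl (fst p)) + t (Inr (snd p))) ^ j)"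
      if "p \<in> P" for p
      unfolding cis_e[OF that] g_def by (rule sums_unique[symmetric]) (rule exp_trunc_sums)
    thus "cis (- (\<Sum>i\<in>I. of_int (int n) * t i)) *
            (\<Prod>p\<in>P. \<Sum>a. g a * cis (\<Sum>i\<in>I. of_int (e p i) * t i) ^ a) =
       cis (- (\<Sum>i\<in>I. real n * t i)) *
      (\<Prod>p\<in>P. exp (\<Sum>j=1..n. of_real (\<theta> / real j) * cis (t (Inl (fst p)) + t (Inr (snd p))) ^ j))"
      by simp
  qed
  finally have lim: "(\<lambda>N. \<Sum>a | a \<in> P \<rightarrow>\<^sub>E {..N} \<and> (\<forall>i\<in>I. (\<Sum>p\<in>P. int (a p) * e p i) = int n). \<Prod>p\<in>P. g (a p))
    \<longlonglongrightarrow> (\<integral>t. cis (- (\<Sum>i\<in>I. real n * t i)) *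
      (\<Prod>p\<in>P. exp (\<Sum>j=1..n. of_real (\<theta> / real j) * cis (t (Inl (fst p)) + t (Inr (snd p))) ^ j)) \<partial>torus I)" .
  have "(\<Sum>a | a \<in> P \<rightarrow>\<^sub>E {..N} \<and> (\<forall>i\<in>I. (\<Sum>p\<in>P. int (a p) * e p i) = int n). \<Prod>p\<in>P. g (a p)) =
      of_real (\<Sum>a\<in>line_matrices k n. \<Prod>p\<in>P. neg_binom \<theta> (a p))" if N: "N \<ge> n" for N
  proof -
    have le: "a p \<le> n" if "\<forall>i<k. (\<Sum>j<k. a (i, j)) = n" "p \<in> P" for a p
    proof -
      have "a (fst p, snd p) \<le> (\<Sum>j<k. a (fst p, j))"
        using that by (intro member_le_sum[of _ _ "\<lambda>j. a (fst p, j)"]) (auto simp: P_def)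
      thus ?thesis using that by (auto simp: P_def)
    qed
    have "{a. a \<in> P \<rightarrow>\<^sub>E {..N} \<and> (\<forall>i\<in>I. (\<Sum>p\<in>P. int (a p) * e p i) = int n)} = line_matrices k n"
      unfolding cond line_matrices_def P_def[symmetric] using le N
      by (intro Collect_cong) (auto simp: PiE_iff intro: order.trans)
    moreover have "(\<Prod>p\<in>P. g (a p)) = of_real (\<Prod>p\<in>P. neg_binom \<theta> (a p))" if "a \<in> line_matrices k n" for a
    proof -
      have "g (a p) = of_real (neg_binom \<theta> (a p))" if "p \<in> P" for p
        using \<open>a \<in> line_matrices k n\<close> that by (intro g_eq) (auto simp: line_matrices_def P_def PiE_iff)
      thus ?thesis by simp
    qed
    ultimately show ?thesis by simp
  qed
  hence "eventually (\<lambda>N. (\<Sum>a | a \<in> P \<rightarrow>\<^sub>E {..N} \<and> (\<forall>i\<in>I. (\<Sum>p\<in>P. int (a p) * e p i) = int n). \<Prod>p\<in>P. g (a p)) =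
      of_real (\<Sum>a\<in>line_matrices k n. \<Prod>p\<in>P. neg_binom \<theta> (a p))) sequentially"
    by (intro eventually_mono[OF eventually_ge_at_top[of n]])
  from LIMSEQ_unique[OF lim tendsto_eventually[OF this]] show ?thesis
    by (simp add: P_def)
qed

section \<open>Exponential moments of complex Gaussian variables\<close>

lemma borel_measurable_cnj [measurable]: "cnj \<in> borel_measurable borel"
  by (intro borel_measurable_continuous_onI continuous_intros)

lemma integral_std_normal_cis:
  "(\<integral>x. std_normal_density x *\<^sub>R cis (c * x) \<partial>lborel) = complex_of_real (exp (- (c\<^sup>2) / 2))"
proof -
  have "char std_normal_distribution c = (\<integral>x. std_normal_density x *\<^sub>R cis (c * x) \<partial>lborel)"
    unfolding char_def by (subst integral_density) (auto simp: cis_conv_exp)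
  thus ?thesis by (simp add: char_std_normal_distribution)
qed

lemma integral_normal_cis:
  assumes "\<sigma> > 0"
  shows "(\<integral>x. normal_density \<mu> \<sigma> x *\<^sub>R cis (b * x) \<partial>lborel) =
    cis (b * \<mu>) * complex_of_real (exp (- ((b * \<sigma>)\<^sup>2) / 2))"
proof -
  have dens: "\<sigma> * normal_density \<mu> \<sigma> (\<mu> + \<sigma> * x) = std_normal_density x" for x
  proof -
    have "sqrt (2 * pi * \<sigma>\<^sup>2) = sqrt (2 * pi) * \<sigma>"
      using assms by (simp add: real_sqrt_mult)
    thus ?thesis using assms by (simp add: normal_density_def power_mult_distrib)
  qed
  have "(\<integral>x. normal_density \<mu> \<sigma> x *\<^sub>R cis (b * x) \<partial>lborel) =
      \<bar>\<sigma>\<bar> *\<^sub>R (\<integral>x. normal_density \<mu> \<sigma> (\<mu> + \<sigma> * x) *\<^sub>R cis (b * (\<mu> + \<sigma> * x)) \<partial>lborel)"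
    using assms by (intro lborel_integral_real_affine) auto
  also have "\<dots> = (\<integral>x. \<sigma> *\<^sub>R (normal_density \<mu> \<sigma> (\<mu> + \<sigma> * x) *\<^sub>R cis (b * (\<mu> + \<sigma> * x))) \<partial>lborel)"
    using assms by (simp only: integral_scaleR_right abs_of_pos)
  also have "\<dots> = (\<integral>x. cis (b * \<mu>) * (std_normal_density x *\<^sub>R cis ((b * \<sigma>) * x)) \<partial>lborel)"
    by (simp add: dens[symmetric] distrib_left cis_mult[symmetric] mult_ac)
  also have "\<dots> = cis (b * \<mu>) * complex_of_real (exp (- ((b * \<sigma>)\<^sup>2) / 2))"
    by (simp only: integral_mult_right_zero integral_std_normal_cis)
  finally show ?thesis .
qed

text \<open>The real part of \<open>s\<close> is absorbed by completing the square, which shifts the mean.\<close>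
lemma normal_density_times_exp:
  assumes "\<sigma> > 0"
  shows "normal_density 0 \<sigma> x *\<^sub>R exp (s * complex_of_real x) =
    complex_of_real (exp ((Re s)\<^sup>2 * \<sigma>\<^sup>2 / 2)) * (normal_density (Re s * \<sigma>\<^sup>2) \<sigma> x *\<^sub>R cis (Im s * x))"
proof -
  have "exp (s * complex_of_real x) = complex_of_real (exp (Re s * x)) * cis (Im s * x)"
    by (simp add: exp_eq_polar)
  moreover have "normal_density 0 \<sigma> x * exp (Re s * x) = exp ((Re s)\<^sup>2 * \<sigma>\<^sup>2 / 2) * normal_density (Re s * \<sigma>\<^sup>2) \<sigma> x"
  proof -
    have "- x\<^sup>2 / (2 * \<sigma>\<^sup>2) + Re s * x = (Re s)\<^sup>2 * \<sigma>\<^sup>2 / 2 + - (x - Re s * \<sigma>\<^sup>2)\<^sup>2 / (2 * \<sigma>\<^sup>2)"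
      using assms by (simp add: field_simps power2_eq_square)
    thus ?thesis by (simp add: normal_density_def exp_add[symmetric])
  qed
  ultimately show ?thesis
    by (simp add: scaleR_conv_of_real mult_ac flip: of_real_mult)
qed

lemma (in prob_space) expectation_exp_normal:
  fixes s :: complex
  assumes X: "distributed M lborel X (normal_density 0 \<sigma>)" and \<sigma>: "\<sigma> > 0"
  shows "integrable M (\<lambda>\<omega>. exp (s * complex_of_real (X \<omega>)))"
    and "expectation (\<lambda>\<omega>. exp (s * complex_of_real (X \<omega>))) = exp (s\<^sup>2 * complex_of_real (\<sigma>\<^sup>2) / 2)"
proof -
  have X_meas: "X \<in> measurable M lborel"
    using X by (rule distributed_measurable)
  have distr: "distr M lborel X = density lborel (\<lambda>x. ennreal (normal_density 0 \<sigma> x))"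
    using X by (rule distributed_distr_eq_density)
  have int: "integrable lborel (\<lambda>x. normal_density 0 \<sigma> x *\<^sub>R exp (s * complex_of_real x))"
    unfolding normal_density_times_exp[OF \<sigma>]
  proof (intro integrable_mult_right)
    show "integrable lborel (\<lambda>x. normal_density (Re s * \<sigma>\<^sup>2) \<sigma> x *\<^sub>R cis (Im s * x))"
      by (rule Bochner_Integration.integrable_bound[OF integrable_normal_density[OF \<sigma>, of "Re s * \<sigma>\<^sup>2"]])
         auto
  qed
  have "integrable (distr M lborel X) (\<lambda>x. exp (s * complex_of_real x))"
    unfolding distr using int by (subst integrable_density) auto
  thus "integrable M (\<lambda>\<omega>. exp (s * complex_of_real (X \<omega>)))"
    using X_meas by (subst (asm) integrable_distr_eq) auto
  have "expectation (\<lambda>\<omega>. exp (s * complex_of_real (X \<omega>))) = (\<integral>x. exp (s * complex_of_real x) \<partial>distr M lborel X)"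
    using X_meas by (subst integral_distr) auto
  also have "\<dots> = (\<integral>x. normal_density 0 \<sigma> x *\<^sub>R exp (s * complex_of_real x) \<partial>lborel)"
    unfolding distr by (subst integral_density) auto
  also have "\<dots> = complex_of_real (exp ((Re s)\<^sup>2 * \<sigma>\<^sup>2 / 2)) *
      (cis (Im s * (Re s * \<sigma>\<^sup>2)) * complex_of_real (exp (- ((Im s * \<sigma>)\<^sup>2) / 2)))"
    unfolding normal_density_times_exp[OF \<sigma>] by (simp only: integral_mult_right_zero integral_normal_cis[OF \<sigma>])
  also have "\<dots> = exp (s\<^sup>2 * complex_of_real (\<sigma>\<^sup>2) / 2)"
  proof -
    have "s\<^sup>2 * complex_of_real (\<sigma>\<^sup>2) / 2 = complex_of_real ((Re s)\<^sup>2 * \<sigma>\<^sup>2 / 2) +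
        (\<i> * complex_of_real (Im s * (Re s * \<sigma>\<^sup>2)) + complex_of_real (- ((Im s * \<sigma>)\<^sup>2) / 2))"
      by (simp add: complex_eq_iff power2_eq_square field_simps)
    thus ?thesis by (simp only: exp_add cis_conv_exp exp_of_real)
  qed
  finally show "expectation (\<lambda>\<omega>. exp (s * complex_of_real (X \<omega>))) = exp (s\<^sup>2 * complex_of_real (\<sigma>\<^sup>2) / 2)" .
qed

text \<open>The exponent is (x + y) Re Z + i (x - y) Im Z, with independent parts of variance 1/2,
  so the expectation has exponent ((x + y)^2 - (x - y)^2) / 4 = x y. The one-dimensional formula is
  used at complex parameters.\<close>

lemma (in prob_space) std_complex_normal_exp:
  fixes x y :: complex
  assumes Z: "std_complex_normal M Z"
  shows "integrable M (\<lambda>\<omega>. exp (x * Z \<omega> + y * cnj (Z \<omega>)))"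
    and "expectation (\<lambda>\<omega>. exp (x * Z \<omega> + y * cnj (Z \<omega>))) = exp (x * y)"
proof -
  let ?X = "\<lambda>\<omega>. exp ((x + y) * complex_of_real (Re (Z \<omega>)))"
  let ?Y = "\<lambda>\<omega>. exp ((\<i> * (x - y)) * complex_of_real (Im (Z \<omega>)))"
  have indep: "indep_var borel (\<lambda>\<omega>. Re (Z \<omega>)) borel (\<lambda>\<omega>. Im (Z \<omega>))"
    and re: "distributed M lborel (\<lambda>\<omega>. Re (Z \<omega>)) (normal_density 0 (1 / sqrt 2))"
    and im: "distributed M lborel (\<lambda>\<omega>. Im (Z \<omega>)) (normal_density 0 (1 / sqrt 2))"
    using Z by (auto simp: std_complex_normal_def)
  have "indep_var borel ((\<lambda>u. exp ((x + y) * complex_of_real u)) \<circ> (\<lambda>\<omega>. Re (Z \<omega>)))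
      borel ((\<lambda>u. exp ((\<i> * (x - y)) * complex_of_real u)) \<circ> (\<lambda>\<omega>. Im (Z \<omega>)))"
    by (rule indep_var_compose[OF indep]) auto
  hence indep': "indep_var borel ?X borel ?Y" by (simp add: o_def)
  note X = expectation_exp_normal[OF re, of "x + y"]
  note Y = expectation_exp_normal[OF im, of "\<i> * (x - y)"]
  have eq: "exp (x * Z \<omega> + y * cnj (Z \<omega>)) = ?X \<omega> * ?Y \<omega>" for \<omega>
  proof -
    have "x * Z \<omega> + y * cnj (Z \<omega>) = (x + y) * complex_of_real (Re (Z \<omega>)) + (\<i> * (x - y)) * complex_of_real (Im (Z \<omega>))"
      by (subst (1 2) complex_eq[of "Z \<omega>"]) (simp add: algebra_simps)
    thus ?thesis by (simp only: exp_add)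
  qed
  show "integrable M (\<lambda>\<omega>. exp (x * Z \<omega> + y * cnj (Z \<omega>)))"
    unfolding eq using indep' X Y by (intro indep_var_integrable) auto
  have "expectation (\<lambda>\<omega>. exp (x * Z \<omega> + y * cnj (Z \<omega>))) = expectation ?X * expectation ?Y"
    unfolding eq using indep' X Y by (intro indep_var_lebesgue_integral) auto
  also have "\<dots> = exp ((x + y)\<^sup>2 / 4 + (\<i> * (x - y))\<^sup>2 / 4)"
    using X Y by (simp add: power_divide exp_add)
  also have "(x + y)\<^sup>2 / 4 + (\<i> * (x - y))\<^sup>2 / 4 = x * y"
    by (simp add: power_mult_distrib power2_eq_square field_simps)
  finally show "expectation (\<lambda>\<omega>. exp (x * Z \<omega> + y * cnj (Z \<omega>))) = exp (x * y)" .
qed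

lemma (in prob_space) std_complex_normal_measurable:
  assumes "std_complex_normal M Z"
  shows "Z \<in> borel_measurable M"
proof -
  have "(\<lambda>\<omega>. Re (Z \<omega>)) \<in> borel_measurable M" "(\<lambda>\<omega>. Im (Z \<omega>)) \<in> borel_measurable M"
    using assms distributed_measurable[of M lborel] by (auto simp: std_complex_normal_def)
  thus ?thesis by (simp add: borel_measurable_complex_iff)
qed

text \<open>Supplies the dominating function for Fubini's theorem. As |Z| <= |Re Z| + |Im Z| and exp
  (c |u|) <= exp (c u) + exp (-c u), four exponentials of real linear forms suffice as a
  bound.\<close>

lemma (in prob_space) std_complex_normal_exp_norm_integrable:
  assumes Z: "std_complex_normal M Z" and c: "c \<ge> 0"
  shows "integrable M (\<lambda>\<omega>. exp (c * cmod (Z \<omega>)))"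
proof -
  note [measurable] = std_complex_normal_measurable[OF Z]
  have lin: "integrable M (\<lambda>\<omega>. exp (u * Re (Z \<omega>) + v * Im (Z \<omega>)))" for u v
  proof -
    \<comment> \<open>Chosen with \<open>y\<close> so that x Z + y cnj Z is the real form u Re Z + v
      Im Z.\<close>
    define x where "x = (complex_of_real u - \<i> * of_real v) / 2"
    define y where "y = (complex_of_real u + \<i> * of_real v) / 2"
    have "x * Z \<omega> + y * cnj (Z \<omega>) = complex_of_real (u * Re (Z \<omega>) + v * Im (Z \<omega>))" for \<omega>
      by (simp add: x_def y_def complex_eq_iff algebra_simps add_divide_distrib diff_divide_distrib)
    hence "norm (exp (x * Z \<omega> + y * cnj (Z \<omega>))) = exp (u * Re (Z \<omega>) + v * Im (Z \<omega>))" for \<omega>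
      by (simp only: norm_exp_eq_Re Re_complex_of_real)
    thus ?thesis
      using integrable_norm[OF std_complex_normal_exp(1)[OF Z, of x y]] by simp
  qed
  have "integrable M (\<lambda>\<omega>. (exp (c * Re (Z \<omega>) + c * Im (Z \<omega>)) + exp (c * Re (Z \<omega>) + (-c) * Im (Z \<omega>))) +
      (exp ((-c) * Re (Z \<omega>) + c * Im (Z \<omega>)) + exp ((-c) * Re (Z \<omega>) + (-c) * Im (Z \<omega>))))"
    by (intro Bochner_Integration.integrable_add lin)
  thus ?thesis
  proof (rule Bochner_Integration.integrable_bound)
    show "AE \<omega> in M. norm (exp (c * cmod (Z \<omega>))) \<le>
      norm ((exp (c * Re (Z \<omega>) + c * Im (Z \<omega>)) + exp (c * Re (Z \<omega>) + (-c) * Im (Z \<omega>))) +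
        (exp ((-c) * Re (Z \<omega>) + c * Im (Z \<omega>)) + exp ((-c) * Re (Z \<omega>) + (-c) * Im (Z \<omega>))))"
    proof (rule AE_I2)
      fix \<omega>
      define a b where "a = Re (Z \<omega>)" and "b = Im (Z \<omega>)"
      have split: "exp (c * \<bar>u\<bar>) \<le> exp (c * u) + exp (- c * u)" for u :: real
        by (cases "u \<ge> 0") (auto simp: abs_if)
      have "exp (c * cmod (Z \<omega>)) \<le> exp (c * (\<bar>a\<bar> + \<bar>b\<bar>))"
        using cmod_le[of "Z \<omega>"] c by (simp add: a_def b_def mult_left_mono)
      also have "\<dots> = exp (c * \<bar>a\<bar>) * exp (c * \<bar>b\<bar>)"
        by (simp add: distrib_left exp_add)
      also have "\<dots> \<le> (exp (c * a) + exp (- c * a)) * (exp (c * b) + exp (- c * b))"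
        by (intro mult_mono split) (auto intro!: add_nonneg_nonneg)
      also have "\<dots> = (exp (c * a + c * b) + exp (c * a + (-c) * b)) + (exp ((-c) * a + c * b) + exp ((-c) * a + (-c) * b))"
        by (simp only: exp_add distrib_left distrib_right)
      finally show "norm (exp (c * cmod (Z \<omega>))) \<le>
        norm ((exp (c * Re (Z \<omega>) + c * Im (Z \<omega>)) + exp (c * Re (Z \<omega>) + (-c) * Im (Z \<omega>))) +
        (exp ((-c) * Re (Z \<omega>) + c * Im (Z \<omega>)) + exp ((-c) * Re (Z \<omega>) + (-c) * Im (Z \<omega>))))"
        unfolding a_def b_def by simp
    qed
  qed measurable
qed

lemma (in prob_space) chaos_coeff_moment:
  assumes indep: "indep_vars (\<lambda>_. borel) N {1..}"
    and normal: "\<And>j. j \<ge> 1 \<Longrightarrow> std_complex_normal M (N j)" and \<theta>: "\<theta> > 0"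
  shows "expectation (\<lambda>\<omega>. cmod (chaos_coeff \<theta> N n \<omega>) ^ (2 * k)) =
    (\<Sum>a\<in>line_matrices k n. \<Prod>p\<in>{..<k} \<times> {..<k}. neg_binom \<theta> (a p))"
proof -
  define I :: "(nat + nat) set" where "I = {..<k} <+> {..<k}"
  interpret T: prob_space "torus I" by (rule prob_space_torus)
  interpret MT: pair_sigma_finite M "torus I" ..
  have finI: "finite I" by (simp add: I_def)
  have N_meas: "N j \<in> borel_measurable M" if "j \<in> {1..n}" for j
    using std_complex_normal_measurable[OF normal[of j]] that by simp
  define \<kappa> where "\<kappa> j = complex_of_real (sqrt \<theta>) / complex_of_real (sqrt (real j))" for j
  define q where "q \<omega> i j = \<kappa> j * (case i of Inl _ \<Rightarrow> N j \<omega> | Inr _ \<Rightarrow> cnj (N j \<omega>))" for \<omega> and i :: "nat + nat" and j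
  \<comment> \<open>With \<open>y\<close>, this collects the coefficients of N_j and of its
    conjugate over all 2 k circle variables, so that the integrand splits into factors independent
    in j.\<close>
  define x where "x j t = \<kappa> j * (\<Sum>i<k. cis (t (Inl i)) ^ j)" for j and t :: "nat + nat \<Rightarrow> real"
  define y where "y j t = \<kappa> j * (\<Sum>i<k. cis (t (Inr i)) ^ j)" for j and t :: "nat + nat \<Rightarrow> real"
  define \<Phi> where "\<Phi> \<omega> t = cis (- (\<Sum>i\<in>I. real n * t i)) * (\<Prod>j\<in>{1..n}. exp (x j t * N j \<omega> + y j t * cnj (N j \<omega>)))" for \<omega> t
  have pointwise: "complex_of_real (cmod (chaos_coeff \<theta> N n \<omega>) ^ (2 * k)) = (\<integral>t. \<Phi> \<omega> t \<partial>torus I)" for \<omega>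
  proof -
    define c where "c = chaos_coeff \<theta> N n \<omega>"
    have l: "fps_nth (fps_exp 1 oo trunc_fps n (q \<omega> (Inl i))) n = c" for i
      unfolding c_def chaos_coeff_def
      by (rule fps_exp_compose_cong) (auto simp: log_series_def q_def \<kappa>_def)
    have r: "fps_nth (fps_exp 1 oo trunc_fps n (q \<omega> (Inr i))) n = cnj c" for i
      unfolding l[of 0, symmetric]
      by (rule fps_exp_compose_cnj) (auto simp: q_def \<kappa>_def)
    have expo: "(\<Prod>i\<in>I. exp (\<Sum>j=1..n. q \<omega> i j * cis (t i) ^ j)) = (\<Prod>j\<in>{1..n}. exp (x j t * N j \<omega> + y j t * cnj (N j \<omega>)))" for t
    proof -
      have "(\<Prod>i\<in>I. exp (\<Sum>j=1..n. q \<omega> i j * cis (t i) ^ j)) = exp (\<Sum>i\<in>I. \<Sum>j=1..n. q \<omega> i j * cis (t i) ^ j)"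
        using finI by (simp add: exp_sum)
      also have "(\<Sum>i\<in>I. \<Sum>j=1..n. q \<omega> i j * cis (t i) ^ j) = (\<Sum>j=1..n. \<Sum>i\<in>I. q \<omega> i j * cis (t i) ^ j)"
        by (rule sum.swap)
      also have "\<dots> = (\<Sum>j=1..n. x j t * N j \<omega> + y j t * cnj (N j \<omega>))"
        unfolding I_def
        by (intro sum.cong refl, subst sum.Plus)
           (simp_all add: q_def x_def y_def sum_distrib_left sum_distrib_right mult_ac)
      also have "exp \<dots> = (\<Prod>j\<in>{1..n}. exp (x j t * N j \<omega> + y j t * cnj (N j \<omega>)))"
        by (simp add: exp_sum)
      finally show ?thesis .
    qed
    have "(\<Prod>i\<in>I. fps_nth (fps_exp 1 oo trunc_fps n (q \<omega> i)) n) = c ^ k * cnj c ^ k"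
      unfolding I_def by (subst prod.Plus) (simp_all add: l r)
    also have "\<dots> = complex_of_real (cmod c ^ (2 * k))"
      by (simp add: power_mult_distrib[symmetric] complex_norm_square[symmetric] power_mult)
    finally have "complex_of_real (cmod c ^ (2 * k)) =
        (\<integral>t. cis (- (\<Sum>i\<in>I. real n * t i)) * (\<Prod>i\<in>I. exp (\<Sum>j=1..n. q \<omega> i j * cis (t i) ^ j)) \<partial>torus I)"
      unfolding prod_coeff_eq_integral[OF finI] by simp
    thus ?thesis by (simp only: expo c_def \<Phi>_def)
  qed
  \<comment> \<open>Bounds |x j t| + |y j t| for all t, each being \<open>\<kappa> j\<close> times a
    sum of k numbers of modulus 1. Hence \<open>H\<close> dominates \<open>\<Phi>\<close> uniformly
    on the torus.\<close>
  define C where "C j = cmod (\<kappa> j) * k + cmod (\<kappa> j) * k" for j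
  define H where "H \<omega> = (\<Prod>j\<in>{1..n}. exp (C j * cmod (N j \<omega>)))" for \<omega>
  have indep_n: "indep_vars (\<lambda>_. borel) N {1..n}"
    by (rule indep_vars_subset[OF indep]) auto
  have H_int: "integrable M H"
    unfolding H_def
  proof (rule indep_vars_integrable)
    show "indep_vars (\<lambda>_. borel) (\<lambda>j \<omega>. exp (C j * cmod (N j \<omega>))) {1..n}"
      by (rule indep_vars_compose2[OF indep_n]) auto
    show "integrable M (\<lambda>\<omega>. exp (C j * cmod (N j \<omega>)))" if "j \<in> {1..n}" for j
      using that by (intro std_complex_normal_exp_norm_integrable normal) (auto simp: C_def)
  qed auto
  have xy_meas: "x j \<in> borel_measurable (torus I)" "y j \<in> borel_measurable (torus I)" for j
  proof -
    have "(\<lambda>t. t (Inl i)) \<in> borel_measurable (torus I)" "(\<lambda>t. t (Inr i)) \<in> borel_measurable (torus I)" if "i < k" for i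
      using that by (auto intro!: measurable_torus_component simp: I_def)
    hence "(\<lambda>t. x j t) \<in> borel_measurable (torus I)" "(\<lambda>t. y j t) \<in> borel_measurable (torus I)"
      unfolding x_def y_def
      by (auto intro!: borel_measurable_times borel_measurable_const borel_measurable_sum borel_measurable_power borel_measurable_cis)
    thus "x j \<in> borel_measurable (torus I)" "y j \<in> borel_measurable (torus I)" by simp_all
  qed
  have \<Phi>_int: "integrable (M \<Otimes>\<^sub>M torus I) (case_prod \<Phi>)"
  proof (rule Bochner_Integration.integrable_bound)
    have "distr (M \<Otimes>\<^sub>M torus I) M fst = M"
      by (rule T.distr_pair_fst)
    hence "integrable (distr (M \<Otimes>\<^sub>M torus I) M fst) H" using H_int by simp
    thus "integrable (M \<Otimes>\<^sub>M torus I) (\<lambda>p. H (fst p))"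
      using H_int by (subst (asm) integrable_distr_eq) auto
    have 1: "(\<lambda>p. N j (fst p)) \<in> borel_measurable (M \<Otimes>\<^sub>M torus I)" if "j \<in> {1..n}" for j
      using N_meas[OF that] by measurable
    have 2: "(\<lambda>p. x j (snd p)) \<in> borel_measurable (M \<Otimes>\<^sub>M torus I)" "(\<lambda>p. y j (snd p)) \<in> borel_measurable (M \<Otimes>\<^sub>M torus I)" for j
      using xy_meas by measurable
    have 3: "(\<lambda>p. cis (- (\<Sum>i\<in>I. real n * snd p i))) \<in> borel_measurable (M \<Otimes>\<^sub>M torus I)"
    proof -
      have "(\<lambda>t. cis (- (\<Sum>i\<in>I. real n * t i))) \<in> borel_measurable (torus I)" by measurable
      thus ?thesis by measurable
    qed
    have "(\<lambda>p. \<Phi> (fst p) (snd p)) \<in> borel_measurable (M \<Otimes>\<^sub>M torus I)"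
      unfolding \<Phi>_def
    proof (intro borel_measurable_times 3 borel_measurable_prod)
      fix j assume "j \<in> {1..n}"
      note [measurable] = 1[OF this] 2[of j]
      show "(\<lambda>p. exp (x j (snd p) * N j (fst p) + y j (snd p) * cnj (N j (fst p)))) \<in> borel_measurable (M \<Otimes>\<^sub>M torus I)"
        by measurable
    qed
    thus "case_prod \<Phi> \<in> borel_measurable (M \<Otimes>\<^sub>M torus I)" by (simp add: split_def)
    have "norm (\<Phi> \<omega> t) \<le> H \<omega>" for \<omega> t
    proof -
      have "norm (\<Phi> \<omega> t) = (\<Prod>j\<in>{1..n}. norm (exp (x j t * N j \<omega> + y j t * cnj (N j \<omega>))))"
        by (simp only: \<Phi>_def norm_mult norm_cis mult_1_left prod_norm)
      also have "\<dots> \<le> H \<omega>"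
        unfolding H_def
      proof (intro prod_mono conjI norm_ge_zero)
        fix j assume "j \<in> {1..n}"
        have sum_le: "cmod (\<Sum>i<k. cis (t (g i)) ^ j) \<le> real k" for g :: "nat \<Rightarrow> nat + nat"
          using norm_sum[of "\<lambda>i. cis (t (g i)) ^ j" "{..<k}"] by (simp add: norm_power)
        have "cmod (x j t) \<le> cmod (\<kappa> j) * k" "cmod (y j t) \<le> cmod (\<kappa> j) * k"
          unfolding x_def y_def norm_mult by (intro mult_left_mono sum_le norm_ge_zero)+
        hence "cmod (x j t) + cmod (y j t) \<le> C j"
          unfolding C_def by (rule add_mono)
        hence "cmod (x j t) * cmod (N j \<omega>) + cmod (y j t) * cmod (N j \<omega>) \<le> C j * cmod (N j \<omega>)"
          unfolding distrib_right[symmetric] by (rule mult_right_mono) simp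
        moreover have "cmod (x j t * N j \<omega> + y j t * cnj (N j \<omega>)) \<le> cmod (x j t) * cmod (N j \<omega>) + cmod (y j t) * cmod (N j \<omega>)"
          using norm_triangle_ineq[of "x j t * N j \<omega>" "y j t * cnj (N j \<omega>)"] by (simp add: norm_mult)
        ultimately have "cmod (x j t * N j \<omega> + y j t * cnj (N j \<omega>)) \<le> C j * cmod (N j \<omega>)" by linarith
        thus "norm (exp (x j t * N j \<omega> + y j t * cnj (N j \<omega>))) \<le> exp (C j * cmod (N j \<omega>))"
          by (intro order.trans[OF norm_exp]) simp
      qed
      finally show ?thesis .
    qed
    moreover have "H \<omega> \<ge> 0" for \<omega> by (auto simp: H_def intro!: prod_nonneg)
    ultimately show "AE p in M \<Otimes>\<^sub>M torus I. norm (case_prod \<Phi> p) \<le> norm (H (fst p))"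
      by (intro AE_I2) (simp add: split_def)
  qed
  have inner: "(\<integral>\<omega>. \<Phi> \<omega> t \<partial>M) = cis (- (\<Sum>i\<in>I. real n * t i)) *
      (\<Prod>p\<in>{..<k} \<times> {..<k}. exp (\<Sum>j=1..n. of_real (\<theta> / real j) * cis (t (Inl (fst p)) + t (Inr (snd p))) ^ j))" for t
  proof -
    have "(\<integral>\<omega>. (\<Prod>j\<in>{1..n}. exp (x j t * N j \<omega> + y j t * cnj (N j \<omega>))) \<partial>M) =
        (\<Prod>j\<in>{1..n}. \<integral>\<omega>. exp (x j t * N j \<omega> + y j t * cnj (N j \<omega>)) \<partial>M)"
    proof (rule indep_vars_lebesgue_integral)
      show "indep_vars (\<lambda>_. borel) (\<lambda>j \<omega>. exp (x j t * N j \<omega> + y j t * cnj (N j \<omega>))) {1..n}"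
        by (rule indep_vars_compose2[OF indep_n]) measurable
      show "integrable M (\<lambda>\<omega>. exp (x j t * N j \<omega> + y j t * cnj (N j \<omega>)))" if "j \<in> {1..n}" for j
        using that by (intro std_complex_normal_exp normal) auto
    qed auto
    also have "\<dots> = (\<Prod>j\<in>{1..n}. exp (x j t * y j t))"
      by (intro prod.cong refl std_complex_normal_exp normal) auto
    also have "\<dots> = exp (\<Sum>j=1..n. x j t * y j t)"
      by (simp add: exp_sum)
    also have "(\<Sum>j=1..n. x j t * y j t) =
        (\<Sum>j=1..n. \<Sum>p\<in>{..<k} \<times> {..<k}. of_real (\<theta> / real j) * cis (t (Inl (fst p)) + t (Inr (snd p))) ^ j)"
    proof (intro sum.cong refl)
      fix j assume "j \<in> {1..n}"
      \<comment> \<open>Pairing N_j with its conjugate squares the weight to \<theta> / j, a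
        coefficient of the logarithmic series. This is where the powers (1 - z_i w_j) powr
        (-\<theta>) come from.\<close>
      have \<kappa>2: "\<kappa> j * \<kappa> j = of_real (\<theta> / real j)"
      proof -
        have "\<kappa> j * \<kappa> j = of_real ((sqrt \<theta> * sqrt \<theta>) / (sqrt (real j) * sqrt (real j)))"
          by (simp only: \<kappa>_def of_real_mult of_real_divide times_divide_times_eq)
        thus ?thesis using \<theta> by simp
      qed
      have "x j t * y j t = (\<kappa> j * \<kappa> j) * ((\<Sum>i<k. cis (t (Inl i)) ^ j) * (\<Sum>i<k. cis (t (Inr i)) ^ j))"
        by (simp add: x_def y_def mult_ac)
      also have "\<dots> = (\<kappa> j * \<kappa> j) * (\<Sum>p\<in>{..<k} \<times> {..<k}. (cis (t (Inl (fst p))) * cis (t (Inr (snd p)))) ^ j)"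
        by (simp add: sum_product sum.cartesian_product split_def power_mult_distrib)
      finally show "x j t * y j t = (\<Sum>p\<in>{..<k} \<times> {..<k}. of_real (\<theta> / real j) * cis (t (Inl (fst p)) + t (Inr (snd p))) ^ j)"
        by (simp only: \<kappa>2 cis_mult sum_distrib_left)
    qed
    also have "\<dots> = (\<Sum>p\<in>{..<k} \<times> {..<k}. \<Sum>j=1..n. of_real (\<theta> / real j) * cis (t (Inl (fst p)) + t (Inr (snd p))) ^ j)"
      by (rule sum.swap)
    also have "exp \<dots> = (\<Prod>p\<in>{..<k} \<times> {..<k}. exp (\<Sum>j=1..n. of_real (\<theta> / real j) * cis (t (Inl (fst p)) + t (Inr (snd p))) ^ j))"
      by (simp add: exp_sum)
    finally show ?thesis
      unfolding \<Phi>_def by (simp only: integral_mult_right_zero)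
  qed
  have "complex_of_real (expectation (\<lambda>\<omega>. cmod (chaos_coeff \<theta> N n \<omega>) ^ (2 * k))) = (\<integral>\<omega>. (\<integral>t. \<Phi> \<omega> t \<partial>torus I) \<partial>M)"
    by (simp only: integral_complex_of_real[symmetric] pointwise)
  also have "\<dots> = (\<integral>t. (\<integral>\<omega>. \<Phi> \<omega> t \<partial>M) \<partial>torus I)"
    by (rule MT.Fubini_integral[OF \<Phi>_int, symmetric])
  also have "\<dots> = of_real (\<Sum>a\<in>line_matrices k n. \<Prod>p\<in>{..<k} \<times> {..<k}. neg_binom \<theta> (a p))"
    unfolding inner I_def by (rule line_matrix_sum_eq_integral)
  finally show ?thesis by (simp only: of_real_eq_iff)
qed

lemma line_matrix_sum_1:
  "(\<Sum>a\<in>line_matrices 1 n. \<Prod>p\<in>{..<1} \<times> {..<1}. neg_binom \<theta> (a p)) = neg_binom \<theta> n"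
proof -
  have K: "{..<1::nat} \<times> {..<1::nat} = {(0, 0)}" by auto
  have "line_matrices 1 n = {restrict (\<lambda>_. n) {(0, 0)}}"
  proof (intro equalityI subsetI)
    fix a assume "a \<in> line_matrices 1 n"
    hence a: "a \<in> {(0, 0)} \<rightarrow>\<^sub>E {..n}" "a (0, 0) = n" by (auto simp: line_matrices_def K)
    have "a = restrict (\<lambda>_. n) {(0, 0)}"
    proof
      fix p show "a p = restrict (\<lambda>_. n) {(0, 0)} p"
        using a PiE_arb[OF a(1), of p] by (cases "p = (0, 0)") auto
    qed
    thus "a \<in> {restrict (\<lambda>_. n) {(0, 0)}}" by simp
  next
    fix a assume "a \<in> {restrict (\<lambda>_. n) {(0 :: nat, 0 :: nat)}}"
    thus "a \<in> line_matrices 1 n" unfolding line_matrices_def K by (simp add: restrict_PiE_iff)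
  qed
  thus ?thesis unfolding K by (simp del: One_nat_def)
qed

theorem theorem1p7:
  fixes M :: "'a measure" and N :: "nat \<Rightarrow> 'a \<Rightarrow> complex" and \<theta> :: real and k :: nat
  assumes "prob_space M"
    and "prob_space.indep_vars M (\<lambda>_. borel) N {1..}"
    and "\<And>j. j \<ge> 1 \<Longrightarrow> std_complex_normal M (N j)"
    and "k \<ge> 1" and "\<theta> > 0" and "\<theta> * real k < 1"
  shows "(\<lambda>n. prob_space.expectation M (\<lambda>\<omega>. cmod (chaos_coeff \<theta> N n \<omega>) ^ (2 * k)) /
              prob_space.expectation M (\<lambda>\<omega>. cmod (chaos_coeff \<theta> N n \<omega>) ^ 2) ^ k)
         \<longlonglongrightarrow> Gamma (1 - real k * \<theta>) / Gamma (1 - \<theta>) ^ k * fact k"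
proof -
  interpret prob_space M by fact
  define R where "R = Gamma (1 - real k * \<theta>) / Gamma (1 - \<theta>) ^ k"
  have "\<theta> \<le> \<theta> * real k" using assms(4,5) by simp
  hence "R \<ge> 0"
    using assms(6) unfolding R_def
    by (intro divide_nonneg_nonneg zero_le_power less_imp_le Gamma_real_pos) (auto simp: mult.commute)
  have W_nonneg: "off_weight \<theta> k b \<ge> 0" for b
    unfolding off_weight_def by (intro prod_nonneg less_imp_le neg_binom_pos assms ballI)
  have nn: "(\<integral>\<^sup>+b. ennreal (off_weight \<theta> k b) \<partial>count_space (balanced k)) = ennreal R"
    unfolding R_def using assms by (intro nn_integral_off_weight) auto
  hence int: "integrable (count_space (balanced k)) (off_weight \<theta> k)"
    using W_nonneg by (intro integrableI_nonneg) auto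
  have "(\<integral>b. off_weight \<theta> k b \<partial>count_space (balanced k)) = R"
    using nn W_nonneg \<open>R \<ge> 0\<close> by (subst integral_eq_nn_integral) auto
  with line_matrix_sum_asymptotics[OF assms(5) int]
  have "(\<lambda>n. (\<Sum>a\<in>line_matrices k n. \<Prod>p\<in>{..<k} \<times> {..<k}. neg_binom \<theta> (a p)) / neg_binom \<theta> n ^ k)
      \<longlonglongrightarrow> R * fact k"
    by (simp add: mult.commute)
  \<comment> \<open>The moment formula at k = 1, where the only matrix has the single entry n. The
    denominator is thus exactly \<open>neg_binom \<theta> n ^ k\<close>, and the quotient is the
    normalised matrix sum.\<close>
  moreover have "expectation (\<lambda>\<omega>. cmod (chaos_coeff \<theta> N n \<omega>) ^ 2) = neg_binom \<theta> n" for n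
    using chaos_coeff_moment[OF assms(2,3,5), of n 1] unfolding line_matrix_sum_1 by simp
  ultimately show ?thesis
    by (simp add: chaos_coeff_moment[OF assms(2,3,5)] R_def)
qed

end
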